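(* Let $(X,\mathcal B)$ be an uncountable standard Borel space. Let $\mathcal R(1)$ be the set of Borel automorphisms of $X$ of rank $1$ and $\mathcal Od$ the set of odometers in $Aut(X,\mathcal B)$. Then $$\overline{\mathcal R(1)}^{\,\tau}=\overline{\mathcal Od}^{\,\tau}.$$
   Context: $Aut(X,\mathcal B)$ is the group of all one-to-one Borel automorphisms of $X$; $\overline{\,\cdot\,}^{\,\tau}$ is closure in $\tau$. The topology $\tau$ has as a base of neighborhoods the sets $U(T;\mu_1,\dots,\mu_n;\varepsilon)=\{S:\mu_j(E(S,T))<\varepsilon,\ j=1,\dots,n\}$, with $T\in Aut(X,\mathcal B)$, $\mu_j$ Borel probability measures on $X$, $\varepsilon>0$, where $E(S,T)=\{x: Tx\ne Sx\}\cup\{x: T^{-1}x\ne S^{-1}x\}$. Odometers: given integers $\lambda_t\ge2$, $t=0,1,2,\dots$, put $p_{-1}=1$, $p_t=\lambda_0\lambda_1\cdots\lambda_t$, and let $Z$ be the compact group of formal series $\sum_{i\ge0}x_ip_{i-1}$ with $x_i\in\{0,\dots,\lambda_i-1\}$ (addition with carry). The map $z\mapsto z+1$ on $Z$, and any Borel automorphism Borel isomorphic to such a map, is called an odometer. Rank 1: $T$ is smooth if there is a Borel set $A$ meeting every $T$-orbit exactly once. Let $T\in Aut(X,\mathcal B)$ be aperiodic (all orbits infinite) and non-smooth. A $T$-tower is a finite family $\xi=(B_0,TB_0,\dots,T^nB_0)$ of pairwise disjoint Borel sets (its atoms) with $B_0$ uncountable; its support is the union of its atoms. $T$ has rank $1$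 if there is a sequence $(\eta_n)$ of $T$-towers, with supports $Y_n$, such that $\eta_{n+1}$ refines $\eta_n$ for every $n$ (every atom of $\eta_{n+1}$ is contained in an atom of $\eta_n$ or is disjoint from $Y_n$), $Y_n\subset Y_{n+1}$, $\bigcup_nY_n=X$, and the collection of all atoms of all $\eta_n$ generates $\mathcal B$. *)

theory Defs
  imports "HOL-Probability.Probability" "HOL-Combinatorics.Permutations"
begin

definition standard_borel :: "'a measure \<Rightarrow> bool" where
  "standard_borel M \<longleftrightarrow>
     (\<exists>S. completely_metrizable_space S \<and> separable_space S \<and> topspace S = space M
        \<and> sets M = sigma_sets (topspace S) {U. openin S U})"

definition borel_isomorphism :: "'a measure \<Rightarrow> 'b measure \<Rightarrow> ('a \<Rightarrow> 'b) \<Rightarrow> bool" where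
  "borel_isomorphism M N f \<longleftrightarrow>
     bij_betw f (space M) (space N) \<and> f \<in> M \<rightarrow>\<^sub>M N \<and> inv_into (space M) f \<in> N \<rightarrow>\<^sub>M M"

text \<open>
  As HOL functions are total, an automorphism of \<^term>\<open>M\<close> is taken to be the identity outside
  \<^term>\<open>space M\<close> (this is part of \<^const>\<open>permutes\<close>). So equality of automorphisms is equality
  on \<^term>\<open>space M\<close>, and \<^term>\<open>inv T\<close> is the inverse automorphism.
\<close>

definition Aut :: "'a measure \<Rightarrow> ('a \<Rightarrow> 'a) set" where
  "Aut M = {T. T permutes space M \<and> T \<in> M \<rightarrow>\<^sub>M M \<and> inv T \<in> M \<rightarrow>\<^sub>M M}"

definition diff_set :: "'a measure \<Rightarrow> ('a \<Rightarrow> 'a) \<Rightarrow> ('a \<Rightarrow> 'a) \<Rightarrow> 'a set" where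
  "diff_set M S T = {x \<in> space M. T x \<noteq> S x} \<union> {x \<in> space M. inv T x \<noteq> inv S x}"

definition borel_probs :: "'a measure \<Rightarrow> 'a measure set" where
  "borel_probs M = {\<mu>. prob_space \<mu> \<and> sets \<mu> = sets M}"

definition tau_nbhd :: "'a measure \<Rightarrow> ('a \<Rightarrow> 'a) \<Rightarrow> 'a measure set \<Rightarrow> real \<Rightarrow> ('a \<Rightarrow> 'a) set" where
  "tau_nbhd M T F \<epsilon> = {S \<in> Aut M. \<forall>\<mu>\<in>F. measure \<mu> (diff_set M S T) < \<epsilon>}"

text \<open>The finite nonempty set \<^term>\<open>F\<close> plays the role of \<open>{\<mu>\<^sub>1, \<dots>, \<mu>\<^sub>n}\<close>.\<close>

definition tau_base :: "'a measure \<Rightarrow> ('a \<Rightarrow> 'a) set set" where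
  "tau_base M = {tau_nbhd M T F \<epsilon> | T F \<epsilon>.
     T \<in> Aut M \<and> finite F \<and> F \<noteq> {} \<and> F \<subseteq> borel_probs M \<and> \<epsilon> > 0}"

text \<open>
  On a standard Borel space the sets generating \<open>\<tau>\<close> below form a base, and those centred at
  \<^term>\<open>T\<close> form a neighbourhood base at \<^term>\<open>T\<close>; see lemma \<open>openin_tau_iff\<close>.
\<close>

definition tau :: "'a measure \<Rightarrow> ('a \<Rightarrow> 'a) topology" where
  "tau M = topology_generated_by (tau_base M)"

lemma neq_set_measurable:
  assumes "standard_borel M" "f \<in> M \<rightarrow>\<^sub>M M" "g \<in> M \<rightarrow>\<^sub>M M"
  shows "{x \<in> space M. f x \<noteq> g x} \<in> sets M"
proof -
  obtain S where S: "completely_metrizable_space S" "separable_space S" "topspace S = space M"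
    "sets M = sigma_sets (topspace S) {U. openin S U}"
    using assms(1) unfolding standard_borel_def by blast
  obtain X d where X: "Metric_space X d" "S = Metric_space.mtopology X d"
    using S(1) unfolding completely_metrizable_space_def by blast
  interpret Metric_space X d by fact
  have XM: "X = space M" using S(3) X(2) by simp
  obtain C where C: "countable C" "C \<subseteq> X" "mtopology closure_of C = X"
    using S(2) X(2) unfolding separable_space_def by auto
  have ball: "mball c q \<in> sets M" for c q
    unfolding S(4) X(2) using openin_mball by blast
  have eq: "{x \<in> space M. f x \<noteq> g x} =
    (\<Union>c\<in>C. \<Union>q\<in>\<rat>. (f -` mball c q \<inter> space M) - (g -` mball c q \<inter> space M))" (is "?L = ?R")
  proof
    show "?L \<subseteq> ?R"
    proof
      fix x assume "x \<in> ?L"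
      then have x: "x \<in> space M" "f x \<noteq> g x" by auto
      then have fg: "f x \<in> X" "g x \<in> X"
        using assms(2,3) XM by (auto dest: measurable_space)
      define r where "r = d (f x) (g x)"
      have r: "r > 0" using fg x by (simp add: r_def)
      have "f x \<in> mtopology closure_of C" using C fg by simp
      then obtain c where c: "c \<in> C" "d (f x) c < r / 3"
        unfolding metric_closure_of using r by (auto dest!: spec[of _ "r/3"])
      obtain q where q: "q \<in> \<rat>" "r / 3 < q" "q < r / 2"
        using Rats_dense_in_real[of "r/3" "r/2"] r by auto
      have cX: "c \<in> X" using C c by auto
      have "f x \<in> mball c q" using c q fg cX by (simp add: commute)
      moreover have "g x \<notin> mball c q"
      proof
        assume "g x \<in> mball c q"
        then have "d c (g x) < q" by simp
        moreover have "d (f x) (g x) \<le> d (f x) c + d c (g x)"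
          using triangle fg cX by blast
        ultimately show False using c q by (simp add: r_def)
      qed
      ultimately show "x \<in> ?R" using c q x by auto
    qed
  qed auto
  have "?R \<in> sets M"
    by (intro sets.countable_UN'' sets.Diff measurable_sets[OF assms(2)] measurable_sets[OF assms(3)] ball C(1)
        countable_rat)
  then show ?thesis using eq by simp
qed

lemma diff_set_measurable:
  assumes "standard_borel M" "S \<in> Aut M" "T \<in> Aut M"
  shows "diff_set M S T \<in> sets M"
  using assms unfolding diff_set_def Aut_def by (intro sets.Un neq_set_measurable) auto

lemma diff_set_self [simp]: "diff_set M T T = {}"
  by (auto simp: diff_set_def)

lemma diff_set_measure_triangle:
  assumes "standard_borel M" "S \<in> Aut M" "R \<in> Aut M" "T \<in> Aut M" "\<mu> \<in> borel_probs M"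
  shows "measure \<mu> (diff_set M S T) \<le> measure \<mu> (diff_set M S R) + measure \<mu> (diff_set M R T)"
proof -
  interpret prob_space \<mu> using assms(5) by (simp add: borel_probs_def)
  have [measurable]: "diff_set M S R \<in> sets \<mu>" "diff_set M R T \<in> sets \<mu>"
    using assms diff_set_measurable by (auto simp: borel_probs_def)
  have "measure \<mu> (diff_set M S T) \<le> measure \<mu> (diff_set M S R \<union> diff_set M R T)"
  proof (rule finite_measure_mono)
    show "diff_set M S T \<subseteq> diff_set M S R \<union> diff_set M R T"
      by (auto simp: diff_set_def)
  qed measurable
  also have "\<dots> \<le> measure \<mu> (diff_set M S R) + measure \<mu> (diff_set M R T)"
    by (rule measure_Un_le) auto
  finally show ?thesis .
qed

lemma openin_tau_iff:
  assumes M: "standard_borel M"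
  shows "openin (tau M) W \<longleftrightarrow>
    W \<subseteq> Aut M \<and>
    (\<forall>T\<in>W. \<exists>F \<epsilon>. finite F \<and> F \<noteq> {} \<and> F \<subseteq> borel_probs M \<and> \<epsilon> > 0 \<and> tau_nbhd M T F \<epsilon> \<subseteq> W)"
    (is "_ \<longleftrightarrow> ?N W")
proof
  assume "openin (tau M) W"
  then have "generate_topology_on (tau_base M) W"
    by (simp add: tau_def openin_topology_generated_by_iff)
  then show "?N W"
  proof (induction rule: generate_topology_on.induct)
    case (Int U V)
    show ?case
    proof (intro conjI ballI)
      fix T assume "T \<in> U \<inter> V"
      then obtain F e G e' where
        F: "finite F" "F \<noteq> {}" "F \<subseteq> borel_probs M" "e > 0" "tau_nbhd M T F e \<subseteq> U" and
        G: "finite G" "G \<noteq> {}" "G \<subseteq> borel_probs M" "e' > 0" "tau_nbhd M T G e' \<subseteq> V"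
        using Int by (metis IntD1 IntD2)
      have "tau_nbhd M T (F \<union> G) (min e e') \<subseteq> tau_nbhd M T F e \<inter> tau_nbhd M T G e'"
        by (auto simp: tau_nbhd_def)
      then have "tau_nbhd M T (F \<union> G) (min e e') \<subseteq> U \<inter> V" using F G by blast
      then show "\<exists>F \<epsilon>. finite F \<and> F \<noteq> {} \<and> F \<subseteq> borel_probs M \<and> \<epsilon> > 0 \<and> tau_nbhd M T F \<epsilon> \<subseteq> U \<inter> V"
        using F G by (intro exI[of _ "F \<union> G"] exI[of _ "min e e'"]) auto
    qed (use Int in auto)
  next
    case (UN K)
    show ?case
    proof (intro conjI ballI)
      show "\<Union> K \<subseteq> Aut M" using UN by blast
      fix T assume "T \<in> \<Union> K"
      then obtain k where "k \<in> K" "T \<in> k" by blast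
      then show "\<exists>F \<epsilon>. finite F \<and> F \<noteq> {} \<and> F \<subseteq> borel_probs M \<and> \<epsilon> > 0 \<and> tau_nbhd M T F \<epsilon> \<subseteq> \<Union> K"
        using UN(2)[of k] by (meson Sup_upper order_trans)
    qed
  next
    case (Basis U)
    then obtain T F e where U: "U = tau_nbhd M T F e" "T \<in> Aut M" "finite F" "F \<noteq> {}"
      "F \<subseteq> borel_probs M" "e > 0" by (auto simp: tau_base_def)
    show ?case
    proof (intro conjI ballI)
      fix R assume R: "R \<in> U"
      define e' where "e' = Min ((\<lambda>\<mu>. e - measure \<mu> (diff_set M R T)) ` F)"
      have RA: "R \<in> Aut M" using R U by (auto simp: tau_nbhd_def)
      have "e' > 0" using R U by (auto simp: e'_def tau_nbhd_def)
      have "tau_nbhd M R F e' \<subseteq> U"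
      proof
        fix S assume S: "S \<in> tau_nbhd M R F e'"
        have "measure \<mu> (diff_set M S T) < e" if "\<mu> \<in> F" for \<mu>
        proof -
          have "e' \<le> e - measure \<mu> (diff_set M R T)"
            using that U(3) by (auto simp: e'_def intro: Min_le)
          moreover have "measure \<mu> (diff_set M S R) < e'" using S that by (auto simp: tau_nbhd_def)
          ultimately show ?thesis
            using diff_set_measure_triangle[OF M _ RA U(2), of S \<mu>] S that subsetD[OF U(5) that]
            by (auto simp: tau_nbhd_def)
        qed
        then show "S \<in> U" using S U by (auto simp: tau_nbhd_def)
      qed
      then show "\<exists>F \<epsilon>. finite F \<and> F \<noteq> {} \<and> F \<subseteq> borel_probs M \<and> \<epsilon> > 0 \<and> tau_nbhd M R F \<epsilon> \<subseteq> U"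
        using U \<open>e' > 0\<close> by blast
    qed (use U in \<open>auto simp: tau_nbhd_def\<close>)
  qed auto
next
  assume N: "?N W"
  then have "\<exists>V. openin (tau M) V \<and> T \<in> V \<and> V \<subseteq> W" if T: "T \<in> W" for T
  proof -
    obtain F e where F: "finite F" "F \<noteq> {}" "F \<subseteq> borel_probs M" "e > 0" "tau_nbhd M T F e \<subseteq> W"
      using N T by blast
    have TA: "T \<in> Aut M" using N T by blast
    have "openin (tau M) (tau_nbhd M T F e)"
      unfolding tau_def using F TA
      by (intro topology_generated_by_Basis) (unfold tau_base_def, blast)
    moreover have "T \<in> tau_nbhd M T F e" using TA F by (auto simp: tau_nbhd_def)
    ultimately show ?thesis using F by blast
  qed
  then show "openin (tau M) W" using openin_subopen by blast
qed

lemma topspace_tau: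
  assumes "standard_borel M" "space M \<noteq> {}"
  shows "topspace (tau M) = Aut M"
proof
  show "topspace (tau M) \<subseteq> Aut M"
    by (auto simp: tau_def tau_base_def tau_nbhd_def)
  obtain a where "a \<in> space M" using assms(2) by blast
  then have ret: "return M a \<in> borel_probs M"
    by (auto simp: borel_probs_def intro: prob_space_return)
  have "openin (tau M) (Aut M)"
    unfolding openin_tau_iff[OF assms(1)]
    using ret by (auto simp: tau_nbhd_def intro!: exI[of _ "{return M a}"] exI[of _ "1::real"])
  then show "Aut M \<subseteq> topspace (tau M)" by (rule openin_subset)
qed

text \<open>
  The formal series \<open>\<Sum>\<^sub>i x\<^sub>i p\<^sub>i\<^sub>-\<^sub>1\<close> is represented by its digit sequence \<open>x\<close>. Since
  \<open>p\<^sub>i = \<lambda>\<^sub>i p\<^sub>i\<^sub>-\<^sub>1\<close>, a digit sum of at least \<open>\<lambda>\<^sub>i\<close> in position \<open>i\<close> carries into position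
  \<open>i + 1\<close>. The Borel structure is that of the product topology, i.e. of the library's topology
  on functions, with \<^typ>\<open>nat\<close> discrete.
\<close>

definition odo_carrier :: "(nat \<Rightarrow> nat) \<Rightarrow> (nat \<Rightarrow> nat) set" where
  "odo_carrier l = {x. \<forall>i. x i < l i}"

primrec odo_carry :: "(nat \<Rightarrow> nat) \<Rightarrow> (nat \<Rightarrow> nat) \<Rightarrow> (nat \<Rightarrow> nat) \<Rightarrow> nat \<Rightarrow> nat" where
  "odo_carry l x y 0 = 0"
| "odo_carry l x y (Suc i) = (x i + y i + odo_carry l x y i) div l i"

definition odo_add :: "(nat \<Rightarrow> nat) \<Rightarrow> (nat \<Rightarrow> nat) \<Rightarrow> (nat \<Rightarrow> nat) \<Rightarrow> nat \<Rightarrow> nat" where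
  "odo_add l x y = (\<lambda>i. (x i + y i + odo_carry l x y i) mod l i)"

definition odo_one :: "nat \<Rightarrow> nat" where
  "odo_one = (\<lambda>i. if i = 0 then 1 else 0)"

definition odo_space :: "(nat \<Rightarrow> nat) \<Rightarrow> (nat \<Rightarrow> nat) measure" where
  "odo_space l = restrict_space borel (odo_carrier l)"

definition odometers :: "'a measure \<Rightarrow> ('a \<Rightarrow> 'a) set" where
  "odometers M = {T \<in> Aut M. \<exists>l \<phi>. (\<forall>t. l t \<ge> 2) \<and> borel_isomorphism M (odo_space l) \<phi>
     \<and> (\<forall>x\<in>space M. \<phi> (T x) = odo_add l (\<phi> x) odo_one)}"

definition full_orbit :: "('a \<Rightarrow> 'a) \<Rightarrow> 'a \<Rightarrow> 'a set" where
  "full_orbit T x = (\<Union>n. {(T ^^ n) x, (inv T ^^ n) x})"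

definition aperiodic :: "'a measure \<Rightarrow> ('a \<Rightarrow> 'a) \<Rightarrow> bool" where
  "aperiodic M T \<longleftrightarrow> (\<forall>x\<in>space M. infinite (full_orbit T x))"

definition smooth_aut :: "'a measure \<Rightarrow> ('a \<Rightarrow> 'a) \<Rightarrow> bool" where
  "smooth_aut M T \<longleftrightarrow> (\<exists>A\<in>sets M. \<forall>x\<in>space M. \<exists>!y. y \<in> A \<inter> full_orbit T x)"

text \<open>The tower \<open>(B, T B, \<dots>, T\<^sup>n B)\<close> is represented by its base \<open>B\<close> and the number \<open>n\<close>.\<close>

definition is_tower :: "'a measure \<Rightarrow> ('a \<Rightarrow> 'a) \<Rightarrow> 'a set \<Rightarrow> nat \<Rightarrow> bool" where
  "is_tower M T B n \<longleftrightarrow>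
     (\<forall>i\<le>n. (T ^^ i) ` B \<in> sets M) \<and> disjoint_family_on (\<lambda>i. (T ^^ i) ` B) {..n} \<and> uncountable B"

definition atoms :: "('a \<Rightarrow> 'a) \<Rightarrow> 'a set \<Rightarrow> nat \<Rightarrow> 'a set set" where
  "atoms T B n = (\<lambda>i. (T ^^ i) ` B) ` {..n}"

definition rank_one :: "'a measure \<Rightarrow> ('a \<Rightarrow> 'a) \<Rightarrow> bool" where
  "rank_one M T \<longleftrightarrow> T \<in> Aut M \<and> aperiodic M T \<and> \<not> smooth_aut M T \<and>
     (\<exists>B h. (\<forall>n. is_tower M T (B n) (h n))
        \<and> (\<forall>n. \<forall>a\<in>atoms T (B (Suc n)) (h (Suc n)).
             (\<exists>b\<in>atoms T (B n) (h n). a \<subseteq> b) \<or> a \<inter> \<Union>(atoms T (B n) (h n)) = {})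
        \<and> (\<forall>n. \<Union>(atoms T (B n) (h n)) \<subseteq> \<Union>(atoms T (B (Suc n)) (h (Suc n))))
        \<and> (\<Union>n. \<Union>(atoms T (B n) (h n))) = space M
        \<and> sigma_sets (space M) (\<Union>n. atoms T (B n) (h n)) = sets M)"

end

theory Submission
  imports Defs
begin

text \<open>
  An odometer has rank one: the points with given first \<open>n\<close> digits form a tower covering the whole space, and
  an odometer cannot be smooth because it preserves a probability measure, the transported Haar
  measure. So one inclusion is clear.

  Conversely let \<open>T\<close> have rank one with towers \<open>\<eta>\<^sub>n\<close>. Any finite chain of uncountable Borel levels that are
  carried onto each other, together with an empty or uncountable rest (used as one more level), extends to
  an odometer, since by Kuratowski's theorem all uncountable Borel sets are isomorphic to the Cantor space. We
  cut \<open>\<eta>\<^sub>n\<close> at two consecutive levels that are small for the given finitely many measures; they exist because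
  the heights of the towers tend to infinity. The two ends of \<open>\<eta>\<^sub>n\<close> are joined by a map \<open>\<sigma>\<close> from the top
  level onto the base. It agrees with \<open>T\<close> up to small sets: either \<open>\<eta>\<^sub>n\<close> is the whole space for large \<open>n\<close>, and
  then \<open>T\<close> itself maps the top level onto the base, or (here non-smoothness enters) the bases are nested whenever they
  meet, so that at most one point lies in infinitely many of them, and \<open>\<sigma>\<close> can be made
  to agree with \<open>T\<close> at its predecessor.
\<close>

section \<open>Borel embeddings\<close>

text \<open>The neighbourhoods of \<open>tau\<close> test arbitrary probability measures, which need
  not be invariant under \<open>T\<close> and may have atoms. So no level is small by itself, and
  not even one point may be neglected. Averaging meets the first difficulty: levels of a tower are
  disjoint, so among many consecutive pairs one is light for all the given measures. For the second,
  each remaining error set must vanish pointwise, every point leaving it eventually; continuity from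
  above then sends its mass to 0 for every probability measure. A point that never left could carry
  a Dirac mass, whence the care at the single point common to infinitely many bases.

  As \<open>diff_set\<close> also compares inverses, a cut between levels \<open>i - 1\<close> and
  \<open>i\<close> costs both: images of the former and preimages of the latter are no longer
  prescribed.

  The odometers built here have bases \<open>H, 2, 2, ...\<close>: the first digit is the level, the
  other digits are a Cantor coordinate inside it. Kuratowski's theorem comes from Borel embeddings
  both ways: distances to a dense sequence embed the space in real sequences and these in the Cantor
  space, and the perfect set theorem embeds the Cantor space back.\<close>

definition borel_embedding :: "'a measure \<Rightarrow> 'b measure \<Rightarrow> ('a \<Rightarrow> 'b) \<Rightarrow> bool" where
  "borel_embedding M N f \<longleftrightarrow> f \<in> M \<rightarrow>\<^sub>M N \<and> inj_on f (space M) \<and> (\<forall>A\<in>sets M. f ` A \<in> sets N)"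

lemma borel_isomorphismI:
  assumes "bij_betw f (space M) (space N)" "f \<in> M \<rightarrow>\<^sub>M N" "\<And>A. A \<in> sets M \<Longrightarrow> f ` A \<in> sets N"
  shows "borel_isomorphism M N f"
proof -
  have "inv_into (space M) f \<in> N \<rightarrow>\<^sub>M M"
  proof (rule measurableI)
    fix x assume "x \<in> space N"
    then show "inv_into (space M) f x \<in> space M"
      using assms(1) by (metis bij_betw_imp_surj_on inv_into_into)
  next
    fix A assume A: "A \<in> sets M"
    have "inv_into (space M) f -` A \<inter> space N = f ` A"
      using assms(1) sets.sets_into_space[OF A]
      by (force simp: bij_betw_def inv_into_f_f image_iff f_inv_into_f subset_iff)
    then show "inv_into (space M) f -` A \<inter> space N \<in> sets N" using assms(3)[OF A] by simp
  qed
  then show ?thesis using assms by (simp add: borel_isomorphism_def)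
qed

lemma borel_isomorphism_imp_embedding:
  assumes "borel_isomorphism M N f"
  shows "borel_embedding M N f"
proof -
  have bij: "bij_betw f (space M) (space N)" and f: "f \<in> M \<rightarrow>\<^sub>M N"
    and g: "inv_into (space M) f \<in> N \<rightarrow>\<^sub>M M"
    using assms by (auto simp: borel_isomorphism_def)
  have "f ` A \<in> sets N" if A: "A \<in> sets M" for A
  proof -
    have "inv_into (space M) f -` A \<inter> space N = f ` A"
      using bij sets.sets_into_space[OF A]
      by (force simp: bij_betw_def inv_into_f_f image_iff f_inv_into_f subset_iff)
    then show ?thesis using measurable_sets[OF g A] by simp
  qed
  then show ?thesis using f bij by (auto simp: borel_embedding_def bij_betw_def)
qed

lemma borel_isomorphism_iff_embedding:
  "borel_isomorphism M N f \<longleftrightarrow> borel_embedding M N f \<and> f ` space M = space N"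
  using borel_isomorphismI[of f M N] borel_isomorphism_imp_embedding[of M N f]
  by (auto simp: borel_embedding_def bij_betw_def borel_isomorphism_def)

lemma borel_isomorphism_inv:
  assumes "borel_isomorphism M N f"
  shows "borel_isomorphism N M (inv_into (space M) f)"
proof (rule borel_isomorphismI)
  have bij: "bij_betw f (space M) (space N)" and f: "f \<in> M \<rightarrow>\<^sub>M N"
    and g: "inv_into (space M) f \<in> N \<rightarrow>\<^sub>M M"
    using assms by (auto simp: borel_isomorphism_def)
  show "bij_betw (inv_into (space M) f) (space N) (space M)" by (rule bij_betw_inv_into[OF bij])
  show "inv_into (space M) f \<in> N \<rightarrow>\<^sub>M M" by (rule g)
  fix A assume A: "A \<in> sets N"
  have "inv_into (space M) f ` A = f -` A \<inter> space M"
    using bij sets.sets_into_space[OF A]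
    by (force simp: bij_betw_def inv_into_f_f image_iff f_inv_into_f subset_iff)
  then show "inv_into (space M) f ` A \<in> sets M" using measurable_sets[OF f A] by simp
qed

lemma borel_embedding_comp:
  assumes "borel_embedding M N f" "borel_embedding N K g"
  shows "borel_embedding M K (g \<circ> f)"
  unfolding borel_embedding_def
proof (intro conjI ballI)
  show "g \<circ> f \<in> M \<rightarrow>\<^sub>M K"
    using assms by (auto simp: borel_embedding_def intro: measurable_comp)
  show "inj_on (g \<circ> f) (space M)"
    using assms unfolding borel_embedding_def
    by (metis comp_inj_on inj_on_subset measurable_space image_subsetI)
  show "(g \<circ> f) ` A \<in> sets K" if "A \<in> sets M" for A
    using assms that unfolding image_comp[symmetric] by (auto simp: borel_embedding_def)
qed

lemma borel_isomorphism_comp: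
  assumes "borel_isomorphism M N f" "borel_isomorphism N K g"
  shows "borel_isomorphism M K (g \<circ> f)"
  using assms borel_embedding_comp[of M N f K g]
  unfolding borel_isomorphism_iff_embedding image_comp[symmetric] by auto

lemma borel_embedding_restrict_image:
  assumes f: "borel_embedding M N f" and B: "B \<in> sets M"
  shows "borel_isomorphism (restrict_space M B) (restrict_space N (f ` B)) f"
proof -
  have B': "B \<subseteq> space M" "f ` B \<subseteq> space N"
    using sets.sets_into_space[OF B] f by (auto simp: borel_embedding_def dest: measurable_space)
  have sp: "space (restrict_space M B) = B" "space (restrict_space N (f ` B)) = f ` B"
    using B' by (auto simp: space_restrict_space)
  show ?thesis
    unfolding borel_isomorphism_iff_embedding borel_embedding_def
  proof (intro conjI ballI)
    show "f \<in> restrict_space M B \<rightarrow>\<^sub>M restrict_space N (f ` B)"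
      using f B' by (intro measurable_restrict_space3) (auto simp: borel_embedding_def)
    show "inj_on f (space (restrict_space M B))"
      using f B' sp by (auto simp: borel_embedding_def intro: inj_on_subset)
    show "f ` space (restrict_space M B) = space (restrict_space N (f ` B))" by (simp add: sp)
    fix A assume "A \<in> sets (restrict_space M B)"
    then have "A \<in> sets M" "A \<subseteq> B" using B sets.Int[of B M]
      by (auto simp: sets_restrict_space_iff B' sets_restrict_space)
    moreover from this have "f ` A \<in> sets N" "f ` B \<in> sets N" using f B by (auto simp: borel_embedding_def)
    ultimately show "f ` A \<in> sets (restrict_space N (f ` B))"
      by (subst sets_restrict_space_iff) auto
  qed
qed

lemma borel_embedding_restrict_dom:
  assumes "borel_embedding M N f" "B \<in> sets M"
  shows "borel_embedding (restrict_space M B) N f"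
  using assms unfolding borel_embedding_def
  by (auto simp: measurable_restrict_space1 space_restrict_space sets_restrict_space
      intro: inj_on_subset[OF _ sets.sets_into_space])

lemma borel_embedding_restrict_cod:
  assumes "borel_embedding M N f" "B \<in> sets N" "f ` space M \<subseteq> B"
  shows "borel_embedding M (restrict_space N B) f"
  using assms sets.sets_into_space unfolding borel_embedding_def
  by (auto simp: measurable_restrict_space2_iff sets_restrict_space_iff) blast

lemma borel_embedding_extend_cod:
  assumes "borel_embedding M (restrict_space N B) f" "B \<in> sets N"
  shows "borel_embedding M N f"
  using assms sets.Int unfolding borel_embedding_def
  by (auto simp: measurable_restrict_space2_iff sets_restrict_space_iff)

text \<open>Measurability of images is part of \<open>borel_embedding\<close>, in place of an appeal
  to the Lusin-Souslin theorem, so it has to be checked by hand. Generators suffice: injectivity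
  makes images commute with complements, hence the sets with measurable image form a
  sigma-algebra.\<close>

lemma images_measurable_generator:
  assumes "sets M = sigma_sets (space M) G" "inj_on f (space M)" "f ` space M \<in> sets N"
    and "\<And>a. a \<in> G \<Longrightarrow> f ` a \<in> sets N" and "A \<in> sets M"
  shows "f ` A \<in> sets N"
proof -
  have "A \<in> sigma_sets (space M) G" using assms by simp
  then show ?thesis
  proof induction
    case (Compl a)
    then have "a \<subseteq> space M" using assms(1) sets.sets_into_space by blast
    then have "f ` (space M - a) = f ` space M - f ` a"
      by (intro inj_on_image_set_diff[OF assms(2)]) auto
    then show ?case using Compl assms(3) by simp
  qed (auto simp: image_UN assms(4))
qed

text \<open>With a measurable left inverse \<open>g\<close>, the image of \<open>A\<close> consists
  of the fixed points of \<open>f \<circ> g\<close> that \<open>g\<close> sends into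
  \<open>A\<close>.\<close>

lemma borel_embedding_retract:
  assumes f: "f \<in> M \<rightarrow>\<^sub>M N" and g: "g \<in> N \<rightarrow>\<^sub>M M" and gf: "\<And>x. x \<in> space M \<Longrightarrow> g (f x) = x"
    and fixpt: "{y \<in> space N. f (g y) = y} \<in> sets N"
  shows "borel_embedding M N f"
  unfolding borel_embedding_def
proof (intro conjI ballI)
  show "inj_on f (space M)" using gf by (metis inj_onI)
  fix A assume A: "A \<in> sets M"
  have "f ` A = (g -` A \<inter> space N) \<inter> {y \<in> space N. f (g y) = y}"
  proof
    show "f ` A \<subseteq> (g -` A \<inter> space N) \<inter> {y \<in> space N. f (g y) = y}"
      using sets.sets_into_space[OF A] gf measurable_space[OF f] by auto
    show "(g -` A \<inter> space N) \<inter> {y \<in> space N. f (g y) = y} \<subseteq> f ` A"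
      by (auto simp: image_iff) metis
  qed
  then show "f ` A \<in> sets N" using measurable_sets[OF g A] fixpt by auto
qed (rule f)

text \<open>The Cantor-Schroeder-Bernstein argument: \<open>A\<close> collects all iterates under
  \<open>g \<circ> f\<close> of the points missed by \<open>g\<close>; \<open>h\<close> is
  \<open>f\<close> on \<open>A\<close> and inverts \<open>g\<close> elsewhere. Both maps send
  measurable sets to measurable sets, which makes \<open>A\<close>, and with it \<open>h\<close>,
  measurable.\<close>

lemma borel_schroeder_bernstein:
  assumes f: "borel_embedding M N f" and g: "borel_embedding N M g"
  shows "\<exists>h. borel_isomorphism M N h"
proof -
  define A where "A = (\<Union>n. ((g \<circ> f) ^^ n) ` (space M - g ` space N))"
  define h where "h x = (if x \<in> A then f x else inv_into (space N) g x)" for x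
  have fm: "f \<in> M \<rightarrow>\<^sub>M N" "g \<in> N \<rightarrow>\<^sub>M M" and inj: "inj_on f (space M)" "inj_on g (space N)"
    and im: "\<And>X. X \<in> sets M \<Longrightarrow> f ` X \<in> sets N" "\<And>X. X \<in> sets N \<Longrightarrow> g ` X \<in> sets M"
    using f g by (auto simp: borel_embedding_def)
  have fs: "x \<in> space M \<Longrightarrow> f x \<in> space N" and gs: "y \<in> space N \<Longrightarrow> g y \<in> space M" for x y
    using fm by (auto dest: measurable_space)
  have "((g \<circ> f) ^^ n) ` (space M - g ` space N) \<in> sets M" for n
  proof (induction n)
    case (Suc n)
    have "((g \<circ> f) ^^ Suc n) ` (space M - g ` space N)
        = g ` f ` (((g \<circ> f) ^^ n) ` (space M - g ` space N))"
      by (simp add: image_comp o_assoc)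
    then show ?case using im(2)[OF im(1)[OF Suc]] by (simp only:)
  qed (use im in auto)
  then have A: "A \<in> sets M" by (auto simp: A_def)
  then have AM: "A \<subseteq> space M" by (rule sets.sets_into_space)
  have notA: "x \<in> g ` space N" if "x \<in> space M" "x \<notin> A" for x
    using that unfolding A_def by (auto dest: spec[of _ 0])
  have stepA: "g (f x) \<in> A" if "x \<in> A" for x
  proof -
    from that obtain n y where "y \<in> space M - g ` space N" "x = ((g \<circ> f) ^^ n) y"
      by (auto simp: A_def)
    then show ?thesis unfolding A_def by (intro UN_I[of "Suc n"]) auto
  qed
  have stepA': "\<exists>x\<in>A. y = f x" if y: "y \<in> space N" "g y \<in> A" for y
  proof -
    obtain n z where z: "z \<in> space M - g ` space N" "g y = ((g \<circ> f) ^^ n) z"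
      using y by (auto simp: A_def)
    show ?thesis
    proof (cases n)
      case 0
      then show ?thesis using z y by auto
    next
      case (Suc m)
      define x where "x = ((g \<circ> f) ^^ m) z"
      have x: "x \<in> A" using z by (auto simp: A_def x_def)
      have "g y = g (f x)" using z Suc by (simp add: x_def)
      then have "y = f x" using inj(2) y fs x AM by (auto dest: inj_onD)
      then show ?thesis using x by blast
    qed
  qed
  have hg: "h (g y) = y" if "y \<in> space N" "g y \<notin> A" for y
    using that inj(2) by (simp add: h_def)
  \<comment> \<open>Off \<open>A\<close> the map \<open>h\<close> inverts \<open>g\<close>, so its
    images there are preimages under \<open>g\<close>; measurability of images then follows from
    that of \<open>g\<close>.\<close>
  have img: "h ` X = f ` (X \<inter> A) \<union> (g -` (X - A) \<inter> space N)" if X: "X \<subseteq> space M" for X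
  proof (intro set_eqI iffI)
    fix y assume "y \<in> h ` X"
    then obtain x where x: "x \<in> X" "y = h x" by auto
    show "y \<in> f ` (X \<inter> A) \<union> (g -` (X - A) \<inter> space N)"
    proof (cases "x \<in> A")
      case False
      then obtain z where "z \<in> space N" "x = g z" using notA x X by blast
      then show ?thesis using hg False x by auto
    qed (use x in \<open>auto simp: h_def\<close>)
  next
    fix y assume "y \<in> f ` (X \<inter> A) \<union> (g -` (X - A) \<inter> space N)"
    then show "y \<in> h ` X" using hg by (force simp: h_def image_iff)
  qed
  have "borel_isomorphism M N h"
  proof (rule borel_isomorphismI)
    have "inj_on h (space M)"
    proof (rule inj_onI)
      fix x y assume xy: "x \<in> space M" "y \<in> space M" "h x = h y"
      have key: False if *: "x \<in> A" "y \<in> space M" "y \<notin> A" "h x = h y" for x y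
      proof -
        obtain z where z: "z \<in> space N" "y = g z" using notA * by blast
        then have "f x = z" using hg * by (auto simp: h_def)
        then show False using stepA[OF *(1)] z * by simp
      qed
      show "x = y"
      proof (cases "x \<in> A \<longleftrightarrow> y \<in> A")
        case True
        show ?thesis
        proof (cases "x \<in> A")
          case True
          then show ?thesis using xy \<open>x \<in> A \<longleftrightarrow> y \<in> A\<close> inj(1) by (auto simp: h_def dest: inj_onD)
        next
          case False
          then obtain a b where "a \<in> space N" "x = g a" "b \<in> space N" "y = g b"
            using notA xy True by blast
          then show ?thesis using hg False True xy by auto
        qed
      next
        case False
        then show ?thesis using key[of x y] key[of y x] xy by auto
      qed
    qed
    moreover have "h ` space M = space N"
      using img[of "space M"] AM fs gs stepA' by (auto simp: image_iff subset_iff) blast+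
    ultimately show "bij_betw h (space M) (space N)" by (simp add: bij_betw_def)
    show "h ` X \<in> sets N" if "X \<in> sets M" for X
      using that A im fm(2) sets.sets_into_space[OF that]
      by (subst img) (auto intro!: sets.Un measurable_sets[OF fm(2)])
    show "h \<in> M \<rightarrow>\<^sub>M N"
    proof (rule measurableI)
      fix x assume x: "x \<in> space M"
      then show "h x \<in> space N" using \<open>h ` space M = space N\<close> by auto
    next
      fix Y assume Y: "Y \<in> sets N"
      have YN: "Y \<subseteq> space N" by (rule sets.sets_into_space[OF Y])
      have "h -` Y \<inter> space M = ((f -` Y \<inter> space M) \<inter> A) \<union> (g ` Y - A)"
      proof (intro set_eqI iffI)
        fix x assume x: "x \<in> h -` Y \<inter> space M"
        show "x \<in> ((f -` Y \<inter> space M) \<inter> A) \<union> (g ` Y - A)"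
        proof (cases "x \<in> A")
          case False
          then obtain z where "z \<in> space N" "x = g z" using notA x by blast
          then show ?thesis using hg False x by auto
        qed (use x in \<open>auto simp: h_def\<close>)
      next
        fix x assume "x \<in> ((f -` Y \<inter> space M) \<inter> A) \<union> (g ` Y - A)"
        then show "x \<in> h -` Y \<inter> space M" using hg YN gs AM by (auto simp: h_def)
      qed
      then show "h -` Y \<inter> space M \<in> sets M"
        using measurable_sets[OF fm(1) Y] im(2)[OF Y] A by auto
    qed
  qed
  then show ?thesis by blast
qed

section \<open>Analytic sets and perfect sets\<close>

lemma open_fun_coord: "open W \<Longrightarrow> open ((\<lambda>h :: 'a \<Rightarrow> 'b::topological_space. h i) -` W)"
  by (intro open_vimage) auto

text \<open>Separation is inherited through a single coordinate. The goal is the Hausdorff property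
  of \<open>nat \<Rightarrow> nat\<close>, for uniqueness of limits and closedness of compact sets;
  the two weaker classes come first as its superclasses.\<close>

instance "fun" :: (type, t0_space) t0_space
proof
  fix f g :: "'a \<Rightarrow> 'b" assume "f \<noteq> g"
  then obtain i where "f i \<noteq> g i" by blast
  then obtain U where "open U" "f i \<in> U \<longleftrightarrow> g i \<notin> U" using separation_t0[of "f i" "g i"] by blast
  then show "\<exists>U. open U \<and> \<not> (f \<in> U \<longleftrightarrow> g \<in> U)"
    by (intro exI[of _ "(\<lambda>h. h i) -` U"]) (auto intro: open_fun_coord)
qed

instance "fun" :: (type, t1_space) t1_space
proof
  fix f g :: "'a \<Rightarrow> 'b" assume "f \<noteq> g"
  then obtain i where "f i \<noteq> g i" by blast
  then obtain U where "open U" "f i \<in> U" "g i \<notin> U" using t1_space by metis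
  then show "\<exists>U. open U \<and> f \<in> U \<and> g \<notin> U"
    by (intro exI[of _ "(\<lambda>h. h i) -` U"]) (auto intro: open_fun_coord)
qed

instance "fun" :: (type, t2_space) t2_space
proof
  fix f g :: "'a \<Rightarrow> 'b" assume "f \<noteq> g"
  then obtain i where "f i \<noteq> g i" by blast
  then obtain U V where "open U" "open V" "f i \<in> U" "g i \<in> V" "U \<inter> V = {}" using hausdorff by metis
  then show "\<exists>U V. open U \<and> open V \<and> f \<in> U \<and> g \<in> V \<and> U \<inter> V = {}"
    by (intro exI[of _ "(\<lambda>h. h i) -` U"] exI[of _ "(\<lambda>h. h i) -` V"]) (auto intro: open_fun_coord)
qed

text \<open>The analytic subsets of Baire space. Parameters range over a closed set rather than all
  of Baire space: this covers the empty set and lets equations between parameters be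
  imposed.\<close>

definition suslin :: "(nat \<Rightarrow> nat) set \<Rightarrow> bool" where
  "suslin A \<longleftrightarrow> (\<exists>F f. closed (F :: (nat \<Rightarrow> nat) set) \<and> continuous_on F f \<and> f ` F = A)"

lemma tendsto_nat_seq_iff:
  fixes x :: "nat \<Rightarrow> nat \<Rightarrow> nat"
  shows "x \<longlonglongrightarrow> a \<longleftrightarrow> (\<forall>i. \<forall>\<^sub>F k in sequentially. x k i = a i)"
proof -
  have "x \<longlonglongrightarrow> a \<longleftrightarrow> limitin (product_topology (\<lambda>_::nat. euclidean :: nat topology) UNIV) x a sequentially"
    by (simp add: euclidean_product_topology)
  also have "\<dots> \<longleftrightarrow> (\<forall>i. (\<lambda>k. x k i) \<longlonglongrightarrow> a i)"
    unfolding limitin_componentwise by simp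
  finally show ?thesis by (simp add: tendsto_discrete)
qed

lemma suslin_family:
  assumes "\<And>n::nat. suslin (A n)"
  obtains F :: "nat \<Rightarrow> (nat \<Rightarrow> nat) set" and f
  where "\<And>n. closed (F n)" "\<And>n. continuous_on (F n) (f n)" "\<And>n. f n ` F n = A n"
proof -
  have "\<exists>p. closed (fst p :: (nat \<Rightarrow> nat) set) \<and> continuous_on (fst p) (snd p) \<and> snd p ` fst p = A n" for n
    using assms[of n] unfolding suslin_def by auto
  then obtain p where p: "\<And>n. closed (fst (p n) :: (nat \<Rightarrow> nat) set) \<and> continuous_on (fst (p n)) (snd (p n)) \<and>
      snd (p n) ` fst (p n) = A n"
    by metis
  show thesis by (rule that[of "\<lambda>n. fst (p n)" "\<lambda>n. snd (p n)"]) (use p in auto)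
qed

lemma suslin_closed: "closed A \<Longrightarrow> suslin A"
  unfolding suslin_def by (intro exI[of _ A] exI[of _ id]) auto

text \<open>The first digit of a parameter selects the set, the tail is a parameter for it. Along a
  convergent sequence the first digit is eventually constant, so limits concern one of the given
  maps only.\<close>

lemma suslin_UN:
  assumes "\<And>n::nat. suslin (A n)"
  shows "suslin (\<Union>n. A n)"
proof -
  obtain F :: "nat \<Rightarrow> (nat \<Rightarrow> nat) set" and f where F: "\<And>n. closed (F n)" "\<And>n. continuous_on (F n) (f n)" "\<And>n. f n ` F n = A n"
    by (rule suslin_family[of A, OF assms]) (rule that)
  define tl where "tl = (\<lambda>(\<alpha>::nat \<Rightarrow> nat) i. \<alpha> (Suc i))"
  have tail: "\<forall>\<^sub>F k in sequentially. x k 0 = a 0" "(\<lambda>k. tl (x k)) \<longlonglongrightarrow> tl a"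
    if "x \<longlonglongrightarrow> a" for x a
    using that unfolding tendsto_nat_seq_iff tl_def by blast+
  define G where "G = {\<alpha>. tl \<alpha> \<in> F (\<alpha> 0)}"
  define g where "g \<alpha> = f (\<alpha> 0) (tl \<alpha>)" for \<alpha>
  show ?thesis
    unfolding suslin_def
  proof (intro exI conjI)
    show "closed G"
      unfolding closed_sequential_limits
    proof (intro allI impI; elim conjE)
      fix x a assume x: "\<forall>n. x n \<in> G" "x \<longlonglongrightarrow> a"
      have "\<forall>\<^sub>F k in sequentially. tl (x k) \<in> F (a 0)"
        using tail(1)[OF x(2)] 
      proof eventually_elim
        case (elim k) then show ?case using x(1)[rule_format, of k] by (simp add: G_def)
      qed
      then have "tl a \<in> F (a 0)"
        using Lim_in_closed_set[OF F(1) _ _ tail(2)[OF x(2)]] by simp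
      then show "a \<in> G" by (simp add: G_def)
    qed
    show "continuous_on G g"
      unfolding continuous_on_sequentially
    proof (intro allI ballI impI; elim conjE)
      fix x a assume x: "a \<in> G" "\<forall>n. x n \<in> G" "x \<longlonglongrightarrow> a"
      have ev: "\<forall>\<^sub>F k in sequentially. x k 0 = a 0" by (rule tail(1)[OF x(3)])
      then have inF: "\<forall>\<^sub>F k in sequentially. tl (x k) \<in> F (a 0)"
        
      proof eventually_elim
        case (elim k) then show ?case using x(2)[rule_format, of k] by (simp add: G_def)
      qed
      have "((\<lambda>k. f (a 0) (tl (x k))) \<longlongrightarrow> f (a 0) (tl a)) sequentially"
        using x(1) by (intro continuous_on_tendsto_compose[OF F(2) tail(2)[OF x(3)] _ inF])
          (auto simp: G_def)
      then have "((\<lambda>k. g (x k)) \<longlongrightarrow> f (a 0) (tl a)) sequentially"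
        by (rule Lim_transform_eventually) (use ev in \<open>eventually_elim; simp add: g_def\<close>)
      then show "(g \<circ> x) \<longlonglongrightarrow> g a" by (simp add: g_def comp_def)
    qed
    show "g ` G = (\<Union>n. A n)"
    proof
      show "g ` G \<subseteq> (\<Union>n. A n)" using F(3) by (auto simp: g_def G_def)
      show "(\<Union>n. A n) \<subseteq> g ` G"
      proof
        fix y assume "y \<in> (\<Union>n. A n)"
        then obtain n b where b: "b \<in> F n" "y = f n b" using F(3) by blast
        have "tl (case_nat n b) = b" by (simp add: tl_def)
        then have "case_nat n b \<in> G" "y = g (case_nat n b)" using b by (auto simp: G_def g_def)
        then show "y \<in> g ` G" by blast
      qed
    qed
  qed
qed

text \<open>One parameter encodes a sequence of parameters, its rows under
  \<open>prod_encode\<close>. Requiring all \<open>f n\<close> to agree on their rows is a closed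
  condition, and the common value runs through the intersection.\<close>

lemma suslin_INT:
  assumes "\<And>n::nat. suslin (A n)"
  shows "suslin (\<Inter>n. A n)"
proof -
  obtain F :: "nat \<Rightarrow> (nat \<Rightarrow> nat) set" and f where F: "\<And>n. closed (F n)" "\<And>n. continuous_on (F n) (f n)" "\<And>n. f n ` F n = A n"
    by (rule suslin_family[of A, OF assms]) (rule that)
  define row where "row = (\<lambda>n (\<alpha>::nat \<Rightarrow> nat) k. \<alpha> (prod_encode (n, k)))"
  have row: "(\<lambda>k. row n (x k)) \<longlonglongrightarrow> row n a" if "x \<longlonglongrightarrow> a" for n x a
    using that unfolding tendsto_nat_seq_iff row_def by blast
  define G where "G = {\<alpha>. \<forall>n. row n \<alpha> \<in> F n \<and> f n (row n \<alpha>) = f 0 (row 0 \<alpha>)}"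
  have lim: "(\<lambda>k. f n (row n (x k))) \<longlonglongrightarrow> f n (row n a)"
    if "x \<longlonglongrightarrow> a" "\<forall>k. x k \<in> G" "row n a \<in> F n" for n x a
    using that by (intro continuous_on_tendsto_compose[OF F(2) row]) (auto simp: G_def)
  show ?thesis
    unfolding suslin_def
  proof (intro exI conjI)
    show "closed G"
      unfolding closed_sequential_limits
    proof (intro allI impI; elim conjE)
      fix x a assume x: "\<forall>n. x n \<in> G" "x \<longlonglongrightarrow> a"
      have inF: "row n a \<in> F n" for n
        by (rule Lim_in_closed_set[OF F(1) _ _ row[OF x(2)]]) (use x(1) in \<open>auto simp: G_def\<close>)
      have "f n (row n a) = f 0 (row 0 a)" for n
      proof (rule LIMSEQ_unique)
        show "(\<lambda>k. f n (row n (x k))) \<longlonglongrightarrow> f n (row n a)" by (rule lim[OF x(2,1) inF])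
        have "(\<lambda>k. f n (row n (x k))) = (\<lambda>k. f 0 (row 0 (x k)))" using x(1) unfolding G_def by blast
        then show "(\<lambda>k. f n (row n (x k))) \<longlonglongrightarrow> f 0 (row 0 a)"
          using lim[OF x(2,1) inF, of 0] by simp
      qed
      then show "a \<in> G" using inF by (simp add: G_def)
    qed
    show "continuous_on G (\<lambda>\<alpha>. f 0 (row 0 \<alpha>))"
      unfolding continuous_on_sequentially comp_def
      by (intro allI ballI impI; elim conjE, rule lim) (auto simp: G_def)
    show "(\<lambda>\<alpha>. f 0 (row 0 \<alpha>)) ` G = (\<Inter>n. A n)"
    proof
      show "(\<lambda>\<alpha>. f 0 (row 0 \<alpha>)) ` G \<subseteq> (\<Inter>n. A n)"
      proof clarify
        fix a n assume "a \<in> G"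
        then have "row n a \<in> F n" "f 0 (row 0 a) = f n (row n a)" unfolding G_def by (blast, metis (mono_tags, lifting) mem_Collect_eq)
        then show "f 0 (row 0 a) \<in> A n" using F(3)[of n] by auto
      qed
      show "(\<Inter>n. A n) \<subseteq> (\<lambda>\<alpha>. f 0 (row 0 \<alpha>)) ` G"
      proof
        fix y assume "y \<in> (\<Inter>n. A n)"
        then have "\<forall>n. \<exists>b\<in>F n. f n b = y" using F(3) by (metis INT_iff UNIV_I imageE)
        then obtain b where b: "\<And>n. b n \<in> F n" "\<And>n. f n (b n) = y" by metis
        define a where "a m = (case prod_decode m of (n, k) \<Rightarrow> b n k)" for m
        have "row n a = b n" for n by (simp add: row_def a_def)
        then show "y \<in> (\<lambda>\<alpha>. f 0 (row 0 \<alpha>)) ` G" using b by (auto simp: G_def intro!: image_eqI[of _ _ a])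
      qed
    qed
  qed
qed

lemma closed_nat_seq_coord: "closed {x :: nat \<Rightarrow> nat. x i \<in> D}"
  unfolding closed_sequential_limits
proof (intro allI impI; elim conjE)
  fix x a assume x: "\<forall>n. x n \<in> {x :: nat \<Rightarrow> nat. x i \<in> D}" "x \<longlonglongrightarrow> a"
  then have "\<forall>\<^sub>F k in sequentially. x k i = a i" by (simp add: tendsto_nat_seq_iff)
  then have "\<forall>\<^sub>F k in sequentially. a i \<in> D" by eventually_elim (use x(1) in \<open>metis mem_Collect_eq\<close>)
  then show "a \<in> {x. x i \<in> D}" by simp
qed

lemma sets_borel_nat_seq:
  "sets (borel :: (nat \<Rightarrow> nat) measure) = sigma_sets UNIV {{x. x i \<in> A} | i A. True}"
proof -
  have "sets (borel :: (nat \<Rightarrow> nat) measure) = sets (PiM UNIV (\<lambda>_::nat. borel :: nat measure))"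
    by (rule sets_PiM_equal_borel[symmetric])
  also have "\<dots> = sigma_sets UNIV {{x. x i \<in> A} | i A. True}"
    by (subst sets_PiM_single) (simp add: sets_borel_eq_count_space)
  finally show ?thesis .
qed

text \<open>Analytic sets are not closed under complement, so the induction carries \<open>A\<close>
  and \<open>- A\<close> together; unions of the one are intersections of the other, and the
  generators are clopen.\<close>

lemma suslin_borel:
  assumes "A \<in> sets (borel :: (nat \<Rightarrow> nat) measure)"
  shows "suslin A"
proof -
  have "A \<in> sigma_sets UNIV {{x. x i \<in> A} | i A. True}" using assms sets_borel_nat_seq by simp
  then have "suslin A \<and> suslin (- A)"
  proof induction
    case (Basic a)
    then obtain i B where a: "a = {x. x i \<in> B}" by blast
    show ?case using closed_nat_seq_coord[of i B] closed_nat_seq_coord[of i "- B"]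
      by (auto simp: a Compl_eq intro: suslin_closed)
  next
    case (Union a)
    then show ?case using suslin_UN[of a] suslin_INT[of "\<lambda>i. - a i"] by simp
  qed (auto simp: Compl_eq_Diff_UNIV[symmetric] intro: suslin_closed)
  then show ?thesis by simp
qed

section \<open>The perfect set theorem for analytic sets\<close>

definition cyl :: "(nat \<Rightarrow> nat) \<Rightarrow> nat \<Rightarrow> (nat \<Rightarrow> nat) set" where
  "cyl a n = {b. \<forall>i<n. b i = a i}"

lemma countable_cyls: "countable (range (\<lambda>(a, n). cyl a n))"
proof -
  have "range (\<lambda>(a, n). cyl a n) \<subseteq> range (\<lambda>xs. {b. \<forall>i<length xs. b i = xs ! i})"
  proof clarify
    fix a n
    show "cyl a n \<in> range (\<lambda>xs. {b. \<forall>i<length xs. b i = xs ! i})"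
      by (rule image_eqI[of _ _ "map a [0..<n]"]) (auto simp: cyl_def)
  qed
  then show ?thesis by (rule countable_subset) simp
qed

text \<open>A coordinate of \<open>f\<close> has discrete values, so continuity makes it locally
  constant on \<open>F\<close>: exceptions in ever longer cylinders about \<open>b\<close> would
  converge to \<open>b\<close>.\<close>

lemma eventually_cyl:
  fixes f :: "(nat \<Rightarrow> nat) \<Rightarrow> (nat \<Rightarrow> nat)"
  assumes "b \<in> F" "continuous_on F f" "f b i = v"
  shows "\<exists>n0. \<forall>n\<ge>n0. \<forall>a\<in>F \<inter> cyl b n. f a i = v"
proof (rule ccontr)
  assume neg: "\<not> ?thesis"
  have "\<exists>a. a \<in> F \<inter> cyl b n0 \<and> f a i \<noteq> v" for n0
  proof -
    obtain n a where "n \<ge> n0" "a \<in> F \<inter> cyl b n" "f a i \<noteq> v" using neg by blast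
    then show ?thesis by (intro exI[of _ a]) (auto simp: cyl_def)
  qed
  then obtain x where "\<And>n. x n \<in> F \<inter> cyl b n \<and> f (x n) i \<noteq> v" by metis
  then have x: "\<And>n. x n \<in> F" "\<And>n. x n \<in> cyl b n" "\<And>n. f (x n) i \<noteq> v" by auto
  have "x \<longlonglongrightarrow> b"
    unfolding tendsto_nat_seq_iff
  proof
    fix j show "\<forall>\<^sub>F k in sequentially. x k j = b j"
      using eventually_gt_at_top[of j] by eventually_elim (use x(2) in \<open>auto simp: cyl_def\<close>)
  qed
  then have "(f \<circ> x) \<longlonglongrightarrow> f b" using assms x(1) by (auto simp: continuous_on_sequentially)
  then have "\<forall>\<^sub>F k in sequentially. f (x k) i = v"
    using assms(3) unfolding tendsto_nat_seq_iff comp_def by blast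
  then show False using x(3) by simp
qed

text \<open>A Cantor scheme: cylinders are split again and again into two smaller ones whose parts
  in \<open>F\<close> have disjoint images under \<open>f\<close>, so distinct binary branches end
  in distinct values.\<close>

lemma perfect_set_scheme:
  fixes f :: "(nat \<Rightarrow> nat) \<Rightarrow> (nat \<Rightarrow> nat)"
  assumes F: "closed F" "continuous_on F f" and unc: "uncountable (f ` F)"
  shows "\<exists>g. continuous_on (odo_carrier (\<lambda>_. 2)) g \<and> inj_on g (odo_carrier (\<lambda>_. 2)) \<and>
    g ` odo_carrier (\<lambda>_. 2) \<subseteq> f ` F"
proof -
  \<comment> \<open>The condensation points of \<open>F\<close> with respect to \<open>f\<close>. As
    there are only countably many cylinders, dropping the other points loses countably many
    values.\<close>
  define G where "G = {a \<in> F. \<forall>n. uncountable (f ` (F \<inter> cyl a n))}"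
  have small: "countable (f ` (F - G))"
  proof -
    define K where "K = {N \<in> range (\<lambda>(a, n). cyl a n). countable (f ` (F \<inter> N))}"
    have "f ` (F - G) \<subseteq> (\<Union>N\<in>K. f ` (F \<inter> N))"
    proof clarify
      fix a assume "a \<in> F" "a \<notin> G"
      then obtain n where "countable (f ` (F \<inter> cyl a n))" by (auto simp: G_def)
      then have "cyl a n \<in> K" by (force simp: K_def)
      moreover have "a \<in> cyl a n" by (simp add: cyl_def)
      ultimately show "f a \<in> (\<Union>N\<in>K. f ` (F \<inter> N))" using \<open>a \<in> F\<close> by blast
    qed
    moreover have "countable K" unfolding K_def by (rule countable_subset[OF _ countable_cyls]) auto
    moreover have "countable (\<Union>N\<in>K. f ` (F \<inter> N))"
      using calculation(2) by (rule countable_UN) (simp add: K_def)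
    ultimately show ?thesis using countable_subset by blast
  qed
  \<comment> \<open>Near a point of \<open>G\<close> uncountably many values come from
    \<open>G\<close> itself, so two points of \<open>G\<close> with different values exist there. A
    coordinate in which these values differ is constant on sufficiently small cylinders about each
    of them.\<close>
  have split: "\<exists>b c m. b \<in> G \<inter> cyl a n \<and> c \<in> G \<inter> cyl a n \<and> m > n \<and>
      (\<forall>x\<in>F \<inter> cyl b m. \<forall>y\<in>F \<inter> cyl c m. f x \<noteq> f y)" if a: "a \<in> G" for a n
  proof -
    have "uncountable (f ` (F \<inter> cyl a n))" using a by (simp add: G_def)
    moreover have "f ` (F \<inter> cyl a n) \<subseteq> f ` (G \<inter> cyl a n) \<union> f ` (F - G)" by blast
    ultimately have "uncountable (f ` (G \<inter> cyl a n))"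
      using small by (metis countable_Un countable_subset)
    then have *: "\<not> f ` (G \<inter> cyl a n) \<subseteq> {p}" for p by (meson countable_empty countable_insert countable_subset)
    obtain b where b: "b \<in> G \<inter> cyl a n" using *[of undefined] by blast
    moreover obtain c where "c \<in> G \<inter> cyl a n" "f c \<noteq> f b" using *[of "f b"] by blast
    ultimately have bc: "b \<in> G \<inter> cyl a n" "c \<in> G \<inter> cyl a n" "f b \<noteq> f c" by auto
    then obtain i where i: "f b i \<noteq> f c i" by auto
    have bF: "b \<in> F" "c \<in> F" using bc by (auto simp: G_def)
    obtain n1 where n1: "\<And>k x. k \<ge> n1 \<Longrightarrow> x \<in> F \<inter> cyl b k \<Longrightarrow> f x i = f b i"
      using eventually_cyl[OF bF(1) F(2) refl, of i] by blast
    obtain n2 where n2: "\<And>k x. k \<ge> n2 \<Longrightarrow> x \<in> F \<inter> cyl c k \<Longrightarrow> f x i = f c i"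
      using eventually_cyl[OF bF(2) F(2) refl, of i] by blast
    define m where "m = Suc (max n (max n1 n2))"
    have "\<forall>x\<in>F \<inter> cyl b m. \<forall>y\<in>F \<inter> cyl c m. f x \<noteq> f y"
    proof (intro ballI notI)
      fix x y assume "x \<in> F \<inter> cyl b m" "y \<in> F \<inter> cyl c m" "f x = f y"
      moreover have "n1 \<le> m" "n2 \<le> m" by (auto simp: m_def)
      ultimately show False using n1[of m x] n2[of m y] i by auto
    qed
    moreover have "m > n" by (simp add: m_def)
    ultimately show ?thesis using bc by blast
  qed
  define Q where "Q a n b c m \<longleftrightarrow> b \<in> G \<inter> cyl a n \<and> c \<in> G \<inter> cyl a n \<and> m > n \<and>
      (\<forall>x\<in>F \<inter> cyl b m. \<forall>y\<in>F \<inter> cyl c m. f x \<noteq> f y)" for a n b c and m :: nat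
  have "\<exists>t. Q a n (fst t) (fst (snd t)) (snd (snd t))" if "a \<in> G" for a n
    using split[OF that, of n] unfolding Q_def by (metis fst_conv snd_conv)
  then obtain r where r: "\<And>a n. a \<in> G \<Longrightarrow> Q a n (fst (r a n)) (fst (snd (r a n))) (snd (snd (r a n)))"
    by metis
  define B C E where "B a n = fst (r a n)" and "C a n = fst (snd (r a n))" and "E a n = snd (snd (r a n))" for a n
  have step:
    "B a n \<in> G \<inter> cyl a n" "C a n \<in> G \<inter> cyl a n" "E a n > n"
    "\<And>x y. x \<in> F \<inter> cyl (B a n) (E a n) \<Longrightarrow> y \<in> F \<inter> cyl (C a n) (E a n) \<Longrightarrow> f x \<noteq> f y"
    if "a \<in> G" for a n
    using r[OF that, of n] unfolding Q_def B_def C_def E_def by blast+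
  obtain a0 where a0: "a0 \<in> G"
    using small unc by (cases "G = {}") auto
  \<comment> \<open>A state is a point of \<open>G\<close> together with the length of the current
    cylinder about it. Digit 0 moves to \<open>B\<close>, any other digit to \<open>C\<close>; state
    \<open>k\<close> depends on the digits below \<open>k\<close> only, which later gives
    continuity.\<close>
  define st where "st = (\<lambda>x. rec_nat (a0, 0::nat)
     (\<lambda>k (a, n). (if x k = (0::nat) then B a n else C a n, E a n)))"
  have st0: "st x 0 = (a0, 0)" and stS: "st x (Suc k) =
      (if x k = 0 then B (fst (st x k)) (snd (st x k)) else C (fst (st x k)) (snd (st x k)),
       E (fst (st x k)) (snd (st x k)))" for x k
    by (auto simp: st_def split_beta)
  have stG: "fst (st x k) \<in> G" for x k
    by (induction k) (use a0 step(1,2) in \<open>auto simp: st0 stS\<close>)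
  have grow: "snd (st x k) < snd (st x (Suc k))" for x k
    using step(3)[OF stG] by (simp add: stS)
  have gek: "k \<le> snd (st x k)" for x k
  proof (induction k)
    case (Suc k) then show ?case using grow[of x k] by linarith
  qed simp
  have mono: "snd (st x k) \<le> snd (st x l)" if "k \<le> l" for x k l
    using that
  proof (induction rule: dec_induct)
    case (step n) then show ?case using grow[of x n] by linarith
  qed simp
  have ext1: "fst (st x (Suc k)) \<in> cyl (fst (st x k)) (snd (st x k))" for x k
    using step(1,2)[OF stG[of x k]] by (simp add: stS)
  have ext: "fst (st x l) \<in> cyl (fst (st x k)) (snd (st x k))" if "k \<le> l" for x k l
    using that
  proof (induction rule: dec_induct)
    case base
    show ?case by (simp add: cyl_def)
  next
    case (step l)
    have "snd (st x k) \<le> snd (st x l)" by (rule mono[OF step.hyps(1)])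
    moreover have "fst (st x (Suc l)) \<in> cyl (fst (st x l)) (snd (st x l))" by (rule ext1)
    ultimately show ?case using step.IH by (simp add: cyl_def)
  qed
  have dep: "st x k = st y k" if "\<And>j. j < k \<Longrightarrow> x j = y j" for x y k
    using that by (induction k) (auto simp: st0 stS)
  \<comment> \<open>Coordinate \<open>i\<close> may be read off at stage \<open>Suc i\<close>: by
    \<open>gek\<close> the cylinder then has length above \<open>i\<close>, and later stages stay
    inside it.\<close>
  define \<gamma> where "\<gamma> x i = fst (st x (Suc i)) i" for x i
  have \<gamma>cyl: "\<gamma> x \<in> cyl (fst (st x k)) (snd (st x k))" for x k
    unfolding cyl_def
  proof (intro CollectI allI impI)
    fix i assume i: "i < snd (st x k)"
    show "\<gamma> x i = fst (st x k) i"
    proof (cases "k \<le> Suc i")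
      case True
      from ext[OF True, of x] i show ?thesis unfolding \<gamma>_def cyl_def by blast
    next
      case False
      then have "fst (st x k) \<in> cyl (fst (st x (Suc i))) (snd (st x (Suc i)))" by (intro ext) simp
      moreover have "i < snd (st x (Suc i))" using gek[of "Suc i" x] by simp
      ultimately show ?thesis unfolding \<gamma>_def cyl_def by simp
    qed
  qed
  have \<gamma>F: "\<gamma> x \<in> F" for x
  proof -
    have "(\<lambda>k. fst (st x k)) \<longlonglongrightarrow> \<gamma> x"
      unfolding tendsto_nat_seq_iff
    proof
      fix i show "\<forall>\<^sub>F k in sequentially. fst (st x k) i = \<gamma> x i"
        using eventually_gt_at_top[of i]
      proof eventually_elim
        case (elim k)
        then have "i < snd (st x k)" using gek[of k x] by simp
        then show ?case using \<gamma>cyl[of x k] by (auto simp: cyl_def)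
      qed
    qed
    moreover have "fst (st x k) \<in> F" for k using stG[of x k] by (simp add: G_def)
    ultimately show ?thesis using closed_sequentially[OF F(1), of "\<lambda>k. fst (st x k)" "\<gamma> x"] by blast
  qed
  have cont\<gamma>: "continuous_on UNIV \<gamma>"
    unfolding continuous_on_sequentially
  proof (intro allI ballI impI; elim conjE)
    fix x a assume x: "x \<longlonglongrightarrow> (a :: nat \<Rightarrow> nat)"
    show "(\<gamma> \<circ> x) \<longlonglongrightarrow> \<gamma> a"
      unfolding tendsto_nat_seq_iff
    proof
      fix i
      have "\<forall>\<^sub>F k in sequentially. \<forall>j\<in>{..i}. x k j = a j"
        using x by (intro eventually_ball_finite) (auto simp: tendsto_nat_seq_iff)
      then show "\<forall>\<^sub>F k in sequentially. (\<gamma> \<circ> x) k i = \<gamma> a i"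
      proof eventually_elim
        case (elim k)
        then have "st (x k) (Suc i) = st a (Suc i)" by (intro dep) auto
        then show ?case by (simp add: \<gamma>_def)
      qed
    qed
  qed
  have inj: "f (\<gamma> x) \<noteq> f (\<gamma> y)" if xy: "x \<in> odo_carrier (\<lambda>_. 2)" "y \<in> odo_carrier (\<lambda>_. 2)" "x \<noteq> y" for x y
  proof -
    define k where "k = (LEAST k. x k \<noteq> y k)"
    have k: "x k \<noteq> y k" using xy(3) LeastI_ex[of "\<lambda>k. x k \<noteq> y k"] unfolding k_def by blast
    have "x j = y j" if "j < k" for j using not_less_Least that unfolding k_def by blast
    then have eq: "st x k = st y k" by (rule dep)
    have sep: "f (\<gamma> u) \<noteq> f (\<gamma> v)" if "st u k = st v k" "u k = 0" "v k \<noteq> 0" for u v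
    proof -
      have "\<gamma> u \<in> cyl (B (fst (st u k)) (snd (st u k))) (E (fst (st u k)) (snd (st u k)))"
        "\<gamma> v \<in> cyl (C (fst (st u k)) (snd (st u k))) (E (fst (st u k)) (snd (st u k)))"
        using \<gamma>cyl[of u "Suc k"] \<gamma>cyl[of v "Suc k"] that by (simp_all add: stS)
      then show ?thesis using step(4)[OF stG[of u k]] \<gamma>F by blast
    qed
    have "x k < 2" "y k < 2" using xy by (auto simp: odo_carrier_def)
    then have "x k = 0 \<and> y k \<noteq> 0 \<or> y k = 0 \<and> x k \<noteq> 0" using k by linarith
    then show ?thesis using sep[of x y] sep[of y x] eq by auto
  qed
  show ?thesis
  proof (intro exI conjI)
    show "continuous_on (odo_carrier (\<lambda>_. 2)) (\<lambda>x. f (\<gamma> x))"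
      using cont\<gamma> \<gamma>F by (intro continuous_on_compose2[OF F(2)]) (auto intro: continuous_on_subset)
    show "inj_on (\<lambda>x. f (\<gamma> x)) (odo_carrier (\<lambda>_. 2))" using inj by (auto intro!: inj_onI)
    show "(\<lambda>x. f (\<gamma> x)) ` odo_carrier (\<lambda>_. 2) \<subseteq> f ` F" using \<gamma>F by auto
  qed
qed

section \<open>Digit spaces as compact Borel sets\<close>

lemma closed_odo_carrier: "closed (odo_carrier l)"
proof -
  have "closed (\<Inter>i. {x :: nat \<Rightarrow> nat. x i \<in> {..<l i}})" using closed_nat_seq_coord by blast
  moreover have "odo_carrier l = (\<Inter>i. {x :: nat \<Rightarrow> nat. x i \<in> {..<l i}})"
    by (auto simp: odo_carrier_def)
  ultimately show ?thesis by simp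
qed

lemma odo_carrier_borel [measurable, simp]: "odo_carrier l \<in> sets borel"
  by (rule borel_closed[OF closed_odo_carrier])

lemma space_odo_space [simp]: "space (odo_space l) = odo_carrier l"
  by (simp add: odo_space_def space_restrict_space)

lemma compact_odo_carrier: "compact (odo_carrier l)"
proof -
  have "compactin (product_topology (\<lambda>_::nat. euclidean :: nat topology) UNIV) (PiE UNIV (\<lambda>i. {..<l i}))"
    unfolding compactin_PiE by (auto intro: finite_imp_compact)
  moreover have "PiE UNIV (\<lambda>i. {..<l i}) = odo_carrier l"
    by (auto simp: odo_carrier_def)
  ultimately show ?thesis by (simp add: euclidean_product_topology)
qed

lemma sets_odo_space_iff: "A \<in> sets (odo_space l) \<longleftrightarrow> A \<in> sets borel \<and> A \<subseteq> odo_carrier l"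
  unfolding odo_space_def by (subst sets_restrict_space_iff) auto

text \<open>By compactness closed subsets have compact, hence closed, images. Complements, available
  through injectivity, give the relatively open sets, and these generate.\<close>

lemma borel_embedding_compact:
  fixes g :: "(nat \<Rightarrow> nat) \<Rightarrow> (nat \<Rightarrow> nat)"
  assumes "continuous_on (odo_carrier l) g" "inj_on g (odo_carrier l)"
  shows "borel_embedding (odo_space l) borel g"
  unfolding borel_embedding_def
proof (intro conjI ballI)
  show "g \<in> odo_space l \<rightarrow>\<^sub>M borel"
    unfolding odo_space_def by (rule borel_measurable_continuous_on_restrict[OF assms(1)])
  show "inj_on g (space (odo_space l))" using assms(2) by simp
  have cl: "closed (g ` A)" if "closed A" "A \<subseteq> odo_carrier l" for A
  proof -
    have "compact A" using that compact_Int_closed[OF compact_odo_carrier that(1), of l] by (simp add: Int_absorb1)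
    moreover have "continuous_on A g" using that assms(1) continuous_on_subset by blast
    ultimately show ?thesis by (intro compact_imp_closed compact_continuous_image)
  qed
  fix A assume A: "A \<in> sets (odo_space l)"
  show "g ` A \<in> sets borel"
  proof (rule images_measurable_generator[OF _ _ _ _ A])
    show "sets (odo_space l) = sigma_sets (space (odo_space l)) ((\<inter>) (odo_carrier l) ` {S. open S})"
      using sigma_sets_Int[of "odo_carrier l" UNIV "{S. open S}"] odo_carrier_borel[of l]
      unfolding odo_space_def sets_restrict_space by (simp add: borel_def space_restrict_space)
    show "inj_on g (space (odo_space l))" using assms(2) by simp
    show "g ` space (odo_space l) \<in> sets borel" using cl[OF closed_odo_carrier] by simp
    fix a assume "a \<in> (\<inter>) (odo_carrier l) ` {S. open S}"
    then obtain U where U: "open U" "a = odo_carrier l \<inter> U" by blast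
    have "a = odo_carrier l - (odo_carrier l - U)" using U by auto
    then have "g ` a = g ` odo_carrier l - g ` (odo_carrier l - U)"
      using inj_on_image_set_diff[OF assms(2), of "odo_carrier l" "odo_carrier l - U"] by auto
    then show "g ` a \<in> sets borel"
      using cl[OF closed_odo_carrier] cl[of "odo_carrier l - U"] closed_odo_carrier[of l] U(1)
      by (simp add: borel_closed closed_Diff sets.Diff)
  qed
qed

lemma cantor_embeds_in_uncountable_borel:
  assumes "A \<in> sets (borel :: (nat \<Rightarrow> nat) measure)" "uncountable A"
  shows "\<exists>g. borel_embedding (odo_space (\<lambda>_. 2)) borel g \<and> g ` odo_carrier (\<lambda>_. 2) \<subseteq> A"
proof -
  obtain F :: "(nat \<Rightarrow> nat) set" and f where "closed F" "continuous_on F f" "f ` F = A"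
    using suslin_borel[OF assms(1)] by (auto simp: suslin_def)
  with perfect_set_scheme[of F f] assms(2) borel_embedding_compact show ?thesis by metis
qed

section \<open>Standard Borel spaces and the Cantor space\<close>

text \<open>A point is coded by its distances to a dense sequence \<open>c\<close>. Density makes
  the code injective; completeness identifies its range with an explicit Borel set, so that images
  can be controlled.\<close>

lemma standard_borel_embeds_real_seq:
  assumes "standard_borel M" "space M \<noteq> {}"
  shows "\<exists>f. borel_embedding M (borel :: (nat \<Rightarrow> real) measure) f"
proof -
  obtain S where S: "completely_metrizable_space S" "separable_space S" "topspace S = space M"
    "sets M = sigma_sets (topspace S) {U. openin S U}"
    using assms(1) unfolding standard_borel_def by blast
  obtain X d where X: "Metric_space X d" "Metric_space.mcomplete X d" "S = Metric_space.mtopology X d"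
    using S(1) unfolding completely_metrizable_space_def by blast
  interpret Metric_space X d by fact
  have XM: "X = space M" using S(3) X(3) by simp
  obtain C where C: "countable C" "C \<subseteq> X" "mtopology closure_of C = X"
    using S(2) X(3) unfolding separable_space_def by auto
  have Cne: "C \<noteq> {}" using C(3) assms(2) XM by auto
  define c where "c = from_nat_into C"
  have c: "range c = C" using Cne C(1) by (simp add: c_def)
  have cX: "c i \<in> X" for i using c C(2) by blast
  have dense: "\<exists>i. d x (c i) < e" if xe: "x \<in> X" "e > 0" for x e
  proof -
    have "x \<in> mtopology closure_of C" using C(3) xe by simp
    then obtain y where "y \<in> C" "y \<in> mball x e"
      unfolding metric_closure_of using xe(2) by blast
    then have "y \<in> C" "d x y < e" by auto
    then show ?thesis using c by auto
  qed
  define f where "f x i = d x (c i)" for x i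
  \<comment> \<open>These are the sequences that look like distance functions: the triangle
    inequalities hold and the values come arbitrarily close to 0. The second condition supplies a
    Cauchy sequence of centres, and its limit is the point being coded.\<close>
  define I where "I = {r \<in> space (borel :: (nat \<Rightarrow> real) measure). (\<forall>i j. d (c i) (c j) \<le> r i + r j \<and> r i \<le> d (c i) (c j) + r j) \<and>
      (\<forall>m::nat. \<exists>i. r i < inverse (real (Suc m)))}"
  have coord: "(\<lambda>r :: nat \<Rightarrow> real. r i) \<in> borel_measurable borel" for i
    by (rule measurable_product_coordinates)
  have I: "I \<in> sets borel" unfolding I_def
    by (intro sets.sets_Collect_conj sets.sets_Collect_countable_All sets.sets_Collect_countable_Ex
        borel_measurable_le borel_measurable_less borel_measurable_add borel_measurable_const coord)
  have inj: "inj_on f (space M)"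
  proof (rule inj_onI, rule ccontr)
    fix x y assume xy: "x \<in> space M" "y \<in> space M" "f x = f y" "x \<noteq> y"
    then have "d x y > 0" using XM by simp
    then obtain i where "d x (c i) < d x y / 2" using dense[of x "d x y / 2"] xy XM by auto
    moreover have "d y (c i) = d x (c i)" using fun_cong[OF xy(3), of i] by (simp add: f_def)
    moreover have "d x y \<le> d x (c i) + d y (c i)" using triangle[of x "c i" y] xy XM cX[of i] commute[of y "c i"] by simp
    ultimately show False by simp
  qed
  have image: "f ` space M = I"
  proof
    show "f ` space M \<subseteq> I"
    proof
      fix r assume "r \<in> f ` space M"
      then obtain x where x: "x \<in> X" "r = f x" using XM by auto
      have "d (c i) (c j) \<le> r i + r j" "r i \<le> d (c i) (c j) + r j" for i j
      proof -
        have "d (c i) (c j) \<le> d (c i) x + d x (c j)" "d x (c i) \<le> d x (c j) + d (c j) (c i)"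
          using triangle x(1) cX by blast+
        moreover have "d (c i) x = d x (c i)" "d (c j) (c i) = d (c i) (c j)" by (rule commute)+
        ultimately show "d (c i) (c j) \<le> r i + r j" "r i \<le> d (c i) (c j) + r j"
          unfolding x(2) f_def by linarith+
      qed
      moreover have "\<exists>i. r i < inverse (real (Suc m))" for m
        using dense[OF x(1), of "inverse (real (Suc m))"] by (simp add: x(2) f_def)
      ultimately show "r \<in> I" by (auto simp: I_def)
    qed
    show "I \<subseteq> f ` space M"
    proof
      fix r assume "r \<in> I"
      then have r: "d (c i) (c j) \<le> r i + r j" "r i \<le> d (c i) (c j) + r j"
        and "\<forall>m. \<exists>i. r i < inverse (real (Suc m))" for i j by (auto simp: I_def)
      then obtain k where k: "\<And>m. r (k m) < inverse (real (Suc m))" by metis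
      have r0: "r (k m) \<ge> 0" for m using r(1)[of "k m" "k m"] cX by simp
      have lim0: "(\<lambda>m. r (k m)) \<longlonglongrightarrow> 0"
        by (rule tendsto_sandwich[OF _ _ tendsto_const LIMSEQ_inverse_real_of_nat])
          (use r0 k in \<open>auto intro!: always_eventually less_imp_le\<close>)
      have "MCauchy (\<lambda>m. c (k m))"
        unfolding MCauchy_def
      proof (intro conjI allI impI)
        show "range (\<lambda>m. c (k m)) \<subseteq> X" using cX by auto
        fix e :: real assume "e > 0"
        then obtain N where N: "inverse (real (Suc N)) < e / 2" using reals_Archimedean half_gt_zero by blast
        show "\<exists>N. \<forall>n n'. N \<le> n \<longrightarrow> N \<le> n' \<longrightarrow> d (c (k n)) (c (k n')) < e"
        proof (intro exI[of _ N] allI impI)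
          fix n n' assume n: "N \<le> n" "N \<le> n'"
          have "inverse (real (Suc m)) \<le> inverse (real (Suc N))" if "N \<le> m" for m
            using that by (auto simp: field_simps)
          from this[OF n(1)] this[OF n(2)] N k[of n] k[of n'] r(1)[of "k n" "k n'"]
          show "d (c (k n)) (c (k n')) < e" by linarith
        qed
      qed
      then obtain x where x: "limitin mtopology (\<lambda>m. c (k m)) x sequentially"
        using X(2) by (auto simp: mcomplete_def)
      then have xX: "x \<in> X" and xl: "(\<lambda>m. d (c (k m)) x) \<longlonglongrightarrow> 0"
        by (auto simp: limit_metric_sequentially limitin_metric_dist_null)
      have "f x j = r j" for j
      proof -
        have a: "\<bar>r j - d x (c j)\<bar> \<le> r (k m) + d (c (k m)) x" for m
        proof -
          have "d (c (k m)) (c j) \<le> d (c (k m)) x + d x (c j)" "d x (c j) \<le> d (c (k m)) x + d (c (k m)) (c j)"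
            using triangle[of "c (k m)" x "c j"] triangle[of x "c (k m)" "c j"] xX cX by (auto simp: commute)
          moreover have "d (c j) (c (k m)) = d (c (k m)) (c j)" by (rule commute)
          ultimately show ?thesis using r(1)[of j "k m"] r(2)[of j "k m"] by linarith
        qed
        have "(\<lambda>m. r (k m) + d (c (k m)) x) \<longlonglongrightarrow> 0 + 0" by (intro tendsto_add lim0 xl)
        then have "\<bar>r j - d x (c j)\<bar> \<le> 0 + 0"
          by (rule LIMSEQ_le_const) (use a in auto)
        then show ?thesis by (simp add: f_def)
      qed
      then have "r = f x" by auto
      then show "r \<in> f ` space M" using xX XM by blast
    qed
  qed
  have ball: "mball y q \<in> sets M" for y q
    unfolding S(4) X(3) using openin_mball by blast
  have meas: "f \<in> borel_measurable M"
  proof (rule measurable_coordinatewise_then_product)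
    fix i
    show "(\<lambda>x. f x i) \<in> borel_measurable M"
      unfolding borel_measurable_iff_less
    proof
      fix a
      have "{w \<in> space M. f w i < a} = mball (c i) a"
        unfolding XM[symmetric] f_def using cX by (auto simp: commute)
      then show "{w \<in> space M. f w i < a} \<in> sets M" using ball by simp
    qed
  qed
  have "f ` A \<in> sets borel" if "A \<in> sets M" for A
  proof (rule images_measurable_generator[OF S(4)[unfolded S(3)] inj _ _ that])
    show "f ` space M \<in> sets borel" using image I by simp
    fix U assume "U \<in> {U. openin S U}"
    then have U: "openin mtopology U" using X(3) by simp
    \<comment> \<open>An open set is the union of the balls with centre \<open>c i\<close> and
      rational radius that it contains, and such a ball is a bound on one coordinate of the
      code.\<close>
    have "f ` U = (\<Union>i. \<Union>q\<in>{q\<in>\<rat>. mball (c i) q \<subseteq> U}. I \<inter> {r \<in> space borel. r i < q})"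
    proof (intro set_eqI iffI)
      fix r assume "r \<in> f ` U"
      then obtain x where x: "x \<in> U" "r = f x" by auto
      then have xX: "x \<in> X" using U openin_subset by fastforce
      obtain e where e: "e > 0" "mball x e \<subseteq> U" using U x(1) unfolding openin_mtopology by blast
      obtain i where i: "d x (c i) < e / 2" using dense[OF xX, of "e / 2"] e by auto
      obtain q where q: "q \<in> \<rat>" "d x (c i) < q" "q < e / 2" using Rats_dense_in_real[OF i] by auto
      have "mball (c i) q \<subseteq> mball x e"
      proof
        fix y assume "y \<in> mball (c i) q"
        then have y: "y \<in> X" "d (c i) y < q" by auto
        have "d x y \<le> d x (c i) + d (c i) y" using triangle xX y cX by blast
        then show "y \<in> mball x e" using y q xX by auto
      qed
      moreover have "r \<in> I" using image x(2) xX XM by blast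
      moreover have "r i < q" using q x(2) by (simp add: f_def)
      ultimately show "r \<in> (\<Union>i. \<Union>q\<in>{q\<in>\<rat>. mball (c i) q \<subseteq> U}. I \<inter> {r \<in> space borel. r i < q})"
        using q e by auto
    next
      fix r assume "r \<in> (\<Union>i. \<Union>q\<in>{q\<in>\<rat>. mball (c i) q \<subseteq> U}. I \<inter> {r \<in> space borel. r i < q})"
      then obtain i q where iq: "mball (c i) q \<subseteq> U" "r \<in> I" "r i < q" by auto
      then obtain x where x: "x \<in> X" "r = f x" using image XM by auto
      then have "x \<in> mball (c i) q" using iq cX by (auto simp: f_def commute)
      then show "r \<in> f ` U" using iq x by auto
    qed
    also have "\<dots> \<in> sets borel"
    proof (intro sets.countable_UN'' sets.Int I)
      show "countable {q\<in>\<rat>. mball (c i) q \<subseteq> U}" for i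
        by (rule countable_subset[OF _ countable_rat]) auto
      show "{r \<in> space borel. r i < q} \<in> sets (borel :: (nat \<Rightarrow> real) measure)" for i :: nat and q
        by (intro borel_measurable_less borel_measurable_const coord)
    qed auto
    finally show "f ` U \<in> sets borel" .
  qed
  then show ?thesis using meas inj unfolding borel_embedding_def by blast
qed

lemma measurable_nat_seqI:
  fixes f :: "'a \<Rightarrow> nat \<Rightarrow> nat"
  assumes "\<And>i. (\<lambda>x. f x i) \<in> M \<rightarrow>\<^sub>M count_space UNIV"
  shows "f \<in> M \<rightarrow>\<^sub>M borel"
proof (rule measurable_coordinatewise_then_product)
  fix i show "(\<lambda>x. f x i) \<in> borel_measurable M"
    unfolding measurable_cong_sets[OF refl sets_borel_eq_count_space] by (rule assms)
qed

lemma measurable_nat_seq_coord [measurable]: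
  "(\<lambda>x :: nat \<Rightarrow> nat. x i) \<in> borel \<rightarrow>\<^sub>M count_space UNIV"
  unfolding measurable_cong_sets[OF refl sets_borel_eq_count_space, symmetric]
  by (rule measurable_product_coordinates)

text \<open>A real number is determined by the floors of its multiples by powers of 2, and an
  integer by the bits saying which integer it is. Decoding is a measurable left inverse, so
  \<open>borel_embedding_retract\<close> applies.\<close>

lemma real_seq_embeds_cantor:
  "\<exists>f. borel_embedding (borel :: (nat \<Rightarrow> real) measure) (odo_space (\<lambda>_. 2)) f"
proof -
  \<comment> \<open>Bit \<open>prod_encode (i, prod_encode (k, z))\<close> tells whether the floor
    of \<open>r i * 2 ^ k\<close> is the integer with code \<open>z\<close>.\<close>
  define f :: "(nat \<Rightarrow> real) \<Rightarrow> nat \<Rightarrow> nat" where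
    "f r n = (if \<lfloor>r (fst (prod_decode n)) * 2 ^ fst (prod_decode (snd (prod_decode n)))\<rfloor>
      = int_decode (snd (prod_decode (snd (prod_decode n)))) then 1 else 0)" for r n
  \<comment> \<open>\<open>LEAST\<close> finds the bit that is set and \<open>lim\<close> recovers
    the number from its dyadic approximations. On sequences that are no codes both may be arbitrary,
    since only the fixed points of \<open>f \<circ> g\<close> enter.\<close>
  define g :: "(nat \<Rightarrow> nat) \<Rightarrow> nat \<Rightarrow> real" where
    "g y i = lim (\<lambda>k. of_int (int_decode (LEAST z. y (prod_encode (i, prod_encode (k, z))) = 1)) / 2 ^ k)" for y i
  have fm: "f \<in> borel \<rightarrow>\<^sub>M borel"
  proof (rule measurable_nat_seqI)
    fix n
    obtain i k z where n: "n = prod_encode (i, prod_encode (k, z))" 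
      using prod_decode_inverse[of n] prod_decode_inverse[of "snd (prod_decode n)"] by (metis prod.collapse)
    have "(\<lambda>r :: nat \<Rightarrow> real. \<lfloor>r i * 2 ^ k\<rfloor>) \<in> borel \<rightarrow>\<^sub>M count_space UNIV"
      by (intro measurable_compose[OF _ measurable_real_floor] borel_measurable_times measurable_product_coordinates borel_measurable_const)
    from measurable_compose[OF this, of "\<lambda>m. if m = int_decode z then 1 else (0::nat)" "count_space UNIV"]
    show "(\<lambda>r. f r n) \<in> borel \<rightarrow>\<^sub>M count_space UNIV" by (simp add: f_def n)
  qed
  have gm: "g \<in> borel \<rightarrow>\<^sub>M borel"
  proof (rule measurable_coordinatewise_then_product)
    fix i
    have "(\<lambda>y :: nat \<Rightarrow> nat. real_of_int (int_decode (LEAST z. y (prod_encode (i, prod_encode (k, z))) = 1)) / 2 ^ k)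
      \<in> borel_measurable borel" for k
    proof -
      have "(\<lambda>y :: nat \<Rightarrow> nat. y n = 1) \<in> borel \<rightarrow>\<^sub>M count_space UNIV" for n
        using measurable_compose[OF measurable_nat_seq_coord, of "\<lambda>m. m = 1" "count_space UNIV" n] by simp
      then have "(\<lambda>y :: nat \<Rightarrow> nat. LEAST z. y (prod_encode (i, prod_encode (k, z))) = 1) \<in> borel \<rightarrow>\<^sub>M count_space UNIV"
        by (rule measurable_Least)
      from measurable_compose[OF this, of "\<lambda>z. real_of_int (int_decode z) / 2 ^ k" borel] show ?thesis by simp
    qed
    then show "(\<lambda>y. g y i) \<in> borel_measurable borel"
      unfolding g_def by (intro borel_measurable_lim_metric)
  qed
  have gf: "g (f r) = r" for r
  proof
    fix i
    have "(LEAST z. f r (prod_encode (i, prod_encode (k, z))) = 1) = int_encode \<lfloor>r i * 2 ^ k\<rfloor>" for k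
      by (rule Least_equality) (auto simp: f_def int_decode_inverse split: if_splits)
    then have eq: "g (f r) i = lim (\<lambda>k. of_int \<lfloor>r i * 2 ^ k\<rfloor> / 2 ^ k)" by (simp add: g_def)
    have "(\<lambda>k. of_int \<lfloor>r i * 2 ^ k\<rfloor> / 2 ^ k) \<longlonglongrightarrow> r i"
    proof (rule tendsto_sandwich)
      show "\<forall>\<^sub>F k in sequentially. r i - (1/2) ^ k \<le> of_int \<lfloor>r i * 2 ^ k\<rfloor> / 2 ^ k"
      proof (rule always_eventually, rule allI)
        fix k
        have "r i * 2 ^ k - 1 \<le> of_int \<lfloor>r i * 2 ^ k\<rfloor>" by linarith
        then have "(r i * 2 ^ k - 1) / 2 ^ k \<le> of_int \<lfloor>r i * 2 ^ k\<rfloor> / 2 ^ k"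
          by (intro divide_right_mono) auto
        then show "r i - (1/2) ^ k \<le> of_int \<lfloor>r i * 2 ^ k\<rfloor> / 2 ^ k"
          by (simp add: diff_divide_distrib power_divide)
      qed
      show "\<forall>\<^sub>F k in sequentially. of_int \<lfloor>r i * 2 ^ k\<rfloor> / 2 ^ k \<le> r i"
        by (rule always_eventually) (simp add: divide_le_eq)
      have "(\<lambda>k. r i - (1/2) ^ k) \<longlonglongrightarrow> r i - 0"
        by (intro tendsto_diff tendsto_const LIMSEQ_realpow_zero) auto
      then show "(\<lambda>k. r i - (1/2) ^ k) \<longlonglongrightarrow> r i" by simp
    qed (rule tendsto_const)
    then show "g (f r) i = r i" using eq by (simp add: limI)
  qed
  have range: "f r \<in> odo_carrier (\<lambda>_. 2)" for r by (auto simp: odo_carrier_def f_def)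
  have "borel_embedding borel (odo_space (\<lambda>_. 2)) f"
  proof (rule borel_embedding_retract)
    show "f \<in> borel \<rightarrow>\<^sub>M odo_space (\<lambda>_. 2)"
      unfolding odo_space_def using fm range by (intro measurable_restrict_space2) auto
    show "g \<in> odo_space (\<lambda>_. 2) \<rightarrow>\<^sub>M borel"
      unfolding odo_space_def using gm by (rule measurable_restrict_space1)
    have fg: "(\<lambda>y. f (g y) i) \<in> borel \<rightarrow>\<^sub>M count_space UNIV" for i
      using measurable_compose[OF measurable_compose[OF gm fm] measurable_nat_seq_coord] by simp
    have "{y \<in> space borel. f (g y) i = y i} \<in> sets borel" for i
    proof -
      have "{y \<in> space borel. f (g y) i = y i} =
          (\<Union>m. ((\<lambda>y. f (g y) i) -` {m} \<inter> space borel) \<inter> ((\<lambda>y. y i) -` {m} \<inter> space borel))"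
        by auto
      also have "\<dots> \<in> sets borel"
        by (intro sets.countable_UN sets.Int image_subsetI measurable_sets[OF fg] measurable_sets[OF measurable_nat_seq_coord]) auto
      finally show ?thesis .
    qed
    then have "{y \<in> space borel. \<forall>i. f (g y) i = y i} \<in> sets borel"
      by (rule sets.sets_Collect_countable_All)
    then have "{y. f (g y) = y} \<in> sets borel" by (simp add: fun_eq_iff)
    moreover have "{y. f (g y) = y} \<subseteq> odo_carrier (\<lambda>_. 2)" proof
      fix y assume "y \<in> {y. f (g y) = y}"
      then show "y \<in> odo_carrier (\<lambda>_. 2)" using range[of "g y"] by simp
    qed
    moreover have "{y \<in> space (odo_space (\<lambda>_. 2)). f (g y) = y} = {y. f (g y) = y}"
      using calculation(2) by auto
    ultimately show "{y \<in> space (odo_space (\<lambda>_. 2)). f (g y) = y} \<in> sets (odo_space (\<lambda>_. 2))"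
      unfolding sets_odo_space_iff by simp
  qed (rule gf)
  then show ?thesis by blast
qed

text \<open>Schroeder-Bernstein applied to \<open>B\<close> and the Cantor space. One embedding
  passes through real sequences; its image of \<open>B\<close> is an uncountable Borel set of digit
  sequences, in which the perfect set theorem finds a copy of the Cantor space.\<close>

theorem borel_isomorphic_cantor:
  assumes M: "standard_borel M" and B: "B \<in> sets M" "uncountable B"
  shows "\<exists>f. borel_isomorphism (odo_space (\<lambda>_. 2)) (restrict_space M B) f"
proof -
  have BM: "B \<subseteq> space M" using B(1) by (rule sets.sets_into_space)
  have "space M \<noteq> {}" using B BM by auto
  then obtain f0 :: "'a \<Rightarrow> nat \<Rightarrow> real" and f1 where "borel_embedding M borel f0"
    and "borel_embedding (borel :: (nat \<Rightarrow> real) measure) (odo_space (\<lambda>_. 2)) f1"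
    using standard_borel_embeds_real_seq[OF M] real_seq_embeds_cantor by blast
  then have f: "borel_embedding M (odo_space (\<lambda>_. 2)) (f1 \<circ> f0)" (is "borel_embedding _ _ ?f")
    by (rule borel_embedding_comp)
  then have inj: "inj_on ?f B" and im: "?f ` B \<in> sets (odo_space (\<lambda>_. 2))"
    using B(1) inj_on_subset[OF _ BM] unfolding borel_embedding_def by blast+
  have "?f ` B \<in> sets borel" using im unfolding sets_odo_space_iff by simp
  moreover have "uncountable (?f ` B)" using countable_image_inj_on[OF _ inj] B(2) by blast
  ultimately obtain g where g: "borel_embedding (odo_space (\<lambda>_. 2)) (borel :: (nat \<Rightarrow> nat) measure) g" "g ` odo_carrier (\<lambda>_. 2) \<subseteq> ?f ` B"
    using cantor_embeds_in_uncountable_borel by blast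
  have "borel_embedding (odo_space (\<lambda>_. 2)) (restrict_space borel (?f ` B)) g"
    by (rule borel_embedding_restrict_cod[OF g(1)]) (use g(2) \<open>?f ` B \<in> sets borel\<close> in auto)
  moreover have "restrict_space (odo_space (\<lambda>_. 2)) (?f ` B) = restrict_space borel (?f ` B)"
    using im unfolding odo_space_def sets_odo_space_iff
    by (subst restrict_restrict_space) (auto simp: Int_absorb1 sets_odo_space_iff odo_space_def[symmetric])
  ultimately have g': "borel_embedding (odo_space (\<lambda>_. 2)) (restrict_space (odo_space (\<lambda>_. 2)) (?f ` B)) g"
    by simp
  have "borel_isomorphism (restrict_space M B) (restrict_space (odo_space (\<lambda>_. 2)) (?f ` B)) ?f"
    by (rule borel_embedding_restrict_image[OF f B(1)])
  from borel_isomorphism_imp_embedding[OF borel_isomorphism_inv[OF this]]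
  have "\<exists>g. borel_embedding (odo_space (\<lambda>_. 2)) (restrict_space M B) g"
    using borel_embedding_comp[OF g'] by blast
  moreover have "borel_embedding (restrict_space M B) (odo_space (\<lambda>_. 2)) ?f"
    by (rule borel_embedding_restrict_dom[OF f B(1)])
  ultimately show ?thesis using borel_schroeder_bernstein by blast
qed

section \<open>Odometers\<close>

text \<open>The place value of digit \<open>n\<close>, classically written p with index
  \<open>n - 1\<close>; the empty product is the convention that this index starts at -1 with value
  1.\<close>

definition odo_prod :: "(nat \<Rightarrow> nat) \<Rightarrow> nat \<Rightarrow> nat" where
  "odo_prod l n = (\<Prod>i<n. l i)"

text \<open>For a digit sequence in the carrier this is the residue of the formal series modulo
  \<open>odo_prod l n\<close>. Identities in the group are proved by comparing all these residues,
  through \<open>odo_eqI\<close>.\<close>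

definition odo_val :: "(nat \<Rightarrow> nat) \<Rightarrow> nat \<Rightarrow> (nat \<Rightarrow> nat) \<Rightarrow> nat" where
  "odo_val l n x = (\<Sum>i<n. x i * odo_prod l i)"

lemma odo_prod_simps [simp]: "odo_prod l 0 = 1" "odo_prod l (Suc n) = odo_prod l n * l n"
  by (simp_all add: odo_prod_def)

lemma odo_val_simps [simp]: "odo_val l 0 x = 0" "odo_val l (Suc n) x = odo_val l n x + x n * odo_prod l n"
  by (simp_all add: odo_val_def)

lemma odo_prod_pos: "\<forall>t. l t \<ge> 2 \<Longrightarrow> odo_prod l n > 0"
  unfolding odo_prod_def by (rule prod_pos) (metis less_le_trans pos2)

lemma odo_prod_ge: "\<forall>t. l t \<ge> 2 \<Longrightarrow> odo_prod l n \<ge> 2 ^ n"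
proof (induction n)
  case (Suc n)
  then show ?case using mult_le_mono[of "2 ^ n" "odo_prod l n" 2 "l n"] Suc.prems[rule_format, of n] by (simp add: mult.commute)
qed simp

lemma odo_val_less:
  assumes "x \<in> odo_carrier l"
  shows "odo_val l n x < odo_prod l n"
proof (induction n)
  case (Suc n)
  have "x n < l n" using assms by (simp add: odo_carrier_def)
  then have "(x n + 1) * odo_prod l n \<le> l n * odo_prod l n" by (intro mult_right_mono) auto
  then show ?case using Suc by (simp add: algebra_simps)
qed simp

lemma odo_val_div_mod:
  assumes "x \<in> odo_carrier l"
  shows "odo_val l (Suc n) x div odo_prod l n = x n" "odo_val l (Suc n) x mod odo_prod l n = odo_val l n x"
proof -
  have "odo_val l n x < odo_prod l n" by (rule odo_val_less[OF assms])
  moreover have "odo_prod l n > 0" using calculation by linarith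
  ultimately show "odo_val l (Suc n) x div odo_prod l n = x n" "odo_val l (Suc n) x mod odo_prod l n = odo_val l n x"
    by simp_all
qed

lemma odo_eqI:
  assumes "x \<in> odo_carrier l" "y \<in> odo_carrier l" "\<And>n. odo_val l n x = odo_val l n y"
  shows "x = y"
proof
  fix i show "x i = y i"
    using odo_val_div_mod(1)[OF assms(1), of i] odo_val_div_mod(1)[OF assms(2), of i] assms(3)[of "Suc i"]
    by simp
qed

lemma odo_add_carrier: "\<forall>t. l t \<ge> 2 \<Longrightarrow> odo_add l x y \<in> odo_carrier l"
  unfolding odo_carrier_def odo_add_def by (auto intro!: mod_less_divisor) (metis less_le_trans pos2)

text \<open>The carry into position \<open>n\<close>, weighted by its place value, is exactly what
  truncation to \<open>n\<close> digits loses; reducing modulo \<open>odo_prod l n\<close> removes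
  it.\<close>

lemma odo_val_add_carry:
  "odo_val l n (odo_add l x y) + odo_carry l x y n * odo_prod l n = odo_val l n x + odo_val l n y"
proof (induction n)
  case (Suc n)
  define s where "s = x n + y n + odo_carry l x y n"
  define q r where "q = s div l n" and "r = s mod l n"
  have s: "r + q * l n = s" by (simp add: q_def r_def)
  have "odo_add l x y n = r" "odo_carry l x y (Suc n) = q" by (simp_all add: odo_add_def s_def q_def r_def)
  then have "odo_val l (Suc n) (odo_add l x y) + odo_carry l x y (Suc n) * odo_prod l (Suc n)
      = odo_val l n (odo_add l x y) + (r + q * l n) * odo_prod l n"
    unfolding odo_val_simps odo_prod_simps by (simp add: algebra_simps)
  also have "\<dots> = (odo_val l n (odo_add l x y) + odo_carry l x y n * odo_prod l n) + (x n + y n) * odo_prod l n"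
    unfolding s unfolding s_def by (simp add: algebra_simps)
  also have "\<dots> = odo_val l (Suc n) x + odo_val l (Suc n) y"
    unfolding Suc by (simp add: algebra_simps)
  finally show ?case .
qed simp

lemma odo_val_add:
  assumes "\<forall>t. l t \<ge> 2"
  shows "odo_val l n (odo_add l x y) = (odo_val l n x + odo_val l n y) mod odo_prod l n"
proof -
  have "odo_val l n (odo_add l x y) < odo_prod l n" by (rule odo_val_less[OF odo_add_carrier[OF assms]])
  then show ?thesis unfolding odo_val_add_carry[symmetric] by simp
qed

lemma odo_val_one: "odo_val l n odo_one = (if n = 0 then 0 else 1)"
  by (induction n) (auto simp: odo_one_def)

lemma odo_val_succ:
  assumes "\<forall>t. l t \<ge> 2"
  shows "odo_val l n (odo_add l x odo_one) = (odo_val l n x + 1) mod odo_prod l n"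
  by (cases "n = 0") (simp_all add: odo_val_add[OF assms] odo_val_one del: odo_val_simps(2) odo_prod_simps(2))

definition odo_neg_one :: "(nat \<Rightarrow> nat) \<Rightarrow> nat \<Rightarrow> nat" where
  "odo_neg_one l i = l i - 1"

lemma odo_val_neg_one:
  assumes "\<forall>t. l t \<ge> 2"
  shows "odo_val l n (odo_neg_one l) + 1 = odo_prod l n"
proof (induction n)
  case (Suc n)
  have "l n = (l n - 1) + 1" using assms[rule_format, of n] by linarith
  then have "odo_prod l (Suc n) = (l n - 1) * odo_prod l n + odo_prod l n"
    by (metis add_mult_distrib mult.commute mult_1 odo_prod_simps(2))
  then show ?case using Suc by (simp add: odo_neg_one_def)
qed simp

text \<open>Comparing residues avoids proving that \<open>odo_add\<close> is associative.\<close>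

lemma odo_succ_pred:
  assumes "\<forall>t. l t \<ge> 2" "x \<in> odo_carrier l"
  shows "odo_add l (odo_add l x (odo_neg_one l)) odo_one = x"
    "odo_add l (odo_add l x odo_one) (odo_neg_one l) = x"
proof -
  have n: "odo_val l n x + odo_val l n (odo_neg_one l) + 1 = odo_val l n x + odo_prod l n" for n
    using odo_val_neg_one[OF assms(1), of n] by simp
  show "odo_add l (odo_add l x (odo_neg_one l)) odo_one = x"
  proof (rule odo_eqI[OF odo_add_carrier[OF assms(1)] assms(2)])
    fix k
    have "odo_val l k (odo_add l (odo_add l x (odo_neg_one l)) odo_one)
      = (odo_val l k x + odo_val l k (odo_neg_one l) + 1) mod odo_prod l k"
      unfolding odo_val_succ[OF assms(1), of k "odo_add l x (odo_neg_one l)"] odo_val_add[OF assms(1), of k x]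
      by (rule mod_add_left_eq)
    then show "odo_val l k (odo_add l (odo_add l x (odo_neg_one l)) odo_one) = odo_val l k x"
      unfolding n using odo_val_less[OF assms(2), of k] by simp
  qed
  show "odo_add l (odo_add l x odo_one) (odo_neg_one l) = x"
  proof (rule odo_eqI[OF odo_add_carrier[OF assms(1)] assms(2)])
    fix k
    have "odo_val l k (odo_add l (odo_add l x odo_one) (odo_neg_one l))
      = ((odo_val l k x + 1) mod odo_prod l k + odo_val l k (odo_neg_one l)) mod odo_prod l k"
      unfolding odo_val_add[OF assms(1), of k "odo_add l x odo_one"] odo_val_succ[OF assms(1)] by simp
    also have "\<dots> = (odo_val l k x + 1 + odo_val l k (odo_neg_one l)) mod odo_prod l k"
      by (rule mod_add_left_eq)
    also have "odo_val l k x + 1 + odo_val l k (odo_neg_one l) = odo_val l k x + odo_prod l k"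
      using n[of k] by linarith
    finally show "odo_val l k (odo_add l (odo_add l x odo_one) (odo_neg_one l)) = odo_val l k x"
      using odo_val_less[OF assms(2), of k] by simp
  qed
qed

lemma measurable_odo_add: "(\<lambda>x. odo_add l x y) \<in> borel \<rightarrow>\<^sub>M borel"
proof -
  have sum: "(\<lambda>x. h (x i) (odo_carry l x y i)) \<in> borel \<rightarrow>\<^sub>M count_space UNIV"
    if "(\<lambda>x. odo_carry l x y i) \<in> borel \<rightarrow>\<^sub>M count_space UNIV" for h :: "nat \<Rightarrow> nat \<Rightarrow> nat" and i
  proof (rule measurable_compose_countable[OF _ that])
    fix c
    show "(\<lambda>x. h (x i) c) \<in> borel \<rightarrow>\<^sub>M count_space UNIV"
      using measurable_compose[OF measurable_nat_seq_coord, of "\<lambda>m. h m c"] by simp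
  qed
  have carry: "(\<lambda>x. odo_carry l x y i) \<in> borel \<rightarrow>\<^sub>M count_space UNIV" for i
  proof (induction i)
    case (Suc i)
    from sum[OF this, of "\<lambda>a c. (a + y i + c) div l i"] show ?case by simp
  qed simp
  show ?thesis
  proof (rule measurable_nat_seqI)
    fix i
    from sum[OF carry, of "\<lambda>a c. (a + y i + c) mod l i"]
    show "(\<lambda>x. odo_add l x y i) \<in> borel \<rightarrow>\<^sub>M count_space UNIV" by (simp add: odo_add_def)
  qed
qed

lemma measurable_odo_add_odo_space:
  assumes "\<forall>t. l t \<ge> 2"
  shows "(\<lambda>x. odo_add l x y) \<in> odo_space l \<rightarrow>\<^sub>M odo_space l"
  unfolding odo_space_def
  by (intro measurable_restrict_space2 measurable_restrict_space1 measurable_odo_add)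
    (auto intro: odo_add_carrier[OF assms])

lemma odo_succ_isomorphism:
  assumes "\<forall>t. l t \<ge> 2"
  shows "borel_isomorphism (odo_space l) (odo_space l) (\<lambda>x. odo_add l x odo_one)"
proof (rule borel_isomorphismI)
  let ?O = "\<lambda>x. odo_add l x odo_one" and ?P = "\<lambda>x. odo_add l x (odo_neg_one l)"
  show "bij_betw ?O (space (odo_space l)) (space (odo_space l))"
    by (rule bij_betw_byWitness[of _ ?P]) (auto simp: odo_succ_pred[OF assms] intro: odo_add_carrier[OF assms])
  show "?O \<in> odo_space l \<rightarrow>\<^sub>M odo_space l" by (rule measurable_odo_add_odo_space[OF assms])
  fix A assume A: "A \<in> sets (odo_space l)"
  then have AC: "A \<subseteq> odo_carrier l" by (simp add: sets_odo_space_iff)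
  have "?O ` A = ?P -` A \<inter> space (odo_space l)"
  proof (intro set_eqI iffI)
    fix x assume "x \<in> ?O ` A"
    then show "x \<in> ?P -` A \<inter> space (odo_space l)"
      using AC odo_succ_pred(2)[OF assms] odo_add_carrier[OF assms] by auto
  next
    fix x assume x: "x \<in> ?P -` A \<inter> space (odo_space l)"
    then have "x = ?O (?P x)" using odo_succ_pred(1)[OF assms] by simp
    then show "x \<in> ?O ` A" using x by blast
  qed
  then show "?O ` A \<in> sets (odo_space l)"
    using measurable_sets[OF measurable_odo_add_odo_space[OF assms] A] by simp
qed

section \<open>Automorphisms as Borel isomorphisms of the space with itself\<close>

lemma AutI:
  assumes "borel_isomorphism M M f" "\<And>x. x \<notin> space M \<Longrightarrow> f x = x"
  shows "f \<in> Aut M"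
proof -
  have bij: "bij_betw f (space M) (space M)" and f: "f \<in> M \<rightarrow>\<^sub>M M"
    and g: "inv_into (space M) f \<in> M \<rightarrow>\<^sub>M M"
    using assms(1) by (auto simp: borel_isomorphism_def)
  have p: "f permutes space M" by (rule bij_imp_permutes[OF bij assms(2)])
  have "inv f x = inv_into (space M) f x" if "x \<in> space M" for x
    using that bij permutes_inverses(1)[OF p, of x] permutes_in_image[OF permutes_inv[OF p], of x]
    by (metis bij_betw_imp_inj_on inv_into_f_f)
  then have "inv f \<in> M \<rightarrow>\<^sub>M M" using g measurable_cong[of M "inv f" "inv_into (space M) f" M] by blast
  then show ?thesis using p f by (simp add: Aut_def)
qed

lemma Aut_borel_isomorphism:
  assumes "T \<in> Aut M"
  shows "borel_isomorphism M M T"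
proof (rule borel_isomorphismI)
  have p: "T permutes space M" and inv: "inv T \<in> M \<rightarrow>\<^sub>M M" and T: "T \<in> M \<rightarrow>\<^sub>M M"
    using assms by (auto simp: Aut_def)
  show "bij_betw T (space M) (space M)" by (rule permutes_imp_bij[OF p])
  show "T \<in> M \<rightarrow>\<^sub>M M" by (rule T)
  fix A assume A: "A \<in> sets M"
  have "T ` A = inv T -` A \<inter> space M"
    using permutes_inverses[OF p] sets.sets_into_space[OF A] permutes_in_image[OF p]
    by (auto simp: image_iff) (metis)
  then show "T ` A \<in> sets M" using measurable_sets[OF inv A] by simp
qed

lemma borel_isomorphism_cong:
  assumes f: "borel_isomorphism M N f" and eq: "\<And>x. x \<in> space M \<Longrightarrow> g x = f x"
  shows "borel_isomorphism M N g"
  unfolding borel_isomorphism_iff_embedding borel_embedding_def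
proof (intro conjI ballI)
  have f': "f \<in> M \<rightarrow>\<^sub>M N" "inj_on f (space M)" "f ` space M = space N" "\<And>A. A \<in> sets M \<Longrightarrow> f ` A \<in> sets N"
    using f unfolding borel_isomorphism_iff_embedding borel_embedding_def by auto
  show "g \<in> M \<rightarrow>\<^sub>M N" using f'(1) measurable_cong[of M g f N, OF eq] by blast
  show "inj_on g (space M)" using f'(2) inj_on_cong[of "space M" g f, OF eq] by blast
  show "g ` space M = space N" using f'(3) image_cong[OF refl eq, of "space M"] by simp
  fix A assume A: "A \<in> sets M"
  have "g ` A = f ` A" using sets.sets_into_space[OF A] eq by (intro image_cong) auto
  then show "g ` A \<in> sets N" using f'(4)[OF A] by simp
qed

section \<open>Odometers with prescribed action on a chain of levels\<close>

lemma odometer_of_coding: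
  assumes l: "\<forall>t. l t \<ge> 2" and iso: "borel_isomorphism M (odo_space l) f"
  shows "\<exists>S\<in>odometers M. \<forall>x\<in>space M. f (S x) = odo_add l (f x) odo_one"
proof -
  define g where "g = inv_into (space M) f"
  define O' where "O' = (\<lambda>z. odo_add l z odo_one)"
  define S where "S x = (if x \<in> space M then (g \<circ> (O' \<circ> f)) x else x)" for x
  have gi: "borel_isomorphism (odo_space l) M g" unfolding g_def by (rule borel_isomorphism_inv[OF iso])
  have S: "borel_isomorphism M M S"
  proof (rule borel_isomorphism_cong)
    show "borel_isomorphism M M (g \<circ> (O' \<circ> f))"
      unfolding O'_def by (rule borel_isomorphism_comp[OF borel_isomorphism_comp[OF iso odo_succ_isomorphism[OF l]] gi])
  qed (simp add: S_def)
  have SA: "S \<in> Aut M" by (rule AutI[OF S]) (simp add: S_def)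
  have fS: "f (S x) = odo_add l (f x) odo_one" if "x \<in> space M" for x
  proof -
    have "odo_add l (f x) odo_one \<in> f ` space M"
      using iso odo_add_carrier[OF l] by (simp add: borel_isomorphism_iff_embedding)
    then show ?thesis using that by (simp add: S_def g_def O'_def f_inv_into_f)
  qed
  then have "S \<in> odometers M" unfolding odometers_def using SA iso l by blast
  then show ?thesis using fS by blast
qed

text \<open>While the first digit stays below its maximum, adding 1 produces no carry. With bases
  \<open>H, 2, 2, ...\<close> the odometer therefore just moves each level but the last to the next
  one, keeping the inner coordinate.\<close>

lemma odo_succ_first_digit:
  assumes "Suc k < H" "w \<in> odo_carrier (\<lambda>_. 2)"
  shows "odo_add (case_nat H (\<lambda>_. 2)) (case_nat k w) odo_one = case_nat (Suc k) w"
proof -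
  let ?l = "case_nat H (\<lambda>_. 2 :: nat)"
  have c: "odo_carry ?l (case_nat k w) odo_one i = 0" for i
  proof (induction i)
    case (Suc i)
    then show ?case using assms by (cases i) (auto simp: odo_one_def odo_carrier_def)
  qed simp
  show ?thesis
  proof
    fix i show "odo_add ?l (case_nat k w) odo_one i = case_nat (Suc k) w i"
      using assms c[of i] by (cases i)
        (simp_all add: odo_add_def odo_one_def[THEN fun_cong] odo_carrier_def del: odo_carry.simps(2))
  qed
qed

text \<open>A point of level \<open>k\<close> with Cantor coordinate \<open>w\<close> receives the
  code \<open>case_nat k w\<close>. The levels partition the space, so this is a coding of the whole
  of it, and \<open>odo_succ_first_digit\<close> describes the resulting odometer on all levels but
  the last.\<close>

lemma odometer_of_levels:
  fixes L :: "nat \<Rightarrow> 'a set"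
  assumes H: "H \<ge> 2" and L: "\<And>k. k < H \<Longrightarrow> L k \<in> sets M" "disjoint_family_on L {..<H}" "(\<Union>k<H. L k) = space M"
    and h: "\<And>k. k < H \<Longrightarrow> borel_isomorphism (odo_space (\<lambda>_. 2)) (restrict_space M (L k)) (h k)"
  shows "\<exists>S\<in>odometers M. \<forall>k w. Suc k < H \<longrightarrow> w \<in> odo_carrier (\<lambda>_. 2) \<longrightarrow> S (h k w) = h (Suc k) w"
proof -
  let ?l = "case_nat H (\<lambda>_. 2 :: nat)" and ?C = "odo_carrier (\<lambda>_. 2)"
  have l: "\<forall>t. ?l t \<ge> 2" using H by (simp split: nat.splits)
  define tl where "tl = (\<lambda>(z::nat \<Rightarrow> nat) i. z (Suc i))"
  define \<Phi> where "\<Phi> z = h (z 0) (tl z)" for z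
  have LM: "L k \<subseteq> space M" if "k < H" for k using L(1)[OF that] by (rule sets.sets_into_space)
  have spL: "space (restrict_space M (L k)) = L k" if "k < H" for k
    using LM[OF that] by (auto simp: space_restrict_space)
  have hb: "bij_betw (h k) ?C (L k)" if "k < H" for k
    using h[OF that] spL[OF that] by (simp add: borel_isomorphism_def)
  have carrier: "z \<in> odo_carrier ?l \<longleftrightarrow> z 0 < H \<and> tl z \<in> ?C" for z
  proof -
    have "(\<forall>i. z i < ?l i) \<longleftrightarrow> z 0 < ?l 0 \<and> (\<forall>i. z (Suc i) < ?l (Suc i))" by (metis not0_implies_Suc)
    then show ?thesis by (simp add: odo_carrier_def tl_def)
  qed
  have cons: "case_nat k w \<in> odo_carrier ?l" if "k < H" "w \<in> ?C" for k w
    using that unfolding carrier by (simp add: tl_def)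
  have cons_tl: "case_nat (z 0) (tl z) = z" for z by (auto simp: tl_def split: nat.splits)
  have \<Phi>cons: "\<Phi> (case_nat k w) = h k w" for k w by (simp add: \<Phi>_def tl_def)
  have tlm: "tl \<in> odo_space ?l \<rightarrow>\<^sub>M odo_space (\<lambda>_. 2)"
    unfolding odo_space_def
  proof (intro measurable_restrict_space2 measurable_restrict_space1)
    show "tl \<in> borel \<rightarrow>\<^sub>M borel"
      unfolding tl_def by (rule measurable_nat_seqI) (rule measurable_nat_seq_coord)
    show "tl \<in> space (restrict_space borel (odo_carrier ?l)) \<rightarrow> ?C"
      using carrier by (auto simp: space_restrict_space)
  qed
  have consm: "case_nat k \<in> odo_space (\<lambda>_. 2) \<rightarrow>\<^sub>M odo_space ?l" if "k < H" for k
    unfolding odo_space_def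
  proof (intro measurable_restrict_space2 measurable_restrict_space1)
    show "case_nat k \<in> borel \<rightarrow>\<^sub>M borel"
    proof (rule measurable_nat_seqI)
      fix i show "(\<lambda>x. case_nat k x i) \<in> borel \<rightarrow>\<^sub>M count_space UNIV"
        by (cases i) (auto intro: measurable_nat_seq_coord)
    qed
    show "case_nat k \<in> space (restrict_space borel ?C) \<rightarrow> odo_carrier ?l"
      using cons[OF that] by (auto simp: space_restrict_space)
  qed
  have iso: "borel_isomorphism (odo_space ?l) M \<Phi>"
  proof (rule borel_isomorphismI)
    have "inj_on \<Phi> (odo_carrier ?l)"
    proof (rule inj_onI)
      fix y z assume yz: "y \<in> odo_carrier ?l" "z \<in> odo_carrier ?l" "\<Phi> y = \<Phi> z"
      have "h (y 0) (tl y) \<in> L (y 0)" "h (z 0) (tl z) \<in> L (z 0)"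
        using yz carrier bij_betwE[OF hb] by blast+
      then have "y 0 = z 0"
        using yz carrier L(2) unfolding disjoint_family_on_def \<Phi>_def by (metis disjoint_iff lessThan_iff)
      moreover have "tl y = tl z"
        using yz carrier hb[of "z 0"] calculation unfolding \<Phi>_def bij_betw_def by (metis inj_onD)
      ultimately show "y = z" using cons_tl by metis
    qed
    moreover have "\<Phi> ` odo_carrier ?l = space M"
    proof (intro set_eqI iffI)
      fix x assume "x \<in> \<Phi> ` odo_carrier ?l"
      then obtain z where "z \<in> odo_carrier ?l" "x = \<Phi> z" by blast
      then show "x \<in> space M" using carrier bij_betwE[OF hb] LM unfolding \<Phi>_def by blast
    next
      fix x assume "x \<in> space M"
      then obtain k where k: "k < H" "x \<in> L k" using L(3) by auto
      then obtain w where "w \<in> ?C" "x = h k w" using hb[OF k(1)] unfolding bij_betw_def by blast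
      then show "x \<in> \<Phi> ` odo_carrier ?l" using cons[OF k(1)] \<Phi>cons by (metis imageI)
    qed
    ultimately show "bij_betw \<Phi> (space (odo_space ?l)) (space M)" by (simp add: bij_betw_def)
    show "\<Phi> \<in> odo_space ?l \<rightarrow>\<^sub>M M"
      unfolding \<Phi>_def
    proof (rule measurable_compose_countable'[where I = "{..<H}" and f = "\<lambda>k z. h k (tl z)" and g = "\<lambda>z. z 0"])
      show "(\<lambda>z. z 0) \<in> odo_space ?l \<rightarrow>\<^sub>M count_space {..<H}"
      proof (rule measurableI)
        fix z assume "z \<in> space (odo_space ?l)"
        then show "z 0 \<in> space (count_space {..<H})" using carrier by simp
      next
        fix A show "(\<lambda>z. z 0) -` A \<inter> space (odo_space ?l) \<in> sets (odo_space ?l)"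
          using measurable_sets[OF measurable_restrict_space1[OF measurable_nat_seq_coord[of 0], of "odo_carrier ?l"], of A]
          by (simp add: odo_space_def)
      qed
      fix k assume "k \<in> {..<H}"
      then have k: "k < H" by simp
      have "h k \<in> odo_space (\<lambda>_. 2) \<rightarrow>\<^sub>M M"
        using borel_isomorphism_imp_embedding[OF h[OF k]] borel_embedding_extend_cod[of _ M "L k" "h k"] L(1)[OF k]
        unfolding borel_embedding_def by blast
      then show "(\<lambda>z. h k (tl z)) \<in> odo_space ?l \<rightarrow>\<^sub>M M" by (rule measurable_compose[OF tlm])
    qed auto
    fix A assume A: "A \<in> sets (odo_space ?l)"
    have "\<Phi> ` A = (\<Union>k<H. h k ` (case_nat k -` A \<inter> space (odo_space (\<lambda>_. 2))))"
    proof (intro set_eqI iffI)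
      fix x assume "x \<in> \<Phi> ` A"
      then obtain z where z: "z \<in> A" "x = \<Phi> z" by blast
      then have "z 0 < H" "tl z \<in> ?C" using A carrier by (auto simp: sets_odo_space_iff)
      then show "x \<in> (\<Union>k<H. h k ` (case_nat k -` A \<inter> space (odo_space (\<lambda>_. 2))))"
        using z cons_tl by (auto simp: \<Phi>_def intro!: bexI[of _ "z 0"] image_eqI[of _ _ "tl z"])
    next
      fix x assume "x \<in> (\<Union>k<H. h k ` (case_nat k -` A \<inter> space (odo_space (\<lambda>_. 2))))"
      then obtain k w where "case_nat k w \<in> A" "x = h k w" by auto
      then show "x \<in> \<Phi> ` A" using \<Phi>cons by (metis imageI)
    qed
    also have "\<dots> \<in> sets M"
    proof (intro sets.finite_UN)
      fix k assume "k \<in> {..<H}"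
      then have k: "k < H" by simp
      have "borel_embedding (odo_space (\<lambda>_. 2)) M (h k)"
        by (rule borel_embedding_extend_cod[OF borel_isomorphism_imp_embedding[OF h[OF k]] L(1)[OF k]])
      then show "h k ` (case_nat k -` A \<inter> space (odo_space (\<lambda>_. 2))) \<in> sets M"
        using measurable_sets[OF consm[OF k] A] unfolding borel_embedding_def by blast
    qed auto
    finally show "\<Phi> ` A \<in> sets M" .
  qed
  define f where "f = inv_into (odo_carrier ?l) \<Phi>"
  have fi: "borel_isomorphism M (odo_space ?l) f"
    using borel_isomorphism_inv[OF iso] by (simp add: f_def)
  have bij: "bij_betw \<Phi> (odo_carrier ?l) (space M)" using iso by (simp add: borel_isomorphism_def)
  have f\<Phi>: "f (\<Phi> z) = z" if "z \<in> odo_carrier ?l" for z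
    unfolding f_def using bij that by (simp add: bij_betw_def)
  have \<Phi>f: "\<Phi> (f x) = x" if "x \<in> space M" for x
    unfolding f_def using bij that by (simp add: bij_betw_def f_inv_into_f)
  obtain S where S: "S \<in> odometers M" "\<And>x. x \<in> space M \<Longrightarrow> f (S x) = odo_add ?l (f x) odo_one"
    using odometer_of_coding[OF l fi] by blast
  have Sp: "S permutes space M" using S(1) by (simp add: odometers_def Aut_def)
  show ?thesis
  proof (intro bexI[OF _ S(1)] allI impI)
    fix k w assume k: "Suc k < H" and w: "w \<in> ?C"
    have z: "case_nat k w \<in> odo_carrier ?l" using cons k w by simp
    have x: "h k w \<in> space M" using bij_betwE[OF hb[of k]] LM[of k] k w by auto
    have "f (S (h k w)) = odo_add ?l (case_nat k w) odo_one"
      using S(2)[OF x] f\<Phi>[OF z] \<Phi>cons by simp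
    also have "\<dots> = case_nat (Suc k) w" by (rule odo_succ_first_digit[OF k w])
    finally have "\<Phi> (f (S (h k w))) = h (Suc k) w" using \<Phi>cons by simp
    then show "S (h k w) = h (Suc k) w" using \<Phi>f permutes_in_image[OF Sp] x by simp
  qed
qed

text \<open>Coordinates on the levels can be chosen freely, so they are adapted to \<open>U\<close>.
  Its action is prescribed between consecutive levels only; what happens after the last one is left
  to the carry of the odometer or to the rest.\<close>

proposition odometer_extending_partial_map:
  fixes L :: "nat \<Rightarrow> 'a set"
  assumes M: "standard_borel M" and K: "K \<ge> 2" and L: "\<And>k. k < K \<Longrightarrow> L k \<in> sets M" "disjoint_family_on L {..<K}"
    and unc: "uncountable (L 0)"
    and U: "\<And>k. Suc k < K \<Longrightarrow> borel_isomorphism (restrict_space M (L k)) (restrict_space M (L (Suc k))) U"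
    and R: "space M - (\<Union>k<K. L k) = {} \<or> uncountable (space M - (\<Union>k<K. L k))"
  shows "\<exists>S\<in>odometers M. \<forall>k. Suc k < K \<longrightarrow> (\<forall>x\<in>L k. S x = U x)"
proof -
  let ?R = "space M - (\<Union>k<K. L k)" and ?C = "odo_space (\<lambda>_. 2)"
  have Rm: "?R \<in> sets M" using L(1) by auto
  have LM: "L k \<subseteq> space M" if "k < K" for k using L(1)[OF that] by (rule sets.sets_into_space)
  obtain f where f: "borel_isomorphism ?C (restrict_space M (L 0)) f"
    using borel_isomorphic_cantor[OF M _ unc] L(1)[of 0] K by auto
  \<comment> \<open>One Cantor coordinate on the first level is carried along by \<open>U\<close>.
    In these coordinates \<open>U\<close> merely raises the level number, which is what the odometer
    does.\<close>
  define h where "h k = (U ^^ k) \<circ> f" for k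
  have h: "borel_isomorphism ?C (restrict_space M (L k)) (h k)" if "k < K" for k
    using that
  proof (induction k)
    case (Suc k)
    have "borel_isomorphism ?C (restrict_space M (L (Suc k))) (U \<circ> h k)"
      by (rule borel_isomorphism_comp[OF _ U]) (use Suc in auto)
    moreover have "U \<circ> h k = h (Suc k)" by (simp add: h_def o_assoc)
    ultimately show ?case by (simp only:)
  qed (simp add: h_def f)
  have hL: "\<exists>w\<in>odo_carrier (\<lambda>_. 2). x = h k w" if "k < K" "x \<in> L k" for k x
  proof -
    have "h k ` odo_carrier (\<lambda>_. 2) = L k"
      using h[OF that(1)] LM[OF that(1)] unfolding borel_isomorphism_def bij_betw_def
      by (simp add: space_restrict_space Int_absorb2)
    then show ?thesis using that(2) by blast
  qed
  have "\<exists>S\<in>odometers M. \<forall>k w. Suc k < K \<longrightarrow> w \<in> odo_carrier (\<lambda>_. 2) \<longrightarrow> S (h k w) = h (Suc k) w"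
  proof (cases "?R = {}")
    case True
    then have "(\<Union>k<K. L k) = space M" using LM by blast
    then show ?thesis using odometer_of_levels[of K L M h, OF K L _ h] by blast
  next
    case False
    then have "uncountable ?R" using R by blast
    from borel_isomorphic_cantor[OF M Rm this]
    obtain r where r: "borel_isomorphism ?C (restrict_space M ?R) r" by blast
    \<comment> \<open>A nonempty rest is appended as level number \<open>K\<close>; being
      uncountable it has a Cantor coordinate of its own.\<close>
    define L' where "L' k = (if k < K then L k else ?R)" for k
    define h' where "h' k = (if k < K then h k else r)" for k
    have "\<exists>S\<in>odometers M. \<forall>k w. Suc k < Suc K \<longrightarrow> w \<in> odo_carrier (\<lambda>_. 2) \<longrightarrow> S (h' k w) = h' (Suc k) w"
    proof (rule odometer_of_levels[of "Suc K" L' M h'])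
      show "2 \<le> Suc K" using K by simp
      show "L' k \<in> sets M" for k using L(1) Rm by (simp add: L'_def)
      show "disjoint_family_on L' {..<Suc K}"
        unfolding disjoint_family_on_def
      proof (intro ballI impI)
        fix i j assume ij: "i \<in> {..<Suc K}" "j \<in> {..<Suc K}" "i \<noteq> j"
        consider "i < K" "j < K" | "i < K" "j = K" | "i = K" "j < K" using ij by force
        then show "L' i \<inter> L' j = {}"
        proof cases
          case 1
          then show ?thesis using disjoint_family_onD[OF L(2), of i j] ij by (simp add: L'_def)
        qed (auto simp: L'_def)
      qed
      show "(\<Union>k<Suc K. L' k) = space M"
      proof -
        have "(\<Union>k<Suc K. L' k) = L' K \<union> (\<Union>k<K. L' k)" by (auto simp: less_Suc_eq)
        also have "\<dots> = ?R \<union> (\<Union>k<K. L k)" by (simp add: L'_def)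
        also have "\<dots> = space M" using LM by blast
        finally show ?thesis .
      qed
      show "borel_isomorphism ?C (restrict_space M (L' k)) (h' k)" for k
        using h r by (simp add: L'_def h'_def)
    qed
    then obtain S where S: "S \<in> odometers M"
      "\<And>k w. Suc k < Suc K \<Longrightarrow> w \<in> odo_carrier (\<lambda>_. 2) \<Longrightarrow> S (h' k w) = h' (Suc k) w" by blast
    show ?thesis
    proof (intro bexI[OF _ S(1)] allI impI)
      fix k w assume "Suc k < K" "w \<in> odo_carrier (\<lambda>_. 2)"
      then show "S (h k w) = h (Suc k) w" using S(2)[of k w] by (simp add: h'_def)
    qed
  qed
  then obtain S where S: "S \<in> odometers M"
    "\<And>k w. Suc k < K \<Longrightarrow> w \<in> odo_carrier (\<lambda>_. 2) \<Longrightarrow> S (h k w) = h (Suc k) w" by blast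
  have "S x = U x" if k: "Suc k < K" and x: "x \<in> L k" for k x
  proof -
    obtain w where w: "w \<in> odo_carrier (\<lambda>_. 2)" "x = h k w" using hL[OF Suc_lessD[OF k] x] by blast
    then show ?thesis using S(2)[OF k w(1)] by (simp add: h_def)
  qed
  then show ?thesis using S(1) by blast
qed

section \<open>Odometers have rank one\<close>

lemma Aut_comp: "S \<in> Aut M \<Longrightarrow> T \<in> Aut M \<Longrightarrow> S \<circ> T \<in> Aut M"
  by (rule AutI[OF borel_isomorphism_comp[OF Aut_borel_isomorphism Aut_borel_isomorphism]])
    (auto simp: Aut_def permutes_not_in)

lemma Aut_inv: "T \<in> Aut M \<Longrightarrow> inv T \<in> Aut M"
  by (simp add: Aut_def permutes_inv permutes_inv_inv[of T "space M"])

lemma Aut_funpow: "T \<in> Aut M \<Longrightarrow> T ^^ n \<in> Aut M"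
proof (induction n)
  case 0
  have "id \<in> Aut M" unfolding Aut_def by (simp add: permutes_id inv_id)
  then show ?case by (simp add: id_def)
qed (simp add: Aut_comp)

lemma Aut_permutes: "T \<in> Aut M \<Longrightarrow> T permutes space M"
  by (simp add: Aut_def)

lemma Aut_measurable: "T \<in> Aut M \<Longrightarrow> T \<in> M \<rightarrow>\<^sub>M M"
  by (simp add: Aut_def)

lemma Aut_bij: "T \<in> Aut M \<Longrightarrow> bij T"
  by (rule permutes_bij[OF Aut_permutes])

lemma Aut_image_sets: "T \<in> Aut M \<Longrightarrow> A \<in> sets M \<Longrightarrow> T ` A \<in> sets M"
  using borel_isomorphism_imp_embedding[OF Aut_borel_isomorphism] by (auto simp: borel_embedding_def)

lemma Aut_in_space: "T \<in> Aut M \<Longrightarrow> T x \<in> space M \<longleftrightarrow> x \<in> space M"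
  by (rule permutes_in_image[OF Aut_permutes])

lemma Aut_inverses:
  assumes "T \<in> Aut M"
  shows "T (inv T x) = x" "inv T (T x) = x"
  by (rule permutes_inverses[OF Aut_permutes[OF assms]])+

lemma Aut_funpow_inverse:
  assumes "T \<in> Aut M"
  shows "(T ^^ n) ((inv T ^^ n) x) = x"
proof (induction n)
  case (Suc n)
  have "(T ^^ Suc n) ((inv T ^^ Suc n) x) = (T ^^ n) (T (inv T ((inv T ^^ n) x)))"
    by (simp only: funpow_swap1[symmetric] funpow.simps comp_apply)
  then show ?case using Suc Aut_inverses(1)[OF assms] by simp
qed simp

lemma aperiodicD:
  assumes T: "T \<in> Aut M" and ap: "aperiodic M T" and x: "x \<in> space M" and k: "(T ^^ k) x = x"
  shows "k = 0"
proof (rule ccontr)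
  assume "k \<noteq> 0"
  have mult: "(T ^^ (k * m)) x = x" for m
    by (induction m) (simp_all add: funpow_add k)
  have "(T ^^ n) x \<in> (\<lambda>i. (T ^^ i) x) ` {..<k}" for n
  proof -
    have "(T ^^ n) x = (T ^^ (n mod k + k * (n div k))) x" by simp
    also have "\<dots> = (T ^^ (n mod k)) x" by (simp only: funpow_add comp_def mult)
    finally show ?thesis using \<open>k \<noteq> 0\<close> by auto
  qed
  \<comment> \<open>Going \<open>n\<close> steps back amounts to going \<open>k * n - n\<close>
    steps forward, because \<open>k * n\<close> is a multiple of the period.\<close>
  moreover have "(inv T ^^ n) x \<in> (\<lambda>i. (T ^^ i) x) ` {..<k}" for n
  proof -
    have "bij (T ^^ n)" by (rule Aut_bij[OF Aut_funpow[OF T]])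
    have "n \<le> k * n" using \<open>k \<noteq> 0\<close> by simp
    then have "(T ^^ n) ((T ^^ (k * n - n)) x) = x" using mult[of n]
      by (metis add_diff_inverse_nat comp_apply funpow_add not_less)
    moreover have "(T ^^ n) ((inv T ^^ n) x) = x"
      by (rule Aut_funpow_inverse[OF T])
    ultimately have "(inv T ^^ n) x = (T ^^ (k * n - n)) x"
      using \<open>bij (T ^^ n)\<close> by (metis bij_pointE)
    then show ?thesis using \<open>(T ^^ (k * n - n)) x \<in> (\<lambda>i. (T ^^ i) x) ` {..<k}\<close> by simp
  qed
  ultimately have "full_orbit T x \<subseteq> (\<lambda>i. (T ^^ i) x) ` {..<k}"
    unfolding full_orbit_def by blast
  then have "finite (full_orbit T x)" by (rule finite_subset) simp
  then show False using ap x by (simp add: aperiodic_def)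
qed

lemma aperiodicI:
  assumes T: "T \<in> Aut M" and "\<And>x k. x \<in> space M \<Longrightarrow> (T ^^ k) x = x \<Longrightarrow> k = 0"
  shows "aperiodic M T"
  unfolding aperiodic_def
proof
  fix x assume x: "x \<in> space M"
  have "inj (\<lambda>n. (T ^^ n) x)"
  proof (rule linorder_injI)
    fix i j :: nat assume ij: "i < j"
    show "(T ^^ i) x \<noteq> (T ^^ j) x"
    proof
      assume *: "(T ^^ i) x = (T ^^ j) x"
      have "(T ^^ j) x = (T ^^ i) ((T ^^ (j - i)) x)" using ij
        by (metis add_diff_inverse_nat comp_apply funpow_add less_not_sym)
      then have "(T ^^ (j - i)) x = x"
        using * Aut_bij[OF Aut_funpow[OF T, of i]] by (metis bij_pointE)
      then have "j - i = 0" by (rule assms(2)[OF x])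
      then show False using ij by simp
    qed
  qed
  then have "infinite (range (\<lambda>n. (T ^^ n) x))" by (rule range_inj_infinite)
  moreover have "range (\<lambda>n. (T ^^ n) x) \<subseteq> full_orbit T x" by (auto simp: full_orbit_def)
  ultimately show "infinite (full_orbit T x)" using finite_subset by blast
qed

text \<open>A Borel transversal of an aperiodic automorphism would have infinitely many pairwise disjoint
  translates of equal measure that cover the space.\<close>

lemma invariant_measure_not_smooth:
  assumes T: "T \<in> Aut M" and ap: "aperiodic M T"
    and \<mu>: "prob_space \<mu>" "sets \<mu> = sets M" and inv: "distr \<mu> M T = \<mu>"
  shows "\<not> smooth_aut M T"
proof
  assume "smooth_aut M T"
  then obtain A where A: "A \<in> sets M" and *: "\<forall>x\<in>space M. \<exists>!y. y \<in> A \<inter> full_orbit T x"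
    unfolding smooth_aut_def by (rule bexE)
  have tr: "\<exists>!y. y \<in> A \<inter> full_orbit T x" if "x \<in> space M" for x using * that by (rule bspec)
  interpret prob_space \<mu> by fact
  have sp: "space \<mu> = space M" by (rule sets_eq_imp_space_eq[OF \<mu>(2)])
  have Tm: "T \<in> \<mu> \<rightarrow>\<^sub>M M" unfolding measurable_cong_sets[OF \<mu>(2) refl] by (rule Aut_measurable[OF T])
  have pre: "emeasure \<mu> (T -` B \<inter> space M) = emeasure \<mu> B" if "B \<in> sets M" for B
    using emeasure_distr[OF Tm that] unfolding inv sp by (rule sym)
  \<comment> \<open>\<open>P n\<close> contains the points that reach \<open>A\<close> after
    \<open>n\<close> forward steps, \<open>N n\<close> those that reach it after \<open>n\<close>
    backward steps. Disjointness of the \<open>P n\<close> forces the common measure to be 0;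
    together the two families cover the space.\<close>
  define P where "P n = (T ^^ n) -` A \<inter> space M" for n
  define N where "N n = (T ^^ n) ` A" for n
  have AM: "A \<subseteq> space M" using A by (rule sets.sets_into_space)
  have Pm: "P n \<in> sets M" for n
    unfolding P_def by (rule measurable_sets[OF Aut_measurable[OF Aut_funpow[OF T]] A])
  have Nm: "N n \<in> sets M" for n unfolding N_def by (rule Aut_image_sets[OF Aut_funpow[OF T] A])
  have Pe: "emeasure \<mu> (P n) = emeasure \<mu> A" for n
  proof (induction n)
    case 0
    have "P 0 = A" using AM by (auto simp: P_def)
    then show ?case by (rule arg_cong)
  next
    case (Suc n)
    have "P (Suc n) = T -` P n \<inter> space M"
      unfolding P_def vimage_def funpow_Suc_right comp_apply
      using Aut_in_space[OF T] by auto
    then have "emeasure \<mu> (P (Suc n)) = emeasure \<mu> (P n)" using pre[OF Pm[of n]] by (rule ssubst)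
    then show ?case unfolding Suc .
  qed
  have Ne: "emeasure \<mu> (N n) = emeasure \<mu> A" for n
  proof (induction n)
    case (Suc n)
    have inj: "inj T" using Aut_bij[OF T] by (rule bij_is_inj)
    have "N (Suc n) = T ` N n" by (simp add: N_def image_comp)
    then have "T -` N (Suc n) = N n" using inj_vimage_image_eq[OF inj] by simp
    then have "T -` N (Suc n) \<inter> space M = N n" using sets.sets_into_space[OF Nm, of n] by blast
    then show ?case using pre[OF Nm, of "Suc n"] Suc by simp
  qed (simp add: N_def)
  have disj: "P i \<inter> P j = {}" if "i < j" for i j
  proof (rule ccontr)
    assume "P i \<inter> P j \<noteq> {}"
    then obtain x where x: "x \<in> space M" "(T ^^ i) x \<in> A" "(T ^^ j) x \<in> A" by (auto simp: P_def)
    moreover have "(T ^^ i) x \<in> full_orbit T x" "(T ^^ j) x \<in> full_orbit T x" by (auto simp: full_orbit_def)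
    ultimately have eq: "(T ^^ i) x = (T ^^ j) x" using tr[OF x(1)] by blast
    have "(T ^^ j) x = (T ^^ (j - i)) ((T ^^ i) x)"
      using funpow_add[of "j - i" i T] that by simp
    then have "(T ^^ (j - i)) ((T ^^ i) x) = (T ^^ i) x" using eq by simp
    moreover have "(T ^^ i) x \<in> space M" using Aut_in_space[OF Aut_funpow[OF T]] x(1) by simp
    ultimately have "j - i = 0" using aperiodicD[OF T ap] by blast
    then show False using that by simp
  qed
  have "disjoint_family P"
    unfolding disjoint_family_on_def
  proof (intro ballI impI)
    fix i j :: nat assume "i \<noteq> j"
    then consider "i < j" | "j < i" by linarith
    then show "P i \<inter> P j = {}" using disj by cases blast+
  qed
  then have disjP: "disjoint_family_on P {..<n}" for n
    by (rule disjoint_family_on_mono[rotated]) simp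
  have "real n * measure \<mu> A \<le> 1" for n
  proof -
    have "measure \<mu> (\<Union>i<n. P i) = (\<Sum>i<n. measure \<mu> (P i))"
      using Pm \<mu>(2) disjP by (intro finite_measure_finite_Union) auto
    also have "\<dots> = real n * measure \<mu> A" by (simp add: measure_def Pe)
    finally show ?thesis using prob_le_1 by metis
  qed
  then have "measure \<mu> A = 0"
    using ex_less_of_nat_mult[of "measure \<mu> A" 1] measure_nonneg[of \<mu> A] by (metis less_eq_real_def not_less)
  then have "emeasure \<mu> A = 0" by (simp add: emeasure_eq_measure)
  then have "P n \<in> null_sets \<mu>" "N n \<in> null_sets \<mu>" for n
    using Pe Ne Pm Nm \<mu>(2) by (simp_all add: null_setsI)
  then have z: "(\<Union>n. P n \<union> N n) \<in> null_sets \<mu>" by (intro null_sets_UN null_sets.Un)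
  have "space M \<subseteq> (\<Union>n. P n \<union> N n)"
  proof
    fix x assume x: "x \<in> space M"
    then obtain y where y: "y \<in> A" "y \<in> full_orbit T x" using tr by blast
    then obtain n where "y = (T ^^ n) x \<or> y = (inv T ^^ n) x" by (auto simp: full_orbit_def)
    then show "x \<in> (\<Union>n. P n \<union> N n)"
    proof
      assume "y = (T ^^ n) x"
      then show ?thesis using x y by (auto simp: P_def)
    next
      assume "y = (inv T ^^ n) x"
      moreover have "(T ^^ n) ((inv T ^^ n) x) = x"
        by (rule Aut_funpow_inverse[OF T])
      ultimately show ?thesis using y by (auto simp: N_def intro!: exI[of _ n] image_eqI[of _ _ y])
    qed
  qed
  then have "emeasure \<mu> (space M) \<le> emeasure \<mu> (\<Union>n. P n \<union> N n)"
    using Pm Nm \<mu>(2) by (intro emeasure_mono) auto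
  also have "\<dots> = 0"
    using z by (rule null_setsD1)
  finally show False using emeasure_space_1 sp by simp
qed

section \<open>Levels and Haar measure of a coded odometer\<close>

locale odometer_coding =
  fixes M :: "'a measure" and T :: "'a \<Rightarrow> 'a" and l :: "nat \<Rightarrow> nat" and \<phi> :: "'a \<Rightarrow> nat \<Rightarrow> nat"
  assumes T: "T \<in> Aut M" and l: "\<forall>t. l t \<ge> 2" and iso: "borel_isomorphism M (odo_space l) \<phi>"
    and conj: "\<And>x. x \<in> space M \<Longrightarrow> \<phi> (T x) = odo_add l (\<phi> x) odo_one"
begin

text \<open>The residue of the code serves as the number of the level in the \<open>n\<close>-th
  tower, which has \<open>odo_prod l n\<close> levels; \<open>T\<close> increases it by 1
  cyclically.\<close>

definition v :: "nat \<Rightarrow> 'a \<Rightarrow> nat" where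
  "v n x = odo_val l n (\<phi> x)"

definition Lev :: "nat \<Rightarrow> nat \<Rightarrow> 'a set" where
  "Lev n i = {x \<in> space M. v n x = i}"

lemma \<phi>_carrier: "x \<in> space M \<Longrightarrow> \<phi> x \<in> odo_carrier l"
  using iso by (auto simp: borel_isomorphism_iff_embedding)

lemma v_less: "x \<in> space M \<Longrightarrow> v n x < odo_prod l n"
  unfolding v_def by (intro odo_val_less \<phi>_carrier)

lemma v_funpow: "x \<in> space M \<Longrightarrow> v n ((T ^^ k) x) = (v n x + k) mod odo_prod l n"
proof (induction k)
  case 0
  then show ?case using v_less by simp
next
  case (Suc k)
  have "(T ^^ k) x \<in> space M" using Aut_in_space[OF Aut_funpow[OF T]] Suc.prems by simp
  then have "v n ((T ^^ Suc k) x) = (v n ((T ^^ k) x) + 1) mod odo_prod l n"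
    by (simp add: v_def conj odo_val_succ[OF l])
  then show ?case using Suc by (simp add: mod_simps)
qed

lemma image_Lev:
  assumes "i < odo_prod l n"
  shows "(T ^^ i) ` Lev n 0 = Lev n i"
proof (intro set_eqI iffI)
  fix x assume "x \<in> (T ^^ i) ` Lev n 0"
  then show "x \<in> Lev n i"
    using v_funpow Aut_in_space[OF Aut_funpow[OF T]] assms by (auto simp: Lev_def)
next
  fix x assume x: "x \<in> Lev n i"
  define y where "y = inv (T ^^ i) x"
  have xy: "x = (T ^^ i) y" unfolding y_def by (rule Aut_inverses(1)[OF Aut_funpow[OF T], symmetric])
  have y: "y \<in> space M" using x Aut_in_space[OF Aut_funpow[OF T]] unfolding xy Lev_def by simp
  then have "(v n y + i) mod odo_prod l n = i" using x v_funpow by (simp add: xy Lev_def)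
  moreover have "v n y < odo_prod l n" by (rule v_less[OF y])
  ultimately have "v n y = 0" using assms
    by (cases "v n y + i < odo_prod l n") (auto simp: le_mod_geq)
  then show "x \<in> (T ^^ i) ` Lev n 0" using xy y by (auto simp: Lev_def)
qed

lemma v_measurable: "v n \<in> M \<rightarrow>\<^sub>M count_space UNIV"
proof (induction n)
  case (Suc n)
  have "\<phi> \<in> M \<rightarrow>\<^sub>M borel"
    using iso by (auto simp: borel_isomorphism_def odo_space_def measurable_restrict_space2_iff)
  from measurable_compose[OF this measurable_nat_seq_coord[of n]]
  have coord: "(\<lambda>x. \<phi> x n) \<in> M \<rightarrow>\<^sub>M count_space UNIV" .
  have "(\<lambda>x. v n x + \<phi> x n * odo_prod l n) \<in> M \<rightarrow>\<^sub>M count_space UNIV"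
  proof (rule measurable_compose_countable[where f = "\<lambda>k x. v n x + k * odo_prod l n", OF _ coord])
    fix k
    show "(\<lambda>x. v n x + k * odo_prod l n) \<in> M \<rightarrow>\<^sub>M count_space UNIV"
      using measurable_compose[OF Suc, of "\<lambda>m. m + k * odo_prod l n" "count_space UNIV"] by simp
  qed
  then show ?case by (simp add: v_def)
qed (simp add: v_def)

lemma Lev_sets: "Lev n i \<in> sets M"
proof -
  have "v n -` {i} \<inter> space M \<in> sets M" by (rule measurable_sets[OF v_measurable]) simp
  moreover have "v n -` {i} \<inter> space M = Lev n i" by (auto simp: Lev_def)
  ultimately show ?thesis by simp
qed

lemma v_mod: "n \<le> m \<Longrightarrow> x \<in> space M \<Longrightarrow> v m x mod odo_prod l n = v n x"
proof (induction rule: dec_induct)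
  case base
  then show ?case using v_less by simp
next
  case (step m)
  have "odo_prod l n dvd odo_prod l m"
    using step.hyps(1) unfolding odo_prod_def by (intro prod_dvd_prod_subset) auto
  then have "v (Suc m) x mod odo_prod l n = (v (Suc m) x mod odo_prod l m) mod odo_prod l n"
    by (simp add: mod_mod_cancel)
  also have "v (Suc m) x mod odo_prod l m = v m x"
    unfolding v_def by (rule odo_val_div_mod(2)[OF \<phi>_carrier[OF step.prems]])
  finally show ?case using step by simp
qed

lemma aperiodic: "aperiodic M T"
proof (rule aperiodicI[OF T])
  fix x k assume x: "x \<in> space M" "(T ^^ k) x = x"
  have lt: "k < odo_prod l k" using odo_prod_ge[OF l, of k] less_exp[of k] by linarith
  have "(v k x + k) mod odo_prod l k = v k x" using v_funpow[OF x(1), of k k] x(2) by simp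
  moreover have "v k x < odo_prod l k" by (rule v_less[OF x(1)])
  ultimately show "k = 0" using lt
    by (cases "v k x + k < odo_prod l k") (auto simp: le_mod_geq)
qed

text \<open>Each digit is a function of a residue, so \<open>\<phi>\<close> is measurable already
  for the sigma-algebra generated by the levels. Any measurable \<open>A\<close> is the preimage of
  its Borel image under the injective \<open>\<phi>\<close>.\<close>

lemma generates: "sets M = sigma_sets (space M) {Lev n i | n i. i < odo_prod l n}"
proof
  show "sigma_sets (space M) {Lev n i | n i. i < odo_prod l n} \<subseteq> sets M"
    by (rule sets.sigma_sets_subset) (auto intro: Lev_sets)
  define N where "N = sigma (space M) {Lev n i | n i. i < odo_prod l n}"
  have sub: "{Lev n i | n i. i < odo_prod l n} \<subseteq> Pow (space M)" by (auto simp: Lev_def)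
  have spN: "space N = space M" and setsN: "sets N = sigma_sets (space M) {Lev n i | n i. i < odo_prod l n}"
    unfolding N_def using sub by (simp_all add: space_measure_of sets_measure_of)
  have LN: "Lev n i \<in> sets N" if "i < odo_prod l n" for n i unfolding setsN using that by blast
  have "\<phi> \<in> N \<rightarrow>\<^sub>M borel"
  proof (rule measurable_nat_seqI)
    fix i
    show "(\<lambda>x. \<phi> x i) \<in> N \<rightarrow>\<^sub>M count_space UNIV"
      unfolding measurable_count_space_eq2_countable
    proof (intro conjI ballI)
      fix a
      have "(\<lambda>x. \<phi> x i) -` {a} \<inter> space N = (\<Union>j\<in>{j. j < odo_prod l (Suc i) \<and> j div odo_prod l i = a}. Lev (Suc i) j)"
      proof (intro set_eqI iffI)
        fix x assume "x \<in> (\<lambda>x. \<phi> x i) -` {a} \<inter> space N"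
        then have x: "x \<in> space M" "\<phi> x i = a" by (auto simp: spN)
        then have "v (Suc i) x div odo_prod l i = a" "v (Suc i) x < odo_prod l (Suc i)"
          using odo_val_div_mod(1)[OF \<phi>_carrier[OF x(1)], of i] v_less[OF x(1), of "Suc i"] x(2)
          by (simp_all add: v_def del: odo_val_simps odo_prod_simps)
        then show "x \<in> (\<Union>j\<in>{j. j < odo_prod l (Suc i) \<and> j div odo_prod l i = a}. Lev (Suc i) j)"
          using x by (auto simp: Lev_def simp del: odo_prod_simps)
      next
        fix x assume "x \<in> (\<Union>j\<in>{j. j < odo_prod l (Suc i) \<and> j div odo_prod l i = a}. Lev (Suc i) j)"
        then have x: "x \<in> space M" "v (Suc i) x div odo_prod l i = a" by (auto simp: Lev_def)
        then show "x \<in> (\<lambda>x. \<phi> x i) -` {a} \<inter> space N"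
          using odo_val_div_mod(1)[OF \<phi>_carrier[OF x(1)], of i] by (simp add: v_def spN del: odo_val_simps)
      qed
      also have "\<dots> \<in> sets N" by (intro sets.finite_UN LN) auto
      finally show "(\<lambda>x. \<phi> x i) -` {a} \<inter> space N \<in> sets N" .
    qed auto
  qed
  note \<phi>N = this
  show "sets M \<subseteq> sigma_sets (space M) {Lev n i | n i. i < odo_prod l n}"
  proof
    fix A assume A: "A \<in> sets M"
    have "\<phi> ` A \<in> sets borel"
      using borel_isomorphism_imp_embedding[OF iso] A by (simp add: borel_embedding_def sets_odo_space_iff)
    then have "\<phi> -` (\<phi> ` A) \<inter> space N \<in> sets N" by (rule measurable_sets[OF \<phi>N])
    moreover have "\<phi> -` (\<phi> ` A) \<inter> space N = A"
    proof -
      have "inj_on \<phi> (space M)" using iso by (simp add: borel_isomorphism_def bij_betw_def)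
      then show ?thesis
        using sets.sets_into_space[OF A] unfolding spN by (auto dest: inj_onD)
    qed
    ultimately show "A \<in> sigma_sets (space M) {Lev n i | n i. i < odo_prod l n}" using setsN by simp
  qed
qed

lemma atoms_eq: "atoms T (Lev n 0) (odo_prod l n - 1) = {Lev n i | i. i < odo_prod l n}"
proof -
  have "{..odo_prod l n - 1} = {..<odo_prod l n}" using odo_prod_pos[OF l, of n] by auto
  then have "atoms T (Lev n 0) (odo_prod l n - 1) = (\<lambda>i. (T ^^ i) ` Lev n 0) ` {..<odo_prod l n}"
    by (simp add: atoms_def)
  also have "\<dots> = Lev n ` {..<odo_prod l n}" by (intro image_cong) (auto simp: image_Lev)
  finally show ?thesis by auto
qed

lemma Union_Lev: "\<Union>{Lev n i | i. i < odo_prod l n} = space M"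
  using v_less by (auto simp: Lev_def)

lemma Lev_is_tower:
  assumes "uncountable (space M)"
  shows "is_tower M T (Lev n 0) (odo_prod l n - 1)"
  unfolding is_tower_def
proof (intro conjI allI impI)
  have im: "(T ^^ i) ` Lev n 0 = Lev n i" if "i \<le> odo_prod l n - 1" for i
    using that odo_prod_pos[OF l, of n] by (intro image_Lev) linarith
  show "(T ^^ i) ` Lev n 0 \<in> sets M" if "i \<le> odo_prod l n - 1" for i
    using im[OF that] Lev_sets by simp
  show "disjoint_family_on (\<lambda>i. (T ^^ i) ` Lev n 0) {..odo_prod l n - 1}"
    unfolding disjoint_family_on_def using im by (auto simp: Lev_def)
  show "uncountable (Lev n 0)"
  proof
    assume "countable (Lev n 0)"
    then have "countable (\<Union>i<odo_prod l n. (T ^^ i) ` Lev n 0)" by auto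
    moreover have "(\<Union>i<odo_prod l n. (T ^^ i) ` Lev n 0) = space M"
      using Union_Lev[of n] by (auto simp: image_Lev)
    ultimately show False using assms by simp
  qed
qed

lemma Lev_nonempty:
  assumes "i < odo_prod l n"
  shows "Lev n i \<noteq> {}"
proof -
  have "(\<lambda>_. 0) \<in> odo_carrier l" using l by (auto simp: odo_carrier_def) (metis less_le_trans pos2)
  then have "(\<lambda>_. 0) \<in> \<phi> ` space M" using iso by (simp add: borel_isomorphism_iff_embedding)
  then obtain x where "x \<in> space M" "\<phi> x = (\<lambda>_. 0)" by auto
  then have "x \<in> Lev n 0" by (simp add: Lev_def v_def odo_val_def)
  then show ?thesis using image_Lev[OF assms] by blast
qed

lemma odo_val_eq_iff:
  assumes "y \<in> odo_carrier l" "z \<in> odo_carrier l"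
  shows "odo_val l n y = odo_val l n z \<longleftrightarrow> (\<forall>j<n. y j = z j)"
proof (induction n)
  case (Suc n)
  have "odo_val l (Suc n) y = odo_val l (Suc n) z \<longleftrightarrow> odo_val l n y = odo_val l n z \<and> y n = z n"
    using odo_val_div_mod[OF assms(1), of n] odo_val_div_mod[OF assms(2), of n]
    by (metis odo_val_simps(2))
  then show ?case using Suc by (auto simp: less_Suc_eq)
qed simp

definition haar :: "'a measure" where
  "haar = distr (PiM UNIV (\<lambda>i. uniform_count_measure {..<l i})) M (inv_into (space M) \<phi>)"

lemma coding_measurable: "inv_into (space M) \<phi> \<in> PiM UNIV (\<lambda>i. uniform_count_measure {..<l i}) \<rightarrow>\<^sub>M M"
proof -
  let ?P = "PiM UNIV (\<lambda>i. uniform_count_measure {..<l i})"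
  have sp: "space ?P = odo_carrier l"
    by (auto simp: space_PiM space_uniform_count_measure odo_carrier_def)
  have "(\<lambda>z. z) \<in> ?P \<rightarrow>\<^sub>M borel"
  proof (rule measurable_nat_seqI)
    fix i
    have "(\<lambda>z. z i) \<in> ?P \<rightarrow>\<^sub>M uniform_count_measure {..<l i}" by (rule measurable_component_singleton) simp
    moreover have "(\<lambda>k. k) \<in> uniform_count_measure {..<l i} \<rightarrow>\<^sub>M count_space UNIV"
      by (auto simp: measurable_def space_uniform_count_measure sets_uniform_count_measure)
    ultimately show "(\<lambda>z. z i) \<in> ?P \<rightarrow>\<^sub>M count_space UNIV" by (rule measurable_compose)
  qed
  then have "(\<lambda>z. z) \<in> ?P \<rightarrow>\<^sub>M odo_space l"
    unfolding odo_space_def by (intro measurable_restrict_space2) (auto simp: sp)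
  moreover have "inv_into (space M) \<phi> \<in> odo_space l \<rightarrow>\<^sub>M M" using iso by (simp add: borel_isomorphism_def)
  ultimately show ?thesis by (rule measurable_compose)
qed

lemma product_prob: "product_prob_space (\<lambda>i. uniform_count_measure {..<l i})"
proof (rule product_prob_spaceI)
  fix i
  have "l i \<ge> 2" using l by simp
  then have "{..<l i} \<noteq> {}" by (auto simp: lessThan_empty_iff)
  then show "prob_space (uniform_count_measure {..<l i})" by (intro prob_space_uniform_count_measure) auto
qed

lemma prob_space_haar: "prob_space haar"
proof -
  interpret product_prob_space "\<lambda>i. uniform_count_measure {..<l i}" UNIV by (rule product_prob)
  show ?thesis unfolding haar_def by (rule prob_space.prob_space_distr[OF prob_space_PiM coding_measurable]) (rule M.prob_space_axioms)
qed

text \<open>In digit space a level is the cylinder given by the first \<open>n\<close> digits of any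
  of its points. What matters is that the value is independent of \<open>i\<close>: preimages under
  \<open>T\<close> permute the levels of one tower.\<close>

lemma haar_Lev:
  assumes "i < odo_prod l n"
  shows "emeasure haar (Lev n i) = (\<Prod>j<n. ennreal (1 / l j))"
proof -
  let ?P = "PiM UNIV (\<lambda>i. uniform_count_measure {..<l i})"
  interpret product_prob_space "\<lambda>i. uniform_count_measure {..<l i}" UNIV by (rule product_prob)
  obtain x where x: "x \<in> Lev n i" using Lev_nonempty[OF assms] by blast
  have sp: "space ?P = odo_carrier l"
    by (auto simp: space_PiM space_uniform_count_measure odo_carrier_def)
  have bij: "bij_betw \<phi> (space M) (odo_carrier l)" using iso by (simp add: borel_isomorphism_def)
  have "inv_into (space M) \<phi> -` Lev n i \<inter> space ?P = {z \<in> space ?P. \<forall>j\<in>{..<n}. z j \<in> {\<phi> x j}}"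
  proof (intro set_eqI)
    fix z
    show "z \<in> inv_into (space M) \<phi> -` Lev n i \<inter> space ?P \<longleftrightarrow> z \<in> {z \<in> space ?P. \<forall>j\<in>{..<n}. z j \<in> {\<phi> x j}}"
    proof (cases "z \<in> odo_carrier l")
      case True
      then have "\<phi> (inv_into (space M) \<phi> z) = z" "inv_into (space M) \<phi> z \<in> space M"
        using bij by (auto simp: bij_betw_def f_inv_into_f inv_into_into)
      then show ?thesis using x True odo_val_eq_iff[OF True \<phi>_carrier, of x n]
        by (auto simp: Lev_def v_def sp)
    qed (simp add: sp)
  qed
  then have "emeasure haar (Lev n i) = emeasure ?P {z \<in> space ?P. \<forall>j\<in>{..<n}. z j \<in> {\<phi> x j}}"
    unfolding haar_def by (simp add: emeasure_distr[OF coding_measurable Lev_sets])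
  also have "\<dots> = (\<Prod>j\<in>{..<n}. emeasure (uniform_count_measure {..<l j}) {\<phi> x j})"
    using \<phi>_carrier[of x] x
    by (intro emeasure_PiM_Collect) (auto simp: sets_uniform_count_measure odo_carrier_def Lev_def)
  also have "\<dots> = (\<Prod>j<n. ennreal (1 / l j))"
    using \<phi>_carrier[of x] x
    by (intro prod.cong) (auto simp: emeasure_uniform_count_measure odo_carrier_def Lev_def)
  finally show ?thesis .
qed

lemma vimage_Lev:
  assumes "i < odo_prod l n"
  shows "\<exists>j<odo_prod l n. T -` Lev n i \<inter> space M = Lev n j"
proof -
  let ?p = "odo_prod l n"
  have vT: "v n (T x) = (v n x + 1) mod ?p" if "x \<in> space M" for x
    using v_funpow[OF that, of n 1] by simp
  define j where "j = (if i = 0 then ?p - 1 else i - 1)"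
  have j: "j < ?p" using assms by (auto simp: j_def)
  have key: "(a + 1) mod ?p = i \<longleftrightarrow> a = j" if "a < ?p" for a
  proof (cases "a + 1 < ?p")
    case True
    then show ?thesis by (auto simp: j_def)
  next
    case False
    then have "a + 1 = ?p" using that by simp
    then show ?thesis using assms by (auto simp: j_def)
  qed
  have "T -` Lev n i \<inter> space M = Lev n j"
  proof (rule set_eqI)
    fix x show "x \<in> T -` Lev n i \<inter> space M \<longleftrightarrow> x \<in> Lev n j"
    proof (cases "x \<in> space M")
      case True
      then show ?thesis using key[OF v_less[OF True]] vT[OF True] Aut_in_space[OF T]
        unfolding Lev_def by simp
    qed (simp add: Lev_def)
  qed
  then show ?thesis using j by blast
qed

text \<open>Two levels, also of different towers, are nested or disjoint. Together with the empty
  set they thus form an intersection-stable generator, on which invariance follows from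
  \<open>vimage_Lev\<close> and \<open>haar_Lev\<close>.\<close>

lemma haar_invariant: "distr haar M T = haar"
proof (rule measure_eqI_generator_eq)
  let ?E = "insert {} {Lev n i | n i. i < odo_prod l n}"
  have sets_haar: "sets haar = sets M" by (simp add: haar_def)
  have Tm: "T \<in> haar \<rightarrow>\<^sub>M M" unfolding measurable_cong_sets[OF sets_haar refl] by (rule Aut_measurable[OF T])
  have sub: "?E \<subseteq> Pow (space M)" by (auto simp: Lev_def)
  then show "?E \<subseteq> Pow (space M)" .
  have gen: "sets M = sigma_sets (space M) ?E"
  proof
    show "sets M \<subseteq> sigma_sets (space M) ?E"
      unfolding generates by (intro sigma_sets_mono') blast
    show "sigma_sets (space M) ?E \<subseteq> sets M"
      by (rule sets.sigma_sets_subset) (auto intro: Lev_sets)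
  qed
  then show "sets (distr haar M T) = sigma_sets (space M) ?E" "sets haar = sigma_sets (space M) ?E"
    using sets_haar by simp_all
  have int: "Lev n i \<inter> Lev m j = {} \<or> Lev n i \<inter> Lev m j = Lev m j" if nm: "n \<le> m" for n i m j
  proof (cases "Lev n i \<inter> Lev m j = {}")
    case False
    then obtain y where y: "y \<in> space M" "v n y = i" "v m y = j" by (auto simp: Lev_def)
    have "Lev m j \<subseteq> Lev n i"
    proof
      fix x assume "x \<in> Lev m j"
      then have "x \<in> space M" "v m x = j" by (auto simp: Lev_def)
      then show "x \<in> Lev n i" using v_mod[OF nm y(1)] v_mod[OF nm, of x] y by (simp add: Lev_def)
    qed
    then show ?thesis by blast
  qed simp
  show "Int_stable ?E"
  proof (rule Int_stableI)
    fix a b assume "a \<in> ?E" "b \<in> ?E"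
    then consider "a = {} \<or> b = {}" | n i m j where "a = Lev n i" "i < odo_prod l n" "b = Lev m j" "j < odo_prod l m"
      by blast
    then show "a \<inter> b \<in> ?E"
    proof cases
      case 2
      then have "a \<inter> b \<in> {{}, a, b}"
        using int[of n m i j] int[of m n j i] by (cases "n \<le> m") (auto simp: Int_commute)
      then show ?thesis using \<open>a \<in> ?E\<close> \<open>b \<in> ?E\<close> by auto
    qed auto
  qed
  show "emeasure (distr haar M T) X = emeasure haar X" if X: "X \<in> ?E" for X
  proof (cases "X = {}")
    case False
    then obtain n i where i: "X = Lev n i" "i < odo_prod l n" using X by blast
    obtain j where j: "j < odo_prod l n" "T -` Lev n i \<inter> space M = Lev n j"
      using vimage_Lev[OF i(2)] by blast
    have "emeasure (distr haar M T) X = emeasure haar (Lev n j)"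
      using emeasure_distr[OF Tm Lev_sets, of n i] i j sets_eq_imp_space_eq[OF sets_haar] by simp
    then show ?thesis using haar_Lev[OF i(2)] haar_Lev[OF j(1)] i(1) by simp
  qed simp
  have "Lev 0 0 = space M" by (auto simp: Lev_def v_def)
  moreover have "Lev 0 0 \<in> ?E" by force
  ultimately show "range (\<lambda>_::nat. space M) \<subseteq> ?E" "(\<Union>_::nat. space M) = space M" by auto
  interpret haar: prob_space "distr haar M T"
    by (rule prob_space.prob_space_distr[OF prob_space_haar Tm])
  show "emeasure (distr haar M T) (space M) \<noteq> \<infinity>" using haar.emeasure_finite by simp
qed

lemma rank_one:
  assumes "uncountable (space M)"
  shows "rank_one M T"
proof -
  let ?B = "\<lambda>n. Lev n 0" and ?h = "\<lambda>n. odo_prod l n - 1"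
  have ns: "\<not> smooth_aut M T"
    by (rule invariant_measure_not_smooth[OF T aperiodic prob_space_haar _ haar_invariant]) (simp add: haar_def)
  have ref: "\<exists>b\<in>atoms T (?B n) (?h n). a \<subseteq> b" if a: "a \<in> atoms T (?B (Suc n)) (?h (Suc n))" for n a
  proof -
    obtain i where i: "a = Lev (Suc n) i" "i < odo_prod l (Suc n)" using a unfolding atoms_eq by blast
    have "a \<subseteq> Lev n (i mod odo_prod l n)" using v_mod[of n "Suc n"] i by (auto simp: Lev_def)
    moreover have "i mod odo_prod l n < odo_prod l n" using odo_prod_pos[OF l] by simp
    ultimately show ?thesis unfolding atoms_eq by blast
  qed
  have gen: "sigma_sets (space M) (\<Union>n. atoms T (?B n) (?h n)) = sets M"
  proof -
    have "(\<Union>n. atoms T (?B n) (?h n)) = {Lev n i | n i. i < odo_prod l n}" unfolding atoms_eq by blast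
    then show ?thesis using generates by simp
  qed
  have un: "\<Union>(atoms T (?B n) (?h n)) = space M" for n unfolding atoms_eq by (rule Union_Lev)
  show ?thesis
    unfolding rank_one_def
    by (intro conjI T aperiodic ns exI[of _ ?B] exI[of _ ?h] allI ballI Lev_is_tower assms gen disjI1 ref)
      (simp_all only: un, simp_all)
qed

end

theorem odometers_rank_one:
  assumes "uncountable (space M)" "T \<in> odometers M"
  shows "rank_one M T"
proof -
  obtain l \<phi> where "\<forall>t. l t \<ge> 2" "borel_isomorphism M (odo_space l) \<phi>"
    "\<forall>x\<in>space M. \<phi> (T x) = odo_add l (\<phi> x) odo_one" and "T \<in> Aut M"
    using assms(2) by (auto simp: odometers_def)
  then interpret odometer_coding M T l \<phi> by unfold_locales auto
  show ?thesis by (rule rank_one[OF assms(1)])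
qed

section \<open>Approximating rank one automorphisms\<close>

lemma Aut_funpow_inverse':
  assumes "T \<in> Aut M"
  shows "(inv T ^^ n) ((T ^^ n) x) = x"
  using Aut_funpow_inverse[OF Aut_inv[OF assms], of n x] permutes_inv_inv[OF Aut_permutes[OF assms]] by simp

lemma singleton_sets:
  assumes "standard_borel M" "a \<in> space M"
  shows "{a} \<in> sets M"
proof -
  have "{x \<in> space M. id x \<noteq> (\<lambda>_. a) x} \<in> sets M"
    using assms by (intro neq_set_measurable) auto
  then have "space M - {x \<in> space M. id x \<noteq> (\<lambda>_. a) x} \<in> sets M" by blast
  moreover have "space M - {x \<in> space M. id x \<noteq> (\<lambda>_. a) x} = {a}" using assms(2) by auto
  ultimately show ?thesis by simp
qed

lemma transpose_Aut:
  assumes "standard_borel M" "a \<in> space M" "b \<in> space M"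
  shows "Transposition.transpose a b \<in> Aut M"
proof -
  have ab: "{a} \<inter> space M \<in> sets M" "{b} \<inter> space M \<in> sets M"
    using singleton_sets[OF assms(1,2)] singleton_sets[OF assms(1,3)] assms(2,3) by simp_all
  have "(\<lambda>x. if x \<in> {a} then b else if x \<in> {b} then a else x) \<in> M \<rightarrow>\<^sub>M M"
    using assms(2,3) by (intro measurable_If_set ab measurable_const measurable_ident_sets refl)
  moreover have "(\<lambda>x. if x \<in> {a} then b else if x \<in> {b} then a else x) = Transposition.transpose a b"
    by (simp add: Transposition.transpose_def fun_eq_iff)
  ultimately have "Transposition.transpose a b \<in> M \<rightarrow>\<^sub>M M" by simp
  moreover have "Transposition.transpose a b permutes space M" by (rule permutes_swap_id[OF assms(2,3)])
  ultimately show ?thesis by (simp add: Aut_def)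
qed

lemma Aut_restrict_isomorphism:
  assumes "T \<in> Aut M" "A \<in> sets M" "T ` A = B"
  shows "borel_isomorphism (restrict_space M A) (restrict_space M B) T"
  using borel_embedding_restrict_image[OF borel_isomorphism_imp_embedding[OF Aut_borel_isomorphism] assms(2)] assms
  by blast

lemma borel_isomorphism_restrict_cong:
  assumes "borel_isomorphism (restrict_space M A) N f" "\<And>x. x \<in> A \<Longrightarrow> g x = f x"
  shows "borel_isomorphism (restrict_space M A) N g"
  by (rule borel_isomorphism_cong[OF assms(1)]) (use assms(2) in \<open>auto simp: space_restrict_space\<close>)

lemma funpow_in_full_orbit:
  assumes "T \<in> Aut M"
  shows "(T ^^ j) b \<in> full_orbit T ((T ^^ i) b)"
proof (cases "i \<le> j")
  case True
  then have "(T ^^ j) b = (T ^^ (j - i)) ((T ^^ i) b)" using funpow_add[of "j - i" i T] by simp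
  then show ?thesis by (auto simp: full_orbit_def)
next
  case False
  then have "(T ^^ i) b = (T ^^ (i - j)) ((T ^^ j) b)" using funpow_add[of "i - j" j T] by simp
  then have "(inv T ^^ (i - j)) ((T ^^ i) b) = (T ^^ j) b" using Aut_funpow_inverse'[OF assms] by simp
  then show ?thesis unfolding full_orbit_def by (intro UN_I[of "i - j"]) auto
qed

text \<open>Both points are forward iterates of a sufficiently remote backward iterate
  \<open>b\<close> of \<open>z\<close>, and forward iterates of one point are comparable.\<close>

lemma full_orbit_common_past:
  assumes T: "T \<in> Aut M" and y: "y \<in> full_orbit T z" "y' \<in> full_orbit T z"
  shows "\<exists>k. y' = (T ^^ k) y \<or> y = (T ^^ k) y'"
proof -
  have past: "\<exists>m. \<forall>n\<ge>m. \<exists>i. w = (T ^^ i) ((inv T ^^ n) z)" if "w \<in> full_orbit T z" for w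
  proof -
    from that obtain a where "w = (T ^^ a) z \<or> w = (inv T ^^ a) z" by (auto simp: full_orbit_def)
    then show ?thesis
    proof
      assume w: "w = (T ^^ a) z"
      have "w = (T ^^ (a + n)) ((inv T ^^ n) z)" for n
        unfolding w funpow_add comp_apply using Aut_funpow_inverse[OF T] by simp
      then show ?thesis by blast
    next
      assume w: "w = (inv T ^^ a) z"
      have "w = (T ^^ (n - a)) ((inv T ^^ n) z)" if "n \<ge> a" for n
      proof -
        have "(inv T ^^ n) z = (inv T ^^ (n - a)) w"
          using funpow_add[of "n - a" a "inv T"] that w by simp
        then show ?thesis using Aut_funpow_inverse[OF T] by simp
      qed
      then show ?thesis by blast
    qed
  qed
  obtain m m' where m: "\<forall>n\<ge>m. \<exists>i. y = (T ^^ i) ((inv T ^^ n) z)" "\<forall>n\<ge>m'. \<exists>i. y' = (T ^^ i) ((inv T ^^ n) z)"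
    using past[OF y(1)] past[OF y(2)] by blast
  define b where "b = (inv T ^^ (max m m')) z"
  obtain i j where ij: "y = (T ^^ i) b" "y' = (T ^^ j) b"
    using m(1)[rule_format, of "max m m'"] m(2)[rule_format, of "max m m'"] unfolding b_def by auto
  show ?thesis
  proof (cases "i \<le> j")
    case True
    then have "y' = (T ^^ (j - i)) y" using funpow_add[of "j - i" i T] ij by simp
    then show ?thesis by blast
  next
    case False
    then have "y = (T ^^ (i - j)) y'" using funpow_add[of "i - j" j T] ij by simp
    then show ?thesis by blast
  qed
qed

text \<open>The unions \<open>D n\<close> of the tails decrease to the empty set. The hypothesis on
  points mentions no measure, so one sequence of error sets can serve all the given
  measures.\<close>

lemma measure_tendsto_0:
  assumes "prob_space \<mu>" "\<And>n. E n \<in> sets \<mu>" "\<And>y. y \<in> space \<mu> \<Longrightarrow> \<forall>\<^sub>F n in sequentially. y \<notin> E n"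
  shows "(\<lambda>n. measure \<mu> (E n)) \<longlonglongrightarrow> 0"
proof -
  interpret prob_space \<mu> by fact
  define D where "D n = (\<Union>m\<in>{n..}. E m)" for n
  have Dm: "D n \<in> sets \<mu>" for n unfolding D_def using assms(2) by (intro sets.countable_UN') auto
  have "decseq D" by (rule decseq_SucI) (unfold D_def, rule UN_mono, auto)
  then have "(\<lambda>n. measure \<mu> (D n)) \<longlonglongrightarrow> measure \<mu> (\<Inter>n. D n)"
    using Dm by (intro finite_Lim_measure_decseq) auto
  moreover have "(\<Inter>n. D n) = {}"
  proof (rule ccontr)
    assume "(\<Inter>n. D n) \<noteq> {}"
    then obtain y where "y \<in> (\<Inter>n. D n)" by auto
    then have y: "y \<in> D n" for n by simp
    then have "y \<in> space \<mu>" using sets.sets_into_space[OF Dm] by blast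
    then have "\<forall>\<^sub>F n in sequentially. y \<notin> E n" by (rule assms(3))
    then obtain N where "\<forall>n\<ge>N. y \<notin> E n" unfolding eventually_sequentially by (rule exE)
    then show False using y[of N] by (auto simp: D_def)
  qed
  ultimately have lim: "(\<lambda>n. measure \<mu> (D n)) \<longlonglongrightarrow> 0" by simp
  show ?thesis
  proof (rule tendsto_sandwich[OF _ _ tendsto_const lim])
    show "\<forall>\<^sub>F n in sequentially. measure \<mu> (E n) \<le> measure \<mu> (D n)"
      by (rule always_eventually, rule allI, rule finite_measure_mono[OF _ Dm]) (auto simp: D_def)
  qed simp
qed

text \<open>The levels are traversed in the cyclic order
  \<open>L i, ..., L h, L 0, ..., L (i - 1)\<close>, with \<open>\<sigma>\<close> for the step from
  top to base and \<open>T\<close> otherwise. Only the step out of \<open>L (i - 1)\<close> is not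
  prescribed. \<open>E\<close> collects the points of the base where the inverses may differ,
  \<open>E'\<close> the points of the top where the maps may differ.\<close>

lemma odometer_near_tower:
  fixes B :: "'a set" and T :: "'a \<Rightarrow> 'a"
  defines "L \<equiv> \<lambda>i. (T ^^ i) ` B"
  assumes M: "standard_borel M" and T: "T \<in> Aut M" and tower: "is_tower M T B h"
    and i: "1 \<le> i" "i \<le> h"
    and R: "space M - (\<Union>j\<le>h. L j) = {} \<or> uncountable (space M - (\<Union>j\<le>h. L j))"
    and \<sigma>: "borel_isomorphism (restrict_space M (L h)) (restrict_space M B) \<sigma>"
    and E: "\<And>y. y \<in> B \<Longrightarrow> y \<notin> E \<Longrightarrow> inv T y \<in> L h \<and> \<sigma> (inv T y) = y"
    and E': "\<And>y. y \<in> L h \<Longrightarrow> y \<notin> E' \<Longrightarrow> \<sigma> y = T y"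
  shows "\<exists>S\<in>odometers M. diff_set M S T \<subseteq> (space M - (\<Union>j\<le>h. L j)) \<union> L (i - 1) \<union> L i \<union> E \<union> E'"
proof -
  have Lm: "L j \<in> sets M" if "j \<le> h" for j using tower that by (simp add: is_tower_def L_def)
  have Ld: "L j \<inter> L k = {}" if "j \<le> h" "k \<le> h" "j \<noteq> k" for j k
    using tower that by (auto simp: is_tower_def L_def disjoint_family_on_def)
  have LS: "T ` L j = L (Suc j)" for j by (simp add: L_def image_comp)
  have L0: "L 0 = B" by (simp add: L_def)
  define U where "U x = (if x \<in> L h then \<sigma> x else T x)" for x
  \<comment> \<open>\<open>p\<close> lists the levels in cyclic order starting with
    \<open>i\<close>; the function \<open>k\<close> gives the position of a level in this
    list.\<close>
  define p where "p k = (i + k) mod Suc h" for k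
  define k where "k j = (j + (Suc h - i)) mod Suc h" for j
  have p_le: "p k \<le> h" for k unfolding p_def using mod_less_divisor[of "Suc h"] less_Suc_eq_le by blast
  have pk: "p (k j) = j" if "j \<le> h" for j
  proof -
    have "p (k j) = (i + (j + (Suc h - i))) mod Suc h" unfolding p_def k_def by (rule mod_add_right_eq)
    also have "i + (j + (Suc h - i)) = j + Suc h" using i by simp
    also have "(j + Suc h) mod Suc h = j mod Suc h" by (rule mod_add_self2)
    also have "\<dots> = j" using that by simp
    finally show ?thesis .
  qed
  have k_le: "k j \<le> h" for j unfolding k_def using mod_less_divisor[of "Suc h"] less_Suc_eq_le by blast
  have p_image: "p ` {..h} = {..h}"
  proof
    show "{..h} \<subseteq> p ` {..h}" using pk k_le by (metis atMost_iff image_eqI subsetI)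
  qed (use p_le in auto)
  then have p_inj: "inj_on p {..h}" by (intro eq_card_imp_inj_on) simp_all
  have pSuc: "p (Suc k) = (if Suc (p k) = Suc h then 0 else Suc (p k))" for k
    using mod_Suc[of "i + k" "Suc h"] unfolding p_def add_Suc_right .
  \<comment> \<open>The list ends with level \<open>i - 1\<close>, which is not the top because
    \<open>i \<le> h\<close>; hence the step from the top to the base is among those
    prescribed.\<close>
  have ph: "p h = i - 1"
  proof -
    have "i + h = (i - 1) + Suc h" using i by simp
    then have "p h = ((i - 1) + Suc h) mod Suc h" unfolding p_def by (rule arg_cong)
    also have "\<dots> = (i - 1) mod Suc h" by (rule mod_add_self2)
    also have "\<dots> = i - 1" using i by simp
    finally show ?thesis .
  qed
  have kh: "k j < h" if "j \<le> h" "j \<noteq> i - 1" for j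
    using k_le[of j] pk[OF that(1)] that(2) ph by (metis le_neq_implies_less)
  have "\<exists>S\<in>odometers M. \<forall>k. Suc k < Suc h \<longrightarrow> (\<forall>x\<in>L (p k). S x = U x)"
  proof (rule odometer_extending_partial_map[of M "Suc h" "\<lambda>k. L (p k)" U, OF M])
    show "2 \<le> Suc h" using i by simp
    show "L (p k) \<in> sets M" for k by (rule Lm[OF p_le])
    show "disjoint_family_on (\<lambda>k. L (p k)) {..<Suc h}"
      unfolding disjoint_family_on_def
    proof (intro ballI impI)
      fix a b assume "a \<in> {..<Suc h}" "b \<in> {..<Suc h}" "a \<noteq> b"
      then have "p a \<noteq> p b" using p_inj by (auto simp: inj_on_def less_Suc_eq_le)
      then show "L (p a) \<inter> L (p b) = {}" by (rule Ld[OF p_le p_le])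
    qed
    show "uncountable (L (p 0))"
    proof
      assume "countable (L (p 0))"
      then have "countable ((inv T ^^ p 0) ` L (p 0))" by simp
      moreover have "(inv T ^^ p 0) ` L (p 0) = B"
        unfolding L_def image_image Aut_funpow_inverse'[OF T] by simp
      ultimately show False using tower by (simp add: is_tower_def)
    qed
    have un: "(\<Union>k<Suc h. L (p k)) = (\<Union>j\<le>h. L j)"
    proof -
      have "(\<Union>k<Suc h. L (p k)) = \<Union>(L ` (p ` {..h}))"
        unfolding lessThan_Suc_atMost image_image ..
      then show ?thesis unfolding p_image .
    qed
    show "space M - (\<Union>k<Suc h. L (p k)) = {} \<or> uncountable (space M - (\<Union>k<Suc h. L (p k)))"
      unfolding un by (rule R)
    fix k assume k: "Suc k < Suc h"
    show "borel_isomorphism (restrict_space M (L (p k))) (restrict_space M (L (p (Suc k)))) U"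
    proof (cases "p k = h")
      case True
      then have "p (Suc k) = 0" using pSuc[of k] by simp
      then have "borel_isomorphism (restrict_space M (L (p k))) (restrict_space M (L (p (Suc k)))) \<sigma>"
        using \<sigma> True L0 by simp
      then show ?thesis by (rule borel_isomorphism_restrict_cong) (simp add: U_def True)
    next
      case False
      then have "p (Suc k) = Suc (p k)" using pSuc[of k] by simp
      then have "borel_isomorphism (restrict_space M (L (p k))) (restrict_space M (L (p (Suc k)))) T"
        using Aut_restrict_isomorphism[OF T Lm[OF p_le] LS] by simp
      moreover have "L (p k) \<inter> L h = {}" by (rule Ld[OF p_le order_refl False])
      then have "U x = T x" if "x \<in> L (p k)" for x using that unfolding U_def by auto
      ultimately show ?thesis by (rule borel_isomorphism_restrict_cong)
    qed
  qed
  then obtain S where S: "S \<in> odometers M" and "\<forall>k. Suc k < Suc h \<longrightarrow> (\<forall>x\<in>L (p k). S x = U x)" by blast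
  then have SU: "S x = U x" if "x \<in> L j" "j \<le> h" "j \<noteq> i - 1" for x j
    using kh[OF that(2,3)] pk[OF that(2)] that(1) by auto
  have SA: "S \<in> Aut M" using S by (simp add: odometers_def)
  have ST: "S x = T x" if "x \<in> L j" "j < h" "j \<noteq> i - 1" for x j
    using SU[OF that(1) _ that(3)] Ld[of j h] that by (auto simp: U_def)
  have "diff_set M S T \<subseteq> (space M - (\<Union>j\<le>h. L j)) \<union> L (i - 1) \<union> L i \<union> E \<union> E'"
  proof
    fix x assume x: "x \<in> diff_set M S T"
    show "x \<in> (space M - (\<Union>j\<le>h. L j)) \<union> L (i - 1) \<union> L i \<union> E \<union> E'"
    proof (rule ccontr)
      assume n: "\<not> ?thesis"
      have "x \<in> space M" using x by (auto simp: diff_set_def)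
      then obtain j where j: "j \<le> h" "x \<in> L j" using n by blast
      then have ji: "j \<noteq> i - 1" "j \<noteq> i" using n by auto
      have "S x = T x"
      proof (cases "j = h")
        case True
        then have "S x = \<sigma> x" using SU[OF j(2,1) ji(1)] j by (simp add: U_def)
        then show ?thesis using E'[of x] j True n by simp
      qed (use ST[OF j(2) _ ji(1)] j in simp)
      \<comment> \<open>Since \<open>S\<close> is injective, agreement of the inverses at
        \<open>x\<close> follows once \<open>S\<close> sends \<open>inv T x\<close> to
        \<open>x\<close>.\<close>
      moreover have "S (inv T x) = x"
      proof (cases j)
        case 0
        then have xB: "x \<in> B" using j L0 by simp
        then have "inv T x \<in> L h" "\<sigma> (inv T x) = x" using E[OF xB] n by auto
        then show ?thesis using SU[of "inv T x" h] i by (simp add: U_def)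
      next
        case (Suc m)
        then have "x \<in> T ` L m" using j LS by simp
        then have "inv T x \<in> L m" using Aut_inverses(2)[OF T] by auto
        then show ?thesis using ST[of "inv T x" m] Suc j ji i Aut_inverses(1)[OF T] by auto
      qed
      then have "inv S x = inv T x" using Aut_inverses(2)[OF SA, of "inv T x"] by simp
      ultimately show False using x by (auto simp: diff_set_def)
    qed
  qed
  then show ?thesis using S by blast
qed

section \<open>The refining towers of a rank one automorphism\<close>

locale rank_one_towers =
  fixes M :: "'a measure" and T :: "'a \<Rightarrow> 'a" and B :: "nat \<Rightarrow> 'a set" and h :: "nat \<Rightarrow> nat"
  assumes M: "standard_borel M" and T: "T \<in> Aut M" and ap: "aperiodic M T" and ns: "\<not> smooth_aut M T"
    and tower: "\<And>n. is_tower M T (B n) (h n)"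
    and refine_Suc: "\<And>n a. a \<in> atoms T (B (Suc n)) (h (Suc n)) \<Longrightarrow>
      (\<exists>b\<in>atoms T (B n) (h n). a \<subseteq> b) \<or> a \<inter> \<Union>(atoms T (B n) (h n)) = {}"
    and mono_Suc: "\<And>n. \<Union>(atoms T (B n) (h n)) \<subseteq> \<Union>(atoms T (B (Suc n)) (h (Suc n)))"
    and cover: "(\<Union>n. \<Union>(atoms T (B n) (h n))) = space M"
    and gen: "sigma_sets (space M) (\<Union>n. atoms T (B n) (h n)) = sets M"
begin

definition L :: "nat \<Rightarrow> nat \<Rightarrow> 'a set" where "L n i = (T ^^ i) ` B n"

definition Y :: "nat \<Rightarrow> 'a set" where "Y n = (\<Union>i\<le>h n. L n i)"

lemma atoms_L: "atoms T (B n) (h n) = L n ` {..h n}"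
  by (simp add: atoms_def L_def)

lemma Union_atoms: "\<Union>(atoms T (B n) (h n)) = Y n"
  by (simp add: atoms_L Y_def)

lemma L0: "L n 0 = B n"
  by (simp add: L_def)

lemma L_Suc: "T ` L n i = L n (Suc i)"
  by (simp add: L_def image_comp)

lemma T_in_L_Suc: "T x \<in> L n (Suc i) \<longleftrightarrow> x \<in> L n i"
  unfolding L_Suc[symmetric] using Aut_inverses(2)[OF T] by (metis image_iff)

lemma L_sets: "i \<le> h n \<Longrightarrow> L n i \<in> sets M"
  using tower[of n] by (simp add: is_tower_def L_def)

lemma L_disjoint: "x \<in> L n i \<Longrightarrow> x \<in> L n j \<Longrightarrow> i \<le> h n \<Longrightarrow> j \<le> h n \<Longrightarrow> i = j"
  using tower[of n] unfolding is_tower_def L_def disjoint_family_on_def by blast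

lemma Y_sets: "Y n \<in> sets M"
  unfolding Y_def using L_sets by (intro sets.finite_UN) auto

lemma uncountable_L: "uncountable (L n i)"
proof
  assume "countable (L n i)"
  then have "countable ((inv T ^^ i) ` L n i)" by simp
  moreover have "(inv T ^^ i) ` L n i = B n"
    unfolding L_def image_image Aut_funpow_inverse'[OF T] by simp
  ultimately show False using tower[of n] by (simp add: is_tower_def)
qed

lemma Y_mono: "n \<le> m \<Longrightarrow> Y n \<subseteq> Y m"
  by (rule lift_Suc_mono_le[of Y]) (use mono_Suc in \<open>simp add: Union_atoms\<close>)

lemma refine:
  assumes "n \<le> m" "i \<le> h m"
  shows "(\<exists>j\<le>h n. L m i \<subseteq> L n j) \<or> L m i \<inter> Y n = {}"
  using assms
proof (induction m arbitrary: i rule: dec_induct)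
  case base
  then show ?case by blast
next
  case (step m)
  have "(\<exists>b\<in>atoms T (B m) (h m). L (Suc m) i \<subseteq> b) \<or> L (Suc m) i \<inter> Y m = {}"
    using refine_Suc[of "L (Suc m) i" m] step.prems unfolding Union_atoms by (simp add: atoms_L)
  then show ?case
  proof
    assume "\<exists>b\<in>atoms T (B m) (h m). L (Suc m) i \<subseteq> b"
    then obtain k where k: "k \<le> h m" "L (Suc m) i \<subseteq> L m k" by (auto simp: atoms_L)
    from step.IH[OF k(1)] k(2) show ?thesis by blast
  next
    assume "L (Suc m) i \<inter> Y m = {}"
    then show ?thesis using Y_mono[OF step.hyps(1)] by blast
  qed
qed

lemma eventually_in_Y:
  assumes "x \<in> space M"
  shows "\<forall>\<^sub>F n in sequentially. x \<in> Y n"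
proof -
  obtain n where "x \<in> Y n" using cover assms unfolding Union_atoms by blast
  then show ?thesis unfolding eventually_sequentially using Y_mono by blast
qed

text \<open>The sets that do not distinguish \<open>x\<close> from \<open>y\<close> are closed under
  the operations generating the sigma-algebra, while the measurable singleton of \<open>x\<close>
  does distinguish them. So some level does, and refinement passes this on to all later
  towers.\<close>

lemma eventually_separated:
  assumes xy: "x \<in> space M" "x \<noteq> y"
  shows "\<forall>\<^sub>F n in sequentially. \<forall>i\<le>h n. \<not> (x \<in> L n i \<and> y \<in> L n i)"
proof -
  have "\<exists>n i. i \<le> h n \<and> (x \<in> L n i) \<noteq> (y \<in> L n i)"
  proof (rule ccontr)
    assume neg: "\<not> ?thesis"
    have same: "x \<in> A \<longleftrightarrow> y \<in> A" if "A \<in> sigma_sets (space M) (\<Union>n. atoms T (B n) (h n))" for A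
      using that
    proof induction
      case (Basic a)
      then show ?case using neg by (auto simp: atoms_L)
    next
      case (Compl a)
      have "y \<in> space M"
      proof -
        obtain n where "x \<in> Y n" using cover xy(1) unfolding Union_atoms by blast
        then obtain i where "i \<le> h n" "x \<in> L n i" by (auto simp: Y_def)
        then have "y \<in> L n i" using neg by blast
        then show ?thesis using sets.sets_into_space[OF L_sets[OF \<open>i \<le> h n\<close>]] by blast
      qed
      then show ?case using Compl xy(1) by simp
    qed auto
    have "{x} \<in> sets M" by (rule singleton_sets[OF M xy(1)])
    then show False using same[of "{x}"] xy(2) unfolding gen by simp
  qed
  then obtain m j where mj: "j \<le> h m" "(x \<in> L m j) \<noteq> (y \<in> L m j)" by blast
  have "\<not> (x \<in> L n i \<and> y \<in> L n i)" if n: "m \<le> n" "i \<le> h n" for n i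
  proof
    assume xy: "x \<in> L n i \<and> y \<in> L n i"
    from refine[OF n] show False
    proof
      assume "\<exists>k\<le>h m. L n i \<subseteq> L m k"
      then obtain k where k: "k \<le> h m" "x \<in> L m k" "y \<in> L m k" using xy by blast
      then have "k = j" using mj L_disjoint[of _ m k j] by blast
      then show False using k mj by blast
    next
      assume "L n i \<inter> Y m = {}"
      then show False using xy mj unfolding Y_def by blast
    qed
  qed
  then show ?thesis unfolding eventually_sequentially by blast
qed

text \<open>By aperiodicity the first \<open>K + 1\<close> points of an orbit are distinct.
  Eventually all of them lie in the tower, in pairwise different levels.\<close>

lemma heights_unbounded: "\<forall>\<^sub>F n in sequentially. K \<le> h n"
proof -
  have "B 0 \<noteq> {}" using tower[of 0] by (auto simp: is_tower_def)
  then obtain x where "x \<in> B 0" by blast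
  then have x: "x \<in> space M" using sets.sets_into_space[OF L_sets[of 0 0]] L0 by auto
  have px: "(T ^^ k) x \<in> space M" for k using Aut_in_space[OF Aut_funpow[OF T]] x by simp
  have dist: "(T ^^ k) x \<noteq> (T ^^ m) x" if "k < m" for k m
  proof
    assume eq: "(T ^^ k) x = (T ^^ m) x"
    have "(T ^^ m) x = (T ^^ (m - k)) ((T ^^ k) x)" using funpow_add[of "m - k" k T] that by simp
    then have "m - k = 0" using aperiodicD[OF T ap px[of k], of "m - k"] eq by simp
    then show False using that by simp
  qed
  have "\<forall>\<^sub>F n in sequentially. \<forall>k\<in>{..K}. (T ^^ k) x \<in> Y n"
    by (intro eventually_ball_finite ballI eventually_in_Y px) simp
  moreover have "\<forall>\<^sub>F n in sequentially. \<forall>k\<in>{..K}. \<forall>m\<in>{k<..K}. \<forall>i\<le>h n. \<not> ((T ^^ k) x \<in> L n i \<and> (T ^^ m) x \<in> L n i)"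
    by (intro eventually_ball_finite ballI eventually_separated px dist) auto
  ultimately show ?thesis
  proof eventually_elim
    case (elim n)
    then have "\<forall>k\<in>{..K}. \<exists>i. i \<le> h n \<and> (T ^^ k) x \<in> L n i" unfolding Y_def by blast
    then obtain f where f: "\<And>k. k \<le> K \<Longrightarrow> f k \<le> h n" "\<And>k. k \<le> K \<Longrightarrow> (T ^^ k) x \<in> L n (f k)"
      unfolding Ball_def atMost_iff by metis
    have "f k \<noteq> f m" if km: "k < m" "m \<le> K" for k m
    proof
      assume eq: "f k = f m"
      have "k \<in> {..K}" "m \<in> {k<..K}" "f m \<le> h n" using km f(1) by auto
      then have "\<not> ((T ^^ k) x \<in> L n (f m) \<and> (T ^^ m) x \<in> L n (f m))" using elim(2) by blast
      then show False using f(2)[of k] f(2)[of m] km eq by simp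
    qed
    then have "inj_on f {..K}" by (intro linorder_inj_onI) auto
    moreover have "f ` {..K} \<subseteq> {..h n}" using f(1) by auto
    ultimately have "card {..K} \<le> card {..h n}" by (intro card_inj_on_le) auto
    then show ?case by simp
  qed
qed

text \<open>If \<open>Y m\<close> is backward invariant but not everything, then the points leaving \<open>Y m\<close> in one step
  form a transversal: along a tower \<open>B n\<close> with \<open>n\<close> large the levels inside \<open>Y m\<close> are an initial segment.\<close>

lemma backward_invariant_full:
  assumes bwd: "\<And>x. T x \<in> Y m \<Longrightarrow> x \<in> Y m"
  shows "Y m = space M"
proof (rule ccontr)
  assume "Y m \<noteq> space M"
  then obtain u where u: "u \<in> space M" "u \<notin> Y m" using sets.sets_into_space[OF Y_sets[of m]] by blast
  define W where "W = Y m - (T -` Y m \<inter> space M)"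
  have Wm: "W \<in> sets M" unfolding W_def using Y_sets measurable_sets[OF Aut_measurable[OF T] Y_sets] by blast
  have W: "x \<in> W \<longleftrightarrow> x \<in> Y m \<and> T x \<notin> Y m" for x
    unfolding W_def using sets.sets_into_space[OF Y_sets[of m]] by blast
  have back_pow: "x \<in> Y m" if "(T ^^ k) x \<in> Y m" for x k
    using that
  proof (induction k)
    case (Suc k)
    then have "T ((T ^^ k) x) \<in> Y m" by simp
    from bwd[OF this] show ?case by (rule Suc.IH)
  qed simp
  have uniq: "k = 0" if "y \<in> W" "(T ^^ k) y \<in> W" for y k
  proof (rule ccontr)
    assume "k \<noteq> 0"
    then obtain k' where k: "k = Suc k'" by (cases k) auto
    have "(T ^^ k') (T y) \<in> Y m" using that(2) unfolding W k funpow_Suc_right comp_apply by blast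
    then have "T y \<in> Y m" by (rule back_pow)
    then show False using that(1) W by blast
  qed
  have "\<exists>!y. y \<in> W \<inter> full_orbit T z" if z: "z \<in> space M" for z
  proof (rule ex_ex1I)
    obtain N where N: "\<And>n. n \<ge> N \<Longrightarrow> z \<in> Y n \<and> u \<in> Y n"
      using eventually_conj[OF eventually_in_Y[OF z] eventually_in_Y[OF u(1)]]
      unfolding eventually_sequentially by blast
    define n where "n = max N m"
    have mn: "m \<le> n" and zu: "z \<in> Y n" "u \<in> Y n" using N[of n] by (auto simp: n_def)
    obtain i where i: "i \<le> h n" "z \<in> L n i" using zu by (auto simp: Y_def)
    then obtain b where b: "b \<in> B n" "z = (T ^^ i) b" by (auto simp: L_def)
    have bL: "(T ^^ j) b \<in> L n j" for j using b by (auto simp: L_def)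
    \<comment> \<open>This transfers information from \<open>u\<close> and \<open>w\<close> to the
      orbit of \<open>z\<close>: some level lies outside \<open>Y m\<close> and some level inside,
      and the orbit through \<open>b\<close> meets both. Backward invariance puts the inner one
      first.\<close>
    have level: "L n j \<subseteq> Y m \<or> L n j \<inter> Y m = {}" if "j \<le> h n" for j
      using refine[OF mn that] unfolding Y_def by blast
    obtain j1 where j1: "j1 \<le> h n" "u \<in> L n j1" using zu by (auto simp: Y_def)
    then have out: "(T ^^ j1) b \<notin> Y m" using level[OF j1(1)] u(2) bL[of j1] by blast
    have "L m 0 \<noteq> {}" using uncountable_L[of m 0] by auto
    then obtain w where w: "w \<in> Y m" unfolding Y_def by blast
    then have "w \<in> Y n" using Y_mono[OF mn] by blast
    then obtain j0 where j0: "j0 \<le> h n" "w \<in> L n j0" by (auto simp: Y_def)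
    then have insd: "(T ^^ j0) b \<in> Y m" using level[OF j0(1)] w bL[of j0] by blast
    have "j0 < j1"
    proof (rule ccontr)
      assume "\<not> j0 < j1"
      then have "(T ^^ (j0 - j1)) ((T ^^ j1) b) = (T ^^ j0) b" using funpow_add[of "j0 - j1" j1 T] by simp
      then show False using back_pow[of "j0 - j1" "(T ^^ j1) b"] insd out by simp
    qed
    have "\<exists>j. (T ^^ j) b \<in> Y m \<and> (T ^^ Suc j) b \<notin> Y m"
    proof (rule ccontr)
      assume neg: "\<not> ?thesis"
      have "(T ^^ j) b \<in> Y m" if "j0 \<le> j" for j
        using that
      proof (induction rule: dec_induct)
        case (step j)
        then show ?case using neg by blast
      qed (rule insd)
      then show False using out \<open>j0 < j1\<close> by simp
    qed
    then obtain j where "(T ^^ j) b \<in> W" using W by auto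
    then show "\<exists>y. y \<in> W \<inter> full_orbit T z"
      using funpow_in_full_orbit[OF T, of j b i] b(2) by blast
  next
    fix y y' assume y: "y \<in> W \<inter> full_orbit T z" "y' \<in> W \<inter> full_orbit T z"
    then obtain k where k: "y' = (T ^^ k) y \<or> y = (T ^^ k) y'"
      using full_orbit_common_past[OF T] by blast
    then show "y = y'"
    proof
      assume e: "y' = (T ^^ k) y"
      then have "k = 0" using uniq[of y k] y by simp
      then show ?thesis using e by simp
    next
      assume e: "y = (T ^^ k) y'"
      then have "k = 0" using uniq[of y' k] y by simp
      then show ?thesis using e by simp
    qed
  qed
  then have "smooth_aut M T" unfolding smooth_aut_def by (intro bexI[OF _ Wm] ballI)
  then show False using ns by blast
qed

text \<open>A missing point lies in a level of some later tower. By refinement that whole level,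
  which is uncountable, avoids \<open>Y n\<close>.\<close>

lemma remainder: "space M - Y n = {} \<or> uncountable (space M - Y n)"
proof (cases "space M - Y n = {}")
  case False
  then obtain u where u: "u \<in> space M" "u \<notin> Y n" by blast
  obtain N where "\<And>m. m \<ge> N \<Longrightarrow> u \<in> Y m"
    using eventually_in_Y[OF u(1)] unfolding eventually_sequentially by blast
  then have m: "u \<in> Y (max N n)" by simp
  then obtain i where i: "i \<le> h (max N n)" "u \<in> L (max N n) i" by (auto simp: Y_def)
  have "L (max N n) i \<inter> Y n = {}"
    using refine[of n "max N n", OF _ i(1)] i(2) u(2) unfolding Y_def by auto
  then have "L (max N n) i \<subseteq> space M - Y n" using sets.sets_into_space[OF L_sets[OF i(1)]] by blast
  then show ?thesis using uncountable_L countable_subset by blast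
qed simp

text \<open>\<open>\<sigma>\<close> closes the tower up by mapping its top level onto its base; \<open>E\<close> and \<open>E'\<close> contain the
  points where this is inconsistent with \<open>T\<close>.\<close>

definition closing :: "nat \<Rightarrow> ('a \<Rightarrow> 'a) \<Rightarrow> 'a set \<Rightarrow> 'a set \<Rightarrow> bool" where
  "closing n \<sigma> E E' \<longleftrightarrow> borel_isomorphism (restrict_space M (L n (h n))) (restrict_space M (B n)) \<sigma> \<and>
     (\<forall>y\<in>B n - E. inv T y \<in> L n (h n) \<and> \<sigma> (inv T y) = y) \<and> (\<forall>y\<in>L n (h n) - E'. \<sigma> y = T y)"

text \<open>\<open>T\<close> moves every level but the top to the next one. When the levels exhaust
  the space, bijectivity leaves just the base as image of the top.\<close>

lemma closing_full:
  assumes full: "Y n = space M"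
  shows "closing n T {} {}"
proof -
  have eq: "T x \<in> B n \<longleftrightarrow> x \<in> L n (h n)" if x: "x \<in> space M" for x
  proof
    assume Tx: "T x \<in> B n"
    obtain j where j: "j \<le> h n" "x \<in> L n j" using x full by (auto simp: Y_def)
    have "j = h n"
    proof (rule ccontr)
      assume "j \<noteq> h n"
      then have "T x \<in> L n (Suc j)" "Suc j \<le> h n" using j T_in_L_Suc by auto
      then show False using L_disjoint[of "T x" n "Suc j" 0] Tx L0 by auto
    qed
    then show "x \<in> L n (h n)" using j by simp
  next
    assume xh: "x \<in> L n (h n)"
    have "T x \<in> Y n" using x full Aut_in_space[OF T] by simp
    then obtain j where j: "j \<le> h n" "T x \<in> L n j" by (auto simp: Y_def)
    show "T x \<in> B n"
    proof (cases j)
      case (Suc j')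
      then have "x \<in> L n j'" using j T_in_L_Suc by simp
      then show ?thesis using L_disjoint[OF xh, of j'] j Suc by simp
    qed (use j L0 in simp)
  qed
  have Bs: "B n \<subseteq> space M" using sets.sets_into_space[OF L_sets[of 0 n]] L0 by simp
  have invB: "inv T y \<in> L n (h n)" "T (inv T y) = y" if "y \<in> B n" for y
  proof -
    show e: "T (inv T y) = y" by (rule Aut_inverses(1)[OF T])
    have "inv T y \<in> space M" using Aut_in_space[OF Aut_inv[OF T]] that Bs by blast
    then show "inv T y \<in> L n (h n)" using eq[of "inv T y"] e that by simp
  qed
  have "T ` L n (h n) = B n"
  proof
    show "T ` L n (h n) \<subseteq> B n" using eq sets.sets_into_space[OF L_sets[of "h n" n]] by blast
    show "B n \<subseteq> T ` L n (h n)" using invB by (metis imageI subsetI)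
  qed
  then have "borel_isomorphism (restrict_space M (L n (h n))) (restrict_space M (B n)) T"
    by (intro Aut_restrict_isomorphism T L_sets) auto
  then show ?thesis unfolding closing_def using invB by blast
qed

text \<open>When both points lie in the tower, \<open>x0\<close> is in the base exactly if
  \<open>inv T x0\<close> is in the top. If they are, one value of \<open>\<sigma>\<close> has to be
  arranged; if not, the error sets are the whole base and the whole top, and any isomorphism will
  do.\<close>

lemma closing_point:
  assumes x0: "x0 \<in> Y n" "inv T x0 \<in> Y n"
  shows "\<exists>\<sigma>. closing n \<sigma> (B n - {x0}) (L n (h n) - {inv T x0})"
proof -
  let ?y0 = "inv T x0" and ?P = "inv T ^^ h n"
  have P: "?P \<in> Aut M" by (rule Aut_funpow[OF Aut_inv[OF T]])
  have Pim: "?P ` L n (h n) = B n"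
    unfolding L_def image_image Aut_funpow_inverse'[OF T] by simp
  have Ty0: "T ?y0 = x0" by (rule Aut_inverses(1)[OF T])
  have a: "x0 \<in> B n \<longleftrightarrow> ?y0 \<in> L n (h n)"
  proof
    assume xB: "x0 \<in> B n"
    obtain j where j: "j \<le> h n" "?y0 \<in> L n j" using x0(2) by (auto simp: Y_def)
    have "j = h n"
    proof (rule ccontr)
      assume "j \<noteq> h n"
      then have "T ?y0 \<in> L n (Suc j)" "Suc j \<le> h n" using j T_in_L_Suc by auto
      then show False using L_disjoint[of x0 n "Suc j" 0] xB L0 Ty0 by auto
    qed
    then show "?y0 \<in> L n (h n)" using j by simp
  next
    assume yh: "?y0 \<in> L n (h n)"
    obtain j where j: "j \<le> h n" "x0 \<in> L n j" using x0(1) by (auto simp: Y_def)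
    show "x0 \<in> B n"
    proof (cases j)
      case (Suc j')
      then have "?y0 \<in> L n j'" using j T_in_L_Suc[of ?y0] Ty0 by simp
      then show ?thesis using L_disjoint[OF yh, of j'] j Suc by simp
    qed (use j L0 in simp)
  qed
  show ?thesis
  proof (cases "x0 \<in> B n")
    case False
    have "borel_isomorphism (restrict_space M (L n (h n))) (restrict_space M (B n)) ?P"
      by (intro Aut_restrict_isomorphism P L_sets Pim) simp
    then have "closing n ?P (B n - {x0}) (L n (h n) - {?y0})"
      unfolding closing_def using False a by auto
    then show ?thesis by blast
  next
    case True
    have Bs: "B n \<subseteq> space M" using sets.sets_into_space[OF L_sets[of 0 n]] L0 by simp
    define c where "c = ?P ?y0"
    have cB: "c \<in> B n" using True a Pim unfolding c_def by blast
    \<comment> \<open>Going down the tower maps the top onto the base but sends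
      \<open>inv T x0\<close> to \<open>c\<close>; exchanging \<open>c\<close> with
      \<open>x0\<close> corrects this inside the base.\<close>
    define \<sigma> where "\<sigma> = Transposition.transpose c x0 \<circ> ?P"
    have "\<sigma> \<in> Aut M"
      unfolding \<sigma>_def using cB True Bs by (intro Aut_comp transpose_Aut M P) auto
    moreover have "\<sigma> ` L n (h n) = B n"
    proof -
      have "\<sigma> ` L n (h n) = Transposition.transpose c x0 ` B n" unfolding \<sigma>_def image_comp[symmetric] Pim ..
      also have "\<dots> = B n" using cB True by simp
      finally show ?thesis .
    qed
    ultimately have "borel_isomorphism (restrict_space M (L n (h n))) (restrict_space M (B n)) \<sigma>"
      by (intro Aut_restrict_isomorphism L_sets) auto
    moreover have "\<sigma> ?y0 = x0" by (simp add: \<sigma>_def c_def)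
    ultimately have "closing n \<sigma> (B n - {x0}) (L n (h n) - {?y0})"
      unfolding closing_def using True a Ty0 by auto
    then show ?thesis by blast
  qed
qed

text \<open>By refinement \<open>B m\<close> lies in one level of the \<open>n\<close>-th tower.
  Were this not the base, points of \<open>B m\<close> would have their predecessors in
  \<open>Y n\<close>, hence in \<open>Y m\<close>. Points of higher levels have theirs in
  \<open>Y m\<close> anyway, so \<open>Y m\<close> would be backward invariant.\<close>

lemma bases_nested:
  assumes "\<exists>x. T x \<in> Y m \<and> x \<notin> Y m" "n \<le> m" "B m \<inter> Y n \<noteq> {}"
  shows "B m \<subseteq> B n"
proof -
  obtain i where i: "i \<le> h n" "B m \<subseteq> L n i"
    using refine[OF assms(2), of 0] assms(3) by (auto simp: L0)
  show ?thesis
  proof (cases i)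
    case (Suc i')
    obtain x where x: "T x \<in> Y m" "x \<notin> Y m" using assms(1) by blast
    then obtain j where j: "j \<le> h m" "T x \<in> L m j" by (auto simp: Y_def)
    have "x \<in> Y m"
    proof (cases j)
      case 0
      then have "T x \<in> L n (Suc i')" using j i Suc L0 by auto
      then have "x \<in> L n i'" using T_in_L_Suc by simp
      then have "x \<in> Y n" using i Suc unfolding Y_def by (auto intro!: bexI[of _ i'])
      then show ?thesis using Y_mono[OF assms(2)] by blast
    next
      case (Suc j')
      then show ?thesis using j T_in_L_Suc unfolding Y_def by (auto intro!: bexI[of _ j'])
    qed
    then show ?thesis using x by blast
  qed (use i L0 in simp)
qed

text \<open>Let \<open>x\<close> and \<open>y\<close> both lie in infinitely many bases. Choose
  \<open>n\<close> with \<open>x\<close> in \<open>B n\<close>, so late that \<open>y\<close> is in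
  \<open>Y n\<close> and no level contains both. A later base containing \<open>y\<close> meets
  \<open>Y n\<close>, hence is contained in \<open>B n\<close>, which then contains both.\<close>

lemma bases_shrink_to_point:
  assumes "\<And>m. \<exists>x. T x \<in> Y m \<and> x \<notin> Y m"
  shows "\<exists>x0\<in>space M. \<forall>y\<in>space M. y \<noteq> x0 \<longrightarrow> (\<forall>\<^sub>F n in sequentially. y \<notin> B n)"
proof (cases "\<exists>x\<in>space M. \<exists>\<^sub>F n in sequentially. x \<in> B n")
  \<comment> \<open>If every point leaves the bases eventually, an arbitrary point of the space can
    play the role of \<open>x0\<close>.\<close>
  case False
  have "B 0 \<noteq> {}" using tower[of 0] by (auto simp: is_tower_def)
  then obtain x where "x \<in> space M" using sets.sets_into_space[OF L_sets[of 0 0]] L0 by auto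
  then show ?thesis using False by (auto simp: frequently_def)
next
  case True
  then obtain x where x: "x \<in> space M" "\<exists>\<^sub>F n in sequentially. x \<in> B n" by blast
  have "\<forall>\<^sub>F n in sequentially. y \<notin> B n" if y: "y \<in> space M" "y \<noteq> x" for y
  proof (rule ccontr)
    assume neg: "\<not> ?thesis"
    obtain N where N: "\<And>n. n \<ge> N \<Longrightarrow> \<not> (x \<in> L n 0 \<and> y \<in> L n 0)" "\<And>n. n \<ge> N \<Longrightarrow> y \<in> Y n"
      using eventually_conj[OF eventually_separated[OF x(1) y(2)[symmetric]] eventually_in_Y[OF y(1)]]
      unfolding eventually_sequentially by blast
    obtain n where n: "n \<ge> N" "x \<in> B n" using x(2) unfolding frequently_sequentially by blast
    obtain m where m: "m \<ge> n" "y \<in> B m"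
      using neg unfolding eventually_sequentially by blast
    have "B m \<subseteq> B n" using m N(2)[OF n(1)] by (intro bases_nested assms m(1)) blast
    then show False using N(1)[OF n(1)] n(2) m(2) L0 by auto
  qed
  then show ?thesis using x(1) by blast
qed

text \<open>Once \<open>T y\<close> is in the tower but not in its base, \<open>y\<close> lies one
  level below \<open>T y\<close>, so it is not in the top.\<close>

lemma tops_shrink_to_point:
  assumes "\<And>y. y \<in> space M \<Longrightarrow> y \<noteq> x0 \<Longrightarrow> \<forall>\<^sub>F n in sequentially. y \<notin> B n"
    and y: "y \<in> space M" "y \<noteq> inv T x0"
  shows "\<forall>\<^sub>F n in sequentially. y \<notin> L n (h n)"
proof -
  have Ty: "T y \<in> space M" using y Aut_in_space[OF T] by simp
  have "T y \<noteq> x0" using y(2) Aut_inverses(2)[OF T] by metis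
  from eventually_in_Y[OF Ty] assms(1)[OF Ty this] show ?thesis
  proof eventually_elim
    case (elim n)
    then obtain j where j: "j \<le> h n" "T y \<in> L n j" by (auto simp: Y_def)
    then obtain j' where "j = Suc j'" using elim(2) L0 by (cases j) auto
    then have "y \<in> L n j'" "j' < h n" using j T_in_L_Suc by auto
    then show ?case using L_disjoint[of y n j' "h n"] by auto
  qed
qed

text \<open>The dichotomy is whether some \<open>Y m\<close> is backward invariant. If so, it is the
  whole space and \<open>T\<close> closes the later towers without error. If not, every
  \<open>Y m\<close> is entered from outside, as \<open>bases_nested\<close> requires, and the
  errors are the bases and tops with one point removed from each.\<close>

lemma vanishing_closing:
  "\<exists>E E'. (\<forall>n. E n \<in> sets M \<and> E' n \<in> sets M) \<and>
     (\<forall>y\<in>space M. \<forall>\<^sub>F n in sequentially. y \<notin> E n) \<and> (\<forall>y\<in>space M. \<forall>\<^sub>F n in sequentially. y \<notin> E' n) \<and>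
     (\<forall>\<^sub>F n in sequentially. \<exists>\<sigma>. closing n \<sigma> (E n) (E' n))"
proof (cases "\<exists>m. \<forall>x. T x \<in> Y m \<longrightarrow> x \<in> Y m")
  case True
  then obtain m where "Y m = space M" using backward_invariant_full by blast
  then have "Y n = space M" if "n \<ge> m" for n
    using Y_mono[OF that] sets.sets_into_space[OF Y_sets] by blast
  then have "\<forall>\<^sub>F n in sequentially. \<exists>\<sigma>. closing n \<sigma> {} {}"
    unfolding eventually_sequentially using closing_full by blast
  then show ?thesis by (intro exI[of _ "\<lambda>_. {}"]) simp
next
  case False
  then obtain x0 where x0: "x0 \<in> space M" "\<And>y. y \<in> space M \<Longrightarrow> y \<noteq> x0 \<Longrightarrow> \<forall>\<^sub>F n in sequentially. y \<notin> B n"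
    using bases_shrink_to_point by blast
  have y0: "inv T x0 \<in> space M" using x0(1) Aut_in_space[OF Aut_inv[OF T]] by simp
  show ?thesis
  proof (intro exI conjI allI ballI)
    show "B n - {x0} \<in> sets M" for n
      using L_sets[of 0 n] L0 singleton_sets[OF M x0(1)] by auto
    show "L n (h n) - {inv T x0} \<in> sets M" for n
      using L_sets[of "h n" n] singleton_sets[OF M y0] by auto
    show "\<forall>\<^sub>F n in sequentially. y \<notin> B n - {x0}" if "y \<in> space M" for y
      using x0(2)[OF that] by (cases "y = x0") (auto elim: eventually_mono)
    show "\<forall>\<^sub>F n in sequentially. y \<notin> L n (h n) - {inv T x0}" if "y \<in> space M" for y
      using tops_shrink_to_point[OF x0(2) that] by (cases "y = inv T x0") (auto elim: eventually_mono)
    show "\<forall>\<^sub>F n in sequentially. \<exists>\<sigma>. closing n \<sigma> (B n - {x0}) (L n (h n) - {inv T x0})"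
      using eventually_in_Y[OF x0(1)] eventually_in_Y[OF y0] by eventually_elim (rule closing_point)
  qed
qed

text \<open>Averaging over \<open>i\<close>: disjointness of the levels bounds the sum over all
  \<open>h n\<close> pairs by 2 for each measure, thus by \<open>2 * card F\<close> in total. If
  every pair were heavy for some measure, the total would be at least
  \<open>h n * d\<close>.\<close>

lemma small_consecutive_levels:
  assumes F: "finite F" "F \<subseteq> borel_probs M" and d: "d > 0" and H: "real (h n) * d > 2 * real (card F)"
  shows "\<exists>i. 1 \<le> i \<and> i \<le> h n \<and> (\<forall>\<mu>\<in>F. measure \<mu> (L n (i - 1)) + measure \<mu> (L n i) < d)"
proof (rule ccontr)
  assume neg: "\<not> ?thesis"
  define g where "g i = (\<Sum>\<mu>\<in>F. measure \<mu> (L n (i - 1)) + measure \<mu> (L n i))" for i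
  have "d \<le> g i" if i: "i \<in> {1..h n}" for i
  proof -
    obtain \<mu> where \<mu>: "\<mu> \<in> F" and le: "d \<le> measure \<mu> (L n (i - 1)) + measure \<mu> (L n i)"
      using neg i by (auto simp: not_less)
    note le
    also have "\<dots> \<le> g i"
      unfolding g_def using \<mu> F(1) by (intro member_le_sum) auto
    finally show ?thesis .
  qed
  then have "(\<Sum>i\<in>{1..h n}. d) \<le> (\<Sum>i\<in>{1..h n}. g i)" by (rule sum_mono)
  also have "\<dots> = (\<Sum>\<mu>\<in>F. (\<Sum>i\<in>{1..h n}. measure \<mu> (L n (i - 1))) + (\<Sum>i\<in>{1..h n}. measure \<mu> (L n i)))"
    unfolding g_def by (subst sum.swap) (simp add: sum.distrib)
  also have "\<dots> \<le> (\<Sum>\<mu>\<in>F. 2)"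
  proof (rule sum_mono)
    fix \<mu> assume "\<mu> \<in> F"
    then have \<mu>: "prob_space \<mu>" "sets \<mu> = sets M" using F(2) by (auto simp: borel_probs_def)
    interpret prob_space \<mu> by (rule \<mu>(1))
    have le: "(\<Sum>i\<in>J. measure \<mu> (L n i)) \<le> 1" if J: "J \<subseteq> {..h n}" for J
    proof -
      have "disjoint_family_on (L n) J"
        unfolding disjoint_family_on_def using L_disjoint J by blast
      then have "(\<Sum>i\<in>J. measure \<mu> (L n i)) = measure \<mu> (\<Union>i\<in>J. L n i)"
        using J \<mu>(2) L_sets finite_subset[OF J]
        by (intro finite_measure_finite_Union[symmetric]) auto
      then show ?thesis using prob_le_1 by simp
    qed
    have "(\<Sum>i\<in>{1..h n}. measure \<mu> (L n (i - 1))) = (\<Sum>i\<in>(\<lambda>i. i - 1) ` {1..h n}. measure \<mu> (L n i))"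
      by (subst sum.reindex) (auto simp: inj_on_def)
    also have "\<dots> \<le> 1" by (rule le) auto
    finally show "(\<Sum>i\<in>{1..h n}. measure \<mu> (L n (i - 1))) + (\<Sum>i\<in>{1..h n}. measure \<mu> (L n i)) \<le> 2"
      using le[of "{1..h n}"] by auto
  qed
  finally show False using H by simp
qed

lemma approximation:
  assumes F: "finite F" "F \<subseteq> borel_probs M" and e: "e > 0"
  shows "\<exists>S\<in>odometers M. S \<in> tau_nbhd M T F e"
proof -
  obtain E E' where EE: "\<And>n. E n \<in> sets M" "\<And>n. E' n \<in> sets M"
    "\<And>y. y \<in> space M \<Longrightarrow> \<forall>\<^sub>F n in sequentially. y \<notin> E n"
    "\<And>y. y \<in> space M \<Longrightarrow> \<forall>\<^sub>F n in sequentially. y \<notin> E' n"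
    and cl: "\<forall>\<^sub>F n in sequentially. \<exists>\<sigma>. closing n \<sigma> (E n) (E' n)"
    using vanishing_closing by blast
  have \<mu>: "prob_space \<mu>" "sets \<mu> = sets M" "space \<mu> = space M" if "\<mu> \<in> F" for \<mu>
    using F(2) that sets_eq_imp_space_eq[of \<mu> M] by (auto simp: borel_probs_def)
  \<comment> \<open>There are four errors of size \<open>e / 4\<close>: the complement of the tower,
    \<open>E n\<close>, \<open>E' n\<close>, and the two levels at the cut, which are counted
    together.\<close>
  have small: "\<forall>\<^sub>F n in sequentially. \<forall>\<mu>\<in>F. measure \<mu> (A n) < e / 4"
    if A: "\<And>n. A n \<in> sets M" "\<And>y. y \<in> space M \<Longrightarrow> \<forall>\<^sub>F n in sequentially. y \<notin> A n" for A
  proof (intro eventually_ball_finite F ballI)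
    fix \<nu> assume \<nu>: "\<nu> \<in> F"
    have "(\<lambda>n. measure \<nu> (A n)) \<longlonglongrightarrow> 0"
      using A \<mu>[OF \<nu>] by (intro measure_tendsto_0) auto
    then show "\<forall>\<^sub>F n in sequentially. measure \<nu> (A n) < e / 4"
      by (rule order_tendstoD(2)) (use e in simp)
  qed
  have sR: "\<forall>\<^sub>F n in sequentially. \<forall>\<mu>\<in>F. measure \<mu> (space M - Y n) < e / 4"
    by (rule small) (use Y_sets eventually_in_Y in \<open>auto elim: eventually_mono\<close>)
  have sE: "\<forall>\<^sub>F n in sequentially. \<forall>\<mu>\<in>F. measure \<mu> (E n) < e / 4" by (rule small[OF EE(1,3)])
  have sE': "\<forall>\<^sub>F n in sequentially. \<forall>\<mu>\<in>F. measure \<mu> (E' n) < e / 4" by (rule small[OF EE(2,4)])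
  \<comment> \<open>This height is what \<open>small_consecutive_levels\<close> demands for
    \<open>d = e / 4\<close>; the added 1 makes the inequality strict.\<close>
  have hh: "\<forall>\<^sub>F n in sequentially. nat \<lceil>2 * real (card F) / (e / 4)\<rceil> + 1 \<le> h n" by (rule heights_unbounded)
  obtain n where n: "\<forall>\<mu>\<in>F. measure \<mu> (space M - Y n) < e / 4" "\<forall>\<mu>\<in>F. measure \<mu> (E n) < e / 4"
    "\<forall>\<mu>\<in>F. measure \<mu> (E' n) < e / 4" "nat \<lceil>2 * real (card F) / (e / 4)\<rceil> + 1 \<le> h n"
    "\<exists>\<sigma>. closing n \<sigma> (E n) (E' n)"
    using eventually_happens[OF eventually_conj[OF sR eventually_conj[OF sE eventually_conj[OF sE' eventually_conj[OF hh cl]]]]]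
    by auto
  have "2 * real (card F) / (e / 4) < real (h n)" using n(4) by linarith
  then have "real (h n) * (e / 4) > 2 * real (card F)" using e by (simp add: field_simps)
  then obtain i where i: "1 \<le> i" "i \<le> h n"
    and Li: "\<And>\<mu>. \<mu> \<in> F \<Longrightarrow> measure \<mu> (L n (i - 1)) + measure \<mu> (L n i) < e / 4"
    using small_consecutive_levels[OF F, of "e / 4" n] e by auto
  obtain \<sigma> where \<sigma>: "closing n \<sigma> (E n) (E' n)" using n(5) by blast
  have "\<exists>S\<in>odometers M. diff_set M S T \<subseteq> (space M - Y n) \<union> L n (i - 1) \<union> L n i \<union> E n \<union> E' n"
    unfolding Y_def L_def
    by (rule odometer_near_tower[where \<sigma> = \<sigma> and E = "E n" and E' = "E' n", OF M T tower i])
      (use remainder[of n] \<sigma> in \<open>auto simp: closing_def Y_def L_def\<close>)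
  then obtain S where S: "S \<in> odometers M"
    and d: "diff_set M S T \<subseteq> (space M - Y n) \<union> L n (i - 1) \<union> L n i \<union> E n \<union> E' n" by blast
  have SA: "S \<in> Aut M" using S by (simp add: odometers_def)
  have "measure \<nu> (diff_set M S T) < e" if \<nu>: "\<nu> \<in> F" for \<nu>
  proof -
    interpret prob_space \<nu> by (rule \<mu>(1)[OF \<nu>])
    let ?A = "space M - Y n" and ?B = "L n (i - 1)" and ?C = "L n i"
    have m: "?A \<in> sets \<nu>" "?B \<in> sets \<nu>" "?C \<in> sets \<nu>" "E n \<in> sets \<nu>" "E' n \<in> sets \<nu>"
      using \<mu>(2)[OF \<nu>] Y_sets L_sets i EE by auto
    have "measure \<nu> (diff_set M S T) \<le> measure \<nu> (?A \<union> ?B \<union> ?C \<union> E n \<union> E' n)"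
      by (rule finite_measure_mono[OF d]) (use m in auto)
    also have "\<dots> \<le> measure \<nu> (?A \<union> ?B \<union> ?C \<union> E n) + measure \<nu> (E' n)"
      using m by (intro measure_Un_le) auto
    also have "measure \<nu> (?A \<union> ?B \<union> ?C \<union> E n) \<le> measure \<nu> (?A \<union> ?B \<union> ?C) + measure \<nu> (E n)"
      using m by (intro measure_Un_le) auto
    also have "measure \<nu> (?A \<union> ?B \<union> ?C) \<le> measure \<nu> (?A \<union> ?B) + measure \<nu> ?C"
      using m by (intro measure_Un_le) auto
    also have "measure \<nu> (?A \<union> ?B) \<le> measure \<nu> ?A + measure \<nu> ?B"
      using m by (intro measure_Un_le) auto
    finally show ?thesis using Li[OF \<nu>] n(1-3) \<nu> by fastforce
  qed
  then show ?thesis using S SA unfolding tau_nbhd_def by blast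
qed

end

lemma rank_one_approximation:
  assumes "standard_borel M" "rank_one M T" "finite F" "F \<subseteq> borel_probs M" "e > 0"
  shows "\<exists>S\<in>odometers M. S \<in> tau_nbhd M T F e"
proof -
  let ?P = "\<lambda>B h. (\<forall>n. is_tower M T (B n) (h n))
        \<and> (\<forall>n. \<forall>a\<in>atoms T (B (Suc n)) (h (Suc n)).
             (\<exists>b\<in>atoms T (B n) (h n). a \<subseteq> b) \<or> a \<inter> \<Union>(atoms T (B n) (h n)) = {})
        \<and> (\<forall>n. \<Union>(atoms T (B n) (h n)) \<subseteq> \<Union>(atoms T (B (Suc n)) (h (Suc n))))
        \<and> (\<Union>n. \<Union>(atoms T (B n) (h n))) = space M
        \<and> sigma_sets (space M) (\<Union>n. atoms T (B n) (h n)) = sets M"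
  note r = assms(2)[unfolded rank_one_def]
  note T = r[THEN conjunct1] r[THEN conjunct2, THEN conjunct1] r[THEN conjunct2, THEN conjunct2, THEN conjunct1]
  obtain B h where P: "?P B h"
    using r[THEN conjunct2, THEN conjunct2, THEN conjunct2] by (elim exE) (rule that)
  interpret rank_one_towers M T B h
    by (unfold_locales; (rule assms(1) T P[THEN conjunct1, rule_format]
        P[THEN conjunct2, THEN conjunct1, rule_format]
        P[THEN conjunct2, THEN conjunct2, THEN conjunct1, rule_format]
        P[THEN conjunct2, THEN conjunct2, THEN conjunct2, THEN conjunct1]
        P[THEN conjunct2, THEN conjunct2, THEN conjunct2, THEN conjunct2])?; assumption?)
  show ?thesis by (rule approximation[OF assms(3-5)])
qed

text \<open>The odometers are among the rank one automorphisms, and the latter lie in the closure of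
  the former, because every basic neighbourhood of a rank one automorphism contains an
  odometer.\<close>

theorem theorem2p19:
  fixes M :: "'a measure"
  assumes "standard_borel M" and "uncountable (space M)"
  shows "tau M closure_of {T. rank_one M T} = tau M closure_of odometers M"
proof
  have ne: "space M \<noteq> {}" using assms(2) by auto
  have "odometers M \<subseteq> {T. rank_one M T}" using odometers_rank_one[OF assms(2)] by blast
  then show "tau M closure_of odometers M \<subseteq> tau M closure_of {T. rank_one M T}"
    by (rule closure_of_mono)
  have "{T. rank_one M T} \<subseteq> tau M closure_of odometers M"
  proof clarify
    fix T assume T: "rank_one M T"
    show "T \<in> tau M closure_of odometers M"
      unfolding in_closure_of topspace_tau[OF assms(1) ne]
    proof (intro conjI allI impI)
      show "T \<in> Aut M" using T by (simp add: rank_one_def)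
      fix W assume W: "T \<in> W \<and> openin (tau M) W"
      then obtain F e where "finite F" "F \<subseteq> borel_probs M" "e > 0" and sub: "tau_nbhd M T F e \<subseteq> W"
        unfolding openin_tau_iff[OF assms(1)] by blast
      from rank_one_approximation[OF assms(1) T this(1-3)] sub
      show "\<exists>S. S \<in> odometers M \<and> S \<in> W" by blast
    qed
  qed
  then show "tau M closure_of {T. rank_one M T} \<subseteq> tau M closure_of odometers M"
    by (rule closure_of_minimal) simp
qed

end
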